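(* Let $k\in\mathbb{N}$, $k\ge2$, and $y>0$. If $k=2$ and $1<\mathrm{Re}(s)<2$, or if $k>2$ and $1<\mathrm{Re}(s)<3$, then $$\int_0^\infty\left((1+x)^{-s}-1\right)x^{\frac{s+k-2}{1-k}}\cos\!\left(yx^{\frac{1}{k-1}}\right)dx=(k-1)\left\{\frac{2^{s-2}}{\sqrt{\pi(k-1)}\,\Gamma(s)}\mathcal{G}_k(s,y)-y^{s-1}\Gamma(1-s)\sin\!\left(\frac{\pi s}{2}\right)\right\}.$$
   Context: The Meijer $G$-function is $G^{m,n}_{p,q}\!\left(\begin{matrix}\{a_1,\dots,a_n\},\{a_{n+1},\dots,a_p\}\\ \{b_1,\dots,b_m\},\{b_{m+1},\dots,b_q\}\end{matrix}\Big| x\right):=\frac{1}{2\pi i}\int_L\frac{\prod_{j=1}^m\Gamma(b_j-w)\prod_{j=1}^n\Gamma(1-a_j+w)}{\prod_{j=m+1}^q\Gamma(1-b_j+w)\prod_{j=n+1}^p\Gamma(a_j-w)}x^w\,dw$, where $L$ runs from $-i\infty$ to $+i\infty$ separating the poles of the $\Gamma(1-a_j+w)$ from those of the $\Gamma(b_j-w)$. Define $\mathcal{G}_k(s,y):=G^{k+1,2}_{2,2k}\!\left(\begin{matrix}\left\{\frac{2k-3+s}{2k-2},\frac{k-2+s}{2k-2}\right\},\{\}\\ \left\{0,\frac{1}{k-1},\dots,\frac{k-2}{k-1},\frac{sk-1}{2k-2},\frac{sk-1}{2k-2}+\frac12\right\},\left\{\frac{1}{2k-2},\frac{3}{2k-2},\dots,\frac{2k-3}{2k-2}\right\}\end{matrix}\Big|\left(\frac{y}{2k-2}\right)^{2k-2}\right)$.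 *)

theory Defs
  imports "HOL-Complex_Analysis.Complex_Analysis"
begin

text \<open>
  A contour running from \<open>-i\<infinity>\<close> to \<open>+i\<infinity>\<close> is a piecewise continuously differentiable curve that
  agrees with an upward vertical line outside a bounded part. The bounded part is arbitrary; in
  particular it need not be a graph over the imaginary axis, so the contour can also separate
  poles of the same imaginary part in any order.
\<close>
definition vertical_contour :: "(real \<Rightarrow> complex) \<Rightarrow> bool" where
  "vertical_contour \<gamma> \<longleftrightarrow>
     (\<forall>T. \<gamma> piecewise_C1_differentiable_on {-T..T}) \<and>
     (\<exists>c R :: real. \<forall>t. \<bar>t\<bar> \<ge> R \<longrightarrow> \<gamma> t = Complex c t)"

text \<open>
  The left (right) side of a contour is the connected component of its complement that contains
  all points sufficiently far out on the negative (positive) real axis.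
\<close>
definition left_side :: "(real \<Rightarrow> complex) \<Rightarrow> complex set" where
  "left_side \<gamma> = {w. \<forall>\<^sub>F r in at_bot. connected_component (- range \<gamma>) w (complex_of_real r)}"

definition right_side :: "(real \<Rightarrow> complex) \<Rightarrow> complex set" where
  "right_side \<gamma> = {w. \<forall>\<^sub>F r in at_top. connected_component (- range \<gamma>) w (complex_of_real r)}"

text \<open>
  The parameters are passed as four lists: \<open>as = [a\<^sub>1, \<dots>, a\<^sub>n]\<close>, \<open>as' = [a\<^sub>n\<^sub>+\<^sub>1, \<dots>, a\<^sub>p]\<close>,
  \<open>bs = [b\<^sub>1, \<dots>, b\<^sub>m]\<close>, \<open>bs' = [b\<^sub>m\<^sub>+\<^sub>1, \<dots>, b\<^sub>q]\<close>, so that \<open>m, n, p, q\<close> are determined by their lengths.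
  Since \<^term>\<open>Gamma\<close> is \<open>0\<close> at its poles and division by \<open>0\<close> gives \<open>0\<close>, the integrand has its
  correct value (zero) also at the poles of the Gamma factors in the denominator.
\<close>
definition meijer_integrand ::
    "complex list \<Rightarrow> complex list \<Rightarrow> complex list \<Rightarrow> complex list \<Rightarrow> complex \<Rightarrow> complex \<Rightarrow> complex" where
  "meijer_integrand as as' bs bs' x w =
     ((\<Prod>b\<leftarrow>bs. Gamma (b - w)) * (\<Prod>a\<leftarrow>as. Gamma (1 - a + w))) /
     ((\<Prod>b\<leftarrow>bs'. Gamma (1 - b + w)) * (\<Prod>a\<leftarrow>as'. Gamma (a - w))) * x powr w"

definition meijer_contour :: "complex list \<Rightarrow> complex list \<Rightarrow> (real \<Rightarrow> complex) \<Rightarrow> bool" where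
  "meijer_contour as bs \<gamma> \<longleftrightarrow>
     vertical_contour \<gamma> \<and>
     (\<forall>a\<in>set as. {w. is_pole (\<lambda>u. Gamma (1 - a + u)) w} \<subseteq> left_side \<gamma>) \<and>
     (\<forall>b\<in>set bs. {w. is_pole (\<lambda>u. Gamma (b - u)) w} \<subseteq> right_side \<gamma>)"

text \<open>
  The definite description is over the value of the contour integral: it is meaningful when
  a separating contour with convergent integral exists and the value does not depend on it.
\<close>
definition meijer_G ::
    "complex list \<Rightarrow> complex list \<Rightarrow> complex list \<Rightarrow> complex list \<Rightarrow> complex \<Rightarrow> complex" where
  "meijer_G as as' bs bs' x =
     (THE v. \<exists>\<gamma> I. meijer_contour as bs \<gamma> \<and>
        ((\<lambda>t. meijer_integrand as as' bs bs' x (\<gamma> t) * vector_derivative \<gamma> (at t))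
           has_integral I) UNIV \<and>
        v = 1 / (2 * of_real pi * \<i>) * I)"

definition meijer_G_cal :: "nat \<Rightarrow> complex \<Rightarrow> real \<Rightarrow> complex" where
  "meijer_G_cal k s y =
     meijer_G
       [(2 * of_nat k - 3 + s) / (2 * of_nat k - 2), (of_nat k - 2 + s) / (2 * of_nat k - 2)]
       []
       (map (\<lambda>j. of_nat j / (of_nat k - 1)) [0..<k - 1] @
        [(s * of_nat k - 1) / (2 * of_nat k - 2), (s * of_nat k - 1) / (2 * of_nat k - 2) + 1 / 2])
       (map (\<lambda>j. (2 * of_nat j + 1) / (2 * of_nat k - 2)) [0..<k - 1])
       (complex_of_real ((y / (2 * real k - 2)) ^ (2 * k - 2)))"

text \<open>
  For \<open>k > 2\<close> the range of \<open>s\<close> includes \<open>s = 2\<close>, where \<open>\<Gamma>(1 - s)\<close> has a simple pole that is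
  cancelled by the zero of \<open>sin (\<pi> s / 2)\<close>. The product is read as its continuous extension
  (with limit \<open>- \<pi> / 2\<close> at \<open>s = 2\<close>); the plain HOL product would be \<open>0\<close> there. At all other \<open>s\<close>
  with \<open>1 < Re s < 3\<close> this is the plain product.
\<close>
definition Gamma_sin :: "complex \<Rightarrow> complex" where
  "Gamma_sin = remove_sings (\<lambda>u. Gamma (1 - u) * sin (of_real pi * u / 2))"

end

theory Submission
  imports Defs
begin

text \<open>
  Substituting \<open>x = u ^ K\<close> with \<open>K = k - 1\<close> turns the integral into \<open>K\<close> times the cosine transform of
  \<open>((1 + u ^ K) powr (- s) - 1) u powr (- s)\<close>. The bracket is the inverse Mellin transform of
  \<open>\<Gamma>(\<tau>) \<Gamma>(s - \<tau>) / \<Gamma>(s)\<close> along a line with \<open>-1 < Re \<tau> < 0\<close>, and after exchanging the integrals the cosine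
  transform becomes a Mellin-Barnes integral. By the duplication and multiplication formulas its
  integrand is that of the G-function, but the line has the pole \<open>\<tau> = 0\<close>, which a separating contour
  must have on its left, on its right. The residue at this pole is the second term of the formula.
  Independence of the contour follows from the residue theorem: a separating contour and the line,
  cut off at height \<open>T\<close>, form a loop that winds once around \<open>\<tau> = 0\<close> and around no other pole.
\<close>

text \<open>No vertical line separates the poles. In the variable \<open>w\<close> of the G-function
  the pole \<open>\<tau> = 0\<close> is \<open>p0 = (s - 1) / (2 K)\<close>; it belongs to the left
  family but lies to the right of \<open>w = 0\<close>, a pole of the right family. For real
  \<open>s\<close> both are on the real axis, so the contour has to turn back and cannot be a graph
  over the imaginary axis. Hence the sides of a contour are handled by winding numbers and not by
  comparing real parts. Two conditions determine the range of \<open>s\<close>. The line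
  \<open>Re \<tau> = \<sigma>\<close> needs \<open>-1 < \<sigma> < 0\<close>, and
  \<open>1 - Re s - K \<sigma>\<close>, the real part of the exponent in the Laplace transform, is
  to lie between 0 and 1; such a \<open>\<sigma>\<close> exists for \<open>1 < Re s < K + 1\<close>.
  And \<open>Re s < 3\<close> keeps \<open>p0\<close> to the left of the next pole
  \<open>w = 1 / K\<close>.\<close>

section \<open>Decay of the Gamma function in vertical strips\<close>

text \<open>
  By Euler's product, \<open>\<bar>\<Gamma>(x + iy)\<bar> / \<Gamma>(x)\<close> is a product of factors that increase with \<open>x\<close>.
\<close>

lemma Gamma_cmod_mono:
  assumes "0 < x1" "x1 \<le> x2"
  shows "norm (Gamma (Complex x1 y)) * Gamma x2 \<le> norm (Gamma (Complex x2 y)) * Gamma x1"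
proof -
  have n: "norm (rGamma_series (Complex x y) n) = norm (pochhammer (Complex x y) (n+1)) / (fact n * exp (x * ln (real n)))"
    if "n > 0" for x n
    using that by (simp add: rGamma_series_def norm_divide norm_mult norm_exp_eq_Re norm_fact del: of_nat_Suc)
  have poch: "norm (pochhammer (Complex x2 y) n) * pochhammer x1 n \<le> norm (pochhammer (Complex x1 y) n) * pochhammer x2 n" for n
  proof (induction n)
    case (Suc n)
    let ?a = "x1 + real n" let ?b = "x2 + real n"
    have ab: "0 < ?a" "?a \<le> ?b" using assms by auto
    \<comment> \<open>After squaring, the common term \<open>?a\<^sup>2 * ?b\<^sup>2\<close> cancels
      and \<open>?a\<^sup>2 * y\<^sup>2 \<le> ?b\<^sup>2 * y\<^sup>2\<close> is left.\<close>
    have 1: "norm (Complex x2 y + of_nat n) * ?a \<le> norm (Complex x1 y + of_nat n) * ?b"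
    proof (rule power2_le_imp_le)
      have "?a^2 \<le> ?b^2" using ab by (intro power_mono) auto
      then have "?a\<^sup>2 * y\<^sup>2 \<le> ?b\<^sup>2 * y\<^sup>2" by (intro mult_right_mono) auto
      then show "(norm (Complex x2 y + of_nat n) * ?a)\<^sup>2 \<le> (norm (Complex x1 y + of_nat n) * ?b)\<^sup>2"
        unfolding power_mult_distrib cmod_power2 by (simp add: algebra_simps)
    qed (use ab in auto)
    have p: "pochhammer x1 n \<ge> 0" "pochhammer x2 n \<ge> 0" using assms by (auto intro!: pochhammer_nonneg)
    have "(norm (pochhammer (Complex x2 y) n) * pochhammer x1 n) * (norm (Complex x2 y + of_nat n) * ?a)
       \<le> (norm (pochhammer (Complex x1 y) n) * pochhammer x2 n) * (norm (Complex x1 y + of_nat n) * ?b)"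
      using mult_mono[OF Suc 1] ab p by simp
    then show ?case by (simp add: pochhammer_Suc norm_mult mult_ac)
  qed simp
  \<comment> \<open>The denominators agree: each side has \<open>fact n\<close> twice and both
    exponentials \<open>exp (x1 * ln n)\<close> and \<open>exp (x2 * ln n)\<close>.\<close>
  have le: "norm (rGamma_series (Complex x2 y) n) * rGamma_series x1 n \<le> norm (rGamma_series (Complex x1 y) n) * rGamma_series x2 n"
    if "n > 0" for n
    using poch[of "n+1"] that unfolding n[OF that] unfolding rGamma_series_def
    by (simp add: divide_simps mult_ac del: times_complex.sel)
  have "norm (rGamma (Complex x2 y)) * rGamma x1 \<le> norm (rGamma (Complex x1 y)) * rGamma x2"
  proof (rule LIMSEQ_le)
    show "(\<lambda>n. norm (rGamma_series (Complex x2 y) n) * rGamma_series x1 n) \<longlonglongrightarrow> norm (rGamma (Complex x2 y)) * rGamma x1"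
      by (intro tendsto_intros)
    show "(\<lambda>n. norm (rGamma_series (Complex x1 y) n) * rGamma_series x2 n) \<longlonglongrightarrow> norm (rGamma (Complex x1 y)) * rGamma x2"
      by (intro tendsto_intros)
  qed (use le in \<open>auto intro!: exI[of _ 1]\<close>)
  moreover have "Complex x1 y \<notin> \<int>\<^sub>\<le>\<^sub>0" "Complex x2 y \<notin> \<int>\<^sub>\<le>\<^sub>0"
    using assms by (auto elim!: nonpos_Ints_cases simp: complex_eq_iff)
  then have "Gamma (Complex x1 y) \<noteq> 0" "Gamma (Complex x2 y) \<noteq> 0" by (auto simp: Gamma_eq_zero_iff)
  ultimately show ?thesis using Gamma_real_pos[of x1] Gamma_real_pos[of x2] assms
    by (simp add: rGamma_inverse_Gamma norm_inverse norm_divide field_simps)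
qed

lemma Complex_notin_nonpos_Ints: "y \<noteq> 0 \<Longrightarrow> Complex x y \<notin> \<int>\<^sub>\<le>\<^sub>0"
  by (auto elim!: nonpos_Ints_cases simp: complex_eq_iff)

text \<open>Monotonicity applies to positive abscissas in the right order, so both arguments are
  first shifted by integers. The shift of \<open>x1\<close> multiplies by a factor of norm at least
  1, since \<open>|y| \<ge> 1\<close>, and that of \<open>x2\<close> by at most a constant times a
  power of \<open>|y|\<close>.\<close>

lemma Gamma_cmod_ratio_bound:
  assumes "M \<ge> 0"
  shows "\<exists>C>0. \<exists>n::nat. \<forall>x1 x2 y. \<bar>x1\<bar> \<le> M \<and> \<bar>x2\<bar> \<le> M \<and> \<bar>y\<bar> \<ge> 1 \<longrightarrow>
           norm (Gamma (Complex x1 y)) \<le> C * \<bar>y\<bar> ^ n * norm (Gamma (Complex x2 y))"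
proof -
  define m where "m = nat \<lceil>M\<rceil> + 1"
  have m: "real m \<ge> M + 1" unfolding m_def by linarith
  define B where "B = 4 * real m"
  have "continuous_on {1..B} (Gamma :: real \<Rightarrow> real)"
    by (intro continuous_intros) (auto elim!: nonpos_Ints_cases)
  moreover have "{1..B} \<noteq> {}" using m assms by (auto simp: B_def)
  ultimately obtain a b where a: "a \<in> {1..B}" "\<And>x. x \<in> {1..B} \<Longrightarrow> Gamma a \<le> (Gamma x::real)"
      and b: "b \<in> {1..B}" "\<And>x. x \<in> {1..B} \<Longrightarrow> (Gamma x::real) \<le> Gamma b"
    using continuous_attains_inf[of "{1..B}" Gamma] continuous_attains_sup[of "{1..B}" Gamma]
    by (metis compact_Icc)
  have ga: "Gamma a > 0" "Gamma b > 0" using a b by auto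
  \<comment> \<open>With \<open>m \<ge> M + 1\<close> this yields
    \<open>1 \<le> x1 + m \<le> x2 + k \<le> B\<close>.\<close>
  define k where "k = 3 * m"
  define C where "C = Gamma b / Gamma a * (4 * real m + 1) ^ k"
  show ?thesis
  proof (intro exI[of _ C] exI[of _ k] conjI allI impI)
    show "C > 0" using ga by (simp add: C_def)
    fix x1 x2 y :: real assume *: "\<bar>x1\<bar> \<le> M \<and> \<bar>x2\<bar> \<le> M \<and> \<bar>y\<bar> \<ge> 1"
    have shift: "Gamma (Complex x y + of_nat n) = pochhammer (Complex x y) n * Gamma (Complex x y)" for x n
      using * pochhammer_Gamma[of "Complex x y" n] Complex_notin_nonpos_Ints[of y x] by (auto simp: Gamma_eq_zero_iff)
    have "1 \<le> norm (pochhammer (Complex x1 y) m)"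
    proof -
      have "1 \<le> norm (Complex x1 y + of_nat i)" for i
        using abs_Im_le_cmod[of "Complex x1 y + of_nat i"] * by simp
      then show ?thesis by (simp add: pochhammer_prod prod_norm[symmetric] prod_ge_1)
    qed
    then have 1: "norm (Gamma (Complex x1 y)) \<le> norm (Gamma (Complex (x1 + m) y))"
      using shift[of x1 m] mult_right_mono[of 1 "norm (pochhammer (Complex x1 y) m)" "norm (Gamma (Complex x1 y))"]
      by (simp add: Complex_eq norm_mult algebra_simps)
    have "norm (pochhammer (Complex x2 y) k) \<le> ((4 * real m + 1) * \<bar>y\<bar>) ^ k"
    proof -
      have "norm (Complex x2 y + of_nat i) \<le> (4 * real m + 1) * \<bar>y\<bar>" if "i < k" for i
      proof -
        have "norm (Complex x2 y + of_nat i) \<le> \<bar>x2 + i\<bar> + \<bar>y\<bar>"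
          using cmod_le[of "Complex x2 y + of_nat i"] by simp
        also have "real i \<le> 3 * real m" using that by (simp add: k_def)
        then have "\<bar>x2 + i\<bar> + \<bar>y\<bar> \<le> (4 * real m) * 1 + \<bar>y\<bar>" using * m by (auto simp: abs_le_iff)
        also have "\<dots> \<le> (4 * real m) * \<bar>y\<bar> + \<bar>y\<bar>" using * by (intro add_right_mono mult_left_mono) auto
        finally show ?thesis by (simp add: algebra_simps)
      qed
      then have "(\<Prod>i<k. norm (Complex x2 y + of_nat i)) \<le> (\<Prod>i<k. (4 * real m + 1) * \<bar>y\<bar>)"
        by (intro prod_mono) auto
      then show ?thesis by (simp add: pochhammer_prod prod_norm[symmetric] atLeast0LessThan)
    qed
    then have 2: "norm (Gamma (Complex (x2 + k) y)) \<le> ((4 * real m + 1) * \<bar>y\<bar>) ^ k * norm (Gamma (Complex x2 y))"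
    proof -
      have "Complex (x2 + k) y = Complex x2 y + of_nat k" by (simp add: complex_eq_iff)
      then show ?thesis using \<open>norm (pochhammer (Complex x2 y) k) \<le> _\<close>
        by (simp only: shift norm_mult mult_right_mono norm_ge_zero)
    qed
    have x: "0 < x1 + m" "x1 + m \<le> x2 + k" "x1 + m \<in> {1..B}" "x2 + k \<in> {1..B}"
      using * m by (auto simp: k_def B_def abs_le_iff)
    have g2: "Gamma (x2 + k) \<ge> Gamma a" "Gamma (x1 + m) \<le> Gamma b" using a b x by auto
    have "norm (Gamma (Complex (x1 + m) y)) * Gamma a \<le> norm (Gamma (Complex (x1 + m) y)) * Gamma (x2 + k)"
      using g2 by (intro mult_left_mono) auto
    also have "\<dots> \<le> norm (Gamma (Complex (x2 + k) y)) * Gamma (x1 + m)"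
      by (rule Gamma_cmod_mono) (use x in auto)
    also have "\<dots> \<le> norm (Gamma (Complex (x2 + k) y)) * Gamma b"
      using g2 by (intro mult_left_mono) auto
    also have "\<dots> \<le> (((4 * real m + 1) * \<bar>y\<bar>) ^ k * norm (Gamma (Complex x2 y))) * Gamma b"
      using 2 ga by (intro mult_right_mono) auto
    finally have "norm (Gamma (Complex (x1 + m) y)) \<le> C * \<bar>y\<bar> ^ k * norm (Gamma (Complex x2 y))"
      using ga unfolding power_mult_distrib by (simp add: C_def divide_simps mult_ac)
    with 1 show "norm (Gamma (Complex x1 y)) \<le> C * \<bar>y\<bar> ^ k * norm (Gamma (Complex x2 y))" by linarith
  qed
qed

lemma norm_sin_ge:
  assumes "\<bar>Im z\<bar> \<ge> 1"
  shows "norm (sin z) \<ge> exp \<bar>Im z\<bar> / 4"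
proof -
  define e where "e = exp \<bar>Im z\<bar>"
  have "sin z = (exp (\<i> * z) - exp (-(\<i> * z))) / (2 * \<i>)" by (simp add: sin_exp_eq)
  then have "norm (sin z) = norm (exp (\<i> * z) - exp (-(\<i> * z))) / 2" by (simp add: norm_divide norm_mult)
  moreover have "norm (exp (\<i> * z) - exp (-(\<i> * z))) \<ge> \<bar>norm (exp (\<i> * z)) - norm (exp (-(\<i> * z)))\<bar>"
    by (rule norm_triangle_ineq3)
  moreover have "norm (exp (\<i> * z)) = exp (- Im z)" "norm (exp (-(\<i> * z))) = exp (Im z)"
    by (simp_all add: norm_exp_eq_Re)
  moreover have "\<bar>exp (- Im z) - exp (Im z)\<bar> \<ge> e / 2"
  proof -
    have "e \<ge> 2" using exp_ge_add_one_self[of "\<bar>Im z\<bar>"] assms unfolding e_def by linarith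
    then have "inverse e \<le> 1/2" by (simp add: field_simps)
    moreover have "\<bar>exp (- Im z) - exp (Im z)\<bar> = \<bar>inverse e - e\<bar>"
      by (cases "Im z \<ge> 0") (auto simp: e_def exp_minus)
    ultimately show ?thesis using \<open>e \<ge> 2\<close> by linarith
  qed
  ultimately show ?thesis by (simp add: e_def)
qed

lemma power_le_exp_bound:
  fixes \<eta> :: real
  assumes "\<eta> > 0"
  shows "\<exists>C>0. \<forall>y\<ge>0. y ^ n \<le> C * exp (\<eta> * y)"
proof (cases "n = 0")
  case False
  show ?thesis
  proof (intro exI[of _ "(n / \<eta>) ^ n"] conjI allI impI)
    fix y :: real assume y: "y \<ge> 0"
    have "(\<eta> * y / n) ^ n \<le> (1 + \<eta> * y / n) ^ n" using y assms by (intro power_mono) auto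
    also have "\<dots> \<le> exp (\<eta> * y)"
      using y assms False order_trans[OF _ mult_nonneg_nonneg[of \<eta> y], of "- real n"]
      by (intro exp_ge_one_plus_x_over_n_power_n) auto
    finally show "y ^ n \<le> (n / \<eta>) ^ n * exp (\<eta> * y)"
      using assms False by (simp add: field_simps power_mult_distrib)
  qed (use assms False in auto)
qed (use assms in \<open>auto intro!: exI[of _ 1]\<close>)

text \<open>
  The reflection formula gives the decay of \<open>\<Gamma>(z) \<Gamma>(1 - z)\<close>, and the two factors are comparable
  because \<open>\<bar>\<Gamma>(1 - z)\<bar> = \<bar>\<Gamma>(1 - x + iy)\<bar>\<close>.
\<close>

lemma Gamma_cmod_exp_bound:
  assumes "M \<ge> 0" "\<eta> > 0"
  shows "\<exists>C>0. \<forall>z. \<bar>Re z\<bar> \<le> M \<and> \<bar>Im z\<bar> \<ge> 1 \<longrightarrow> norm (Gamma z) \<le> C * exp (-(pi/2 - \<eta>) * \<bar>Im z\<bar>)"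
proof -
  obtain C n where C: "C > 0" and CC: "\<And>x1 x2 y. \<bar>x1\<bar> \<le> M + 1 \<Longrightarrow> \<bar>x2\<bar> \<le> M + 1 \<Longrightarrow> \<bar>y\<bar> \<ge> 1 \<Longrightarrow>
      norm (Gamma (Complex x1 y)) \<le> C * \<bar>y\<bar> ^ n * norm (Gamma (Complex x2 y))"
    using Gamma_cmod_ratio_bound[of "M + 1"] assms by (metis add_nonneg_nonneg zero_le_one)
  \<comment> \<open>The estimate below is for the square of the norm, hence
    \<open>2 * \<eta>\<close>.\<close>
  obtain D where D: "D > 0" and DD: "\<And>y. y \<ge> 0 \<Longrightarrow> y ^ n \<le> D * exp (2 * \<eta> * y)"
    using power_le_exp_bound[of "2 * \<eta>" n] assms by auto
  define E where "E = sqrt (C * D * 4 * pi)"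
  show ?thesis
  proof (intro exI[of _ E] conjI allI impI)
    show "E > 0" using C D by (simp add: E_def)
    fix z assume z: "\<bar>Re z\<bar> \<le> M \<and> \<bar>Im z\<bar> \<ge> 1"
    define x where "x = Re z" define y where "y = Im z"
    have zz: "z = Complex x y" by (simp add: x_def y_def)
    have "norm (Gamma (Complex x y)) \<le> C * \<bar>y\<bar> ^ n * norm (Gamma (Complex (1 - x) y))"
      by (rule CC) (use z in \<open>auto simp: x_def y_def\<close>)
    also have "Gamma (Complex (1 - x) y) = cnj (Gamma (1 - z))"
      by (simp add: cnj_Gamma zz complex_eq_iff) (metis complex_cnj cnj_Gamma complex_eq_iff minus_complex.simps one_complex.simps complex.sel diff_0 minus_minus complex_cnj_diff complex_cnj_one Complex_eq)
    finally have 1: "norm (Gamma z) \<le> C * \<bar>y\<bar> ^ n * norm (Gamma (1 - z))" by (simp add: zz)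
    have "norm (Gamma z) * norm (Gamma (1 - z)) = pi / norm (sin (of_real pi * z))"
      by (simp add: norm_mult[symmetric] Gamma_reflection_complex norm_divide)
    also have "\<dots> \<le> pi / (exp (pi * \<bar>y\<bar>) / 4)"
    proof (intro divide_left_mono)
      have "\<bar>Im (of_real pi * z)\<bar> = pi * \<bar>y\<bar>" by (simp add: y_def abs_mult)
      moreover have "pi * \<bar>y\<bar> \<ge> 1 * 1" using z pi_ge_two by (intro mult_mono) (auto simp: y_def)
      ultimately show "exp (pi * \<bar>y\<bar>) / 4 \<le> norm (sin (of_real pi * z))"
        using norm_sin_ge[of "of_real pi * z"] by simp
      then have "0 < norm (sin (of_real pi * z))" by (rule less_le_trans[rotated]) simp
      then show "0 < norm (sin (of_real pi * z)) * (exp (pi * \<bar>y\<bar>) / 4)" by simp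
    qed auto
    finally have 2: "norm (Gamma z) * norm (Gamma (1 - z)) \<le> 4 * pi * exp (- pi * \<bar>y\<bar>)" by (simp add: exp_minus field_simps)
    have "norm (Gamma z) ^ 2 \<le> norm (Gamma z) * (C * \<bar>y\<bar> ^ n * norm (Gamma (1 - z)))"
      unfolding power2_eq_square by (rule mult_left_mono[OF 1]) auto
    also have "\<dots> = C * \<bar>y\<bar> ^ n * (norm (Gamma z) * norm (Gamma (1 - z)))" by simp
    also have "\<dots> \<le> C * (D * exp (2 * \<eta> * \<bar>y\<bar>)) * (4 * pi * exp (- pi * \<bar>y\<bar>))"
      using 2 C D DD[of "\<bar>y\<bar>"] by (intro mult_mono[OF mult_left_mono]) auto
    also have "\<dots> = C * D * 4 * pi * (exp (2 * \<eta> * \<bar>y\<bar>) * exp (- pi * \<bar>y\<bar>))" by simp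
    also have "exp (2 * \<eta> * \<bar>y\<bar>) * exp (- pi * \<bar>y\<bar>) = (exp (-(pi/2 - \<eta>) * \<bar>y\<bar>))^2"
      unfolding power2_eq_square exp_add[symmetric] by (rule arg_cong[of _ _ exp]) algebra
    also have "C * D * 4 * pi * (exp (-(pi/2 - \<eta>) * \<bar>y\<bar>))^2 = (E * exp (-(pi/2 - \<eta>) * \<bar>y\<bar>))^2"
    proof -
      have "E^2 = C * D * 4 * pi" unfolding E_def using C D by (intro real_sqrt_pow2) auto
      then show ?thesis by (simp add: power_mult_distrib)
    qed
    finally show "norm (Gamma z) \<le> E * exp (-(pi/2 - \<eta>) * \<bar>Im z\<bar>)"
      unfolding y_def by (rule power2_le_imp_le) (use \<open>E > 0\<close> in simp)
  qed
qed

section \<open>Winding numbers of contours and contour shifting\<close>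

definition contour_path :: "(real \<Rightarrow> complex) \<Rightarrow> real \<Rightarrow> real \<Rightarrow> complex" where
  "contour_path \<gamma> T = (\<lambda>u. \<gamma> (2 * T * u - T))"

text \<open>
  The truncated contour is closed along the vertical line \<open>Re w = A\<close>. The abscissa \<open>A\<close> may lie on
  either side of \<open>c\<close>: a far away \<open>A\<close> gives the winding numbers, and \<open>A = a\<close> compares the contour
  with the line \<open>Re w = a\<close>.
\<close>

definition closing_path :: "real \<Rightarrow> real \<Rightarrow> real \<Rightarrow> real \<Rightarrow> complex" where
  "closing_path c A T = linepath (Complex c T) (Complex A T) +++ linepath (Complex A T) (Complex A (-T))
     +++ linepath (Complex A (-T)) (Complex c (-T))"

definition closed_contour :: "(real \<Rightarrow> complex) \<Rightarrow> real \<Rightarrow> real \<Rightarrow> real \<Rightarrow> real \<Rightarrow> complex" where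
  "closed_contour \<gamma> c A T = contour_path \<gamma> T +++ closing_path c A T"

section \<open>Truncated contours as paths over the unit interval\<close>

lemma valid_contour_path:
  assumes "\<gamma> piecewise_C1_differentiable_on {-T..T}" "T > 0"
  shows "valid_path (contour_path \<gamma> T)"
proof -
  have "(\<gamma> \<circ> (\<lambda>u. 2 * T * u - T)) piecewise_C1_differentiable_on {0..1}"
  proof (rule piecewise_C1_differentiable_compose)
    show "(\<lambda>u. 2 * T * u - T) piecewise_C1_differentiable_on {0..1}"
      by (intro C1_differentiable_imp_piecewise)
         (auto simp: C1_differentiable_on_def intro!: exI[of _ "\<lambda>_. 2 * T"] derivative_eq_intros)
    have "(\<lambda>u. 2 * T * u - T) ` {0..1} \<subseteq> {-T..T}"
    proof safe
      fix u :: real assume "u \<in> {0..1}"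
      then have "T * u \<le> T * 1" "0 \<le> T * u" using assms by (intro mult_left_mono, auto)
      then show "2 * T * u - T \<in> {-T..T}" by auto
    qed
    then show "\<gamma> piecewise_C1_differentiable_on ((\<lambda>u. 2 * T * u - T) ` {0..1})"
      by (rule piecewise_C1_differentiable_on_subset[OF assms(1)])
    show "finite ({0..1} \<inter> (\<lambda>u. 2 * T * u - T) -` {x})" for x
    proof (rule finite_subset)
      show "{0..1} \<inter> (\<lambda>u. 2 * T * u - T) -` {x} \<subseteq> {(x + T) / (2 * T)}"
        using assms by (auto simp: field_simps)
    qed auto
  qed
  then show ?thesis by (simp add: valid_path_def contour_path_def o_def)
qed

lemma path_image_contour_path:
  assumes "T > 0" shows "path_image (contour_path \<gamma> T) = \<gamma> ` {-T..T}"
proof -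
  have "(\<lambda>u. 2 * T * u - T) ` {0..1} = {-T..T}"
    using image_affinity_atLeastAtMost[of "2*T" "-T" 0 1] assms by simp
  then have "\<gamma> ` (\<lambda>u. 2 * T * u - T) ` {0..1} = \<gamma> ` {-T..T}" by simp
  then show ?thesis unfolding path_image_def contour_path_def by (simp add: image_image)
qed

lemma contour_path_ends [simp]:
  "pathstart (contour_path \<gamma> T) = \<gamma> (-T)" "pathfinish (contour_path \<gamma> T) = \<gamma> T"
  by (simp_all add: pathstart_def pathfinish_def contour_path_def)

lemma closing_path_props [simp]:
  "valid_path (closing_path c A T)"
  "pathstart (closing_path c A T) = Complex c T" "pathfinish (closing_path c A T) = Complex c (-T)"
  "path_image (closing_path c A T) = closed_segment (Complex c T) (Complex A T) \<union>
     closed_segment (Complex A T) (Complex A (-T)) \<union> closed_segment (Complex A (-T)) (Complex c (-T))"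
  by (auto simp: closing_path_def path_image_join)

text \<open>Links contour integrals to the integral over \<open>t\<close> that occurs in
  \<open>meijer_G\<close>. The derivatives match only off the corners and the endpoints, where the
  derivative within \<open>{0..1}\<close> may differ from the two-sided one of
  \<open>\<gamma>\<close>; these are finitely many points.\<close>

lemma has_contour_integral_contour_path:
  assumes "T > 0" "\<gamma> piecewise_C1_differentiable_on {-T..T}"
  shows "(f has_contour_integral I) (contour_path \<gamma> T) \<longleftrightarrow>
    ((\<lambda>t. f (\<gamma> t) * vector_derivative \<gamma> (at t)) has_integral I) {-T..T}" (is "?A = ?B")
proof -
  let ?h = "\<lambda>t. f (\<gamma> t) * vector_derivative \<gamma> (at t)"
  obtain S where S: "finite S" "\<gamma> C1_differentiable_on {-T..T} - S"
    using assms(2) by (auto simp: piecewise_C1_differentiable_on_def)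
  define S' where "S' = (\<lambda>t. (t + T) / (2 * T)) ` S"
  have vd: "vector_derivative (contour_path \<gamma> T) (at u within {0..1}) = 2 * T * vector_derivative \<gamma> (at (2 * T * u - T))"
    if u: "u \<in> {0..1} - (S' \<union> {0,1})" for u
  proof -
    let ?t = "2 * T * u - T"
    have "T * u < T * 1" "0 < T * u" using u assms by (intro mult_strict_left_mono, auto)
    moreover have "?t \<notin> S"
    proof
      assume "?t \<in> S"
      then have "(?t + T) / (2 * T) \<in> S'" unfolding S'_def by (rule imageI)
      then show False using u assms by simp
    qed
    moreover from calculation have "?t \<le> T" "-T \<le> ?t" by linarith+
    ultimately have "?t \<in> {-T..T} - S" by simp
    then obtain D where D: "(\<gamma> has_vector_derivative D) (at ?t)"
      using S(2) unfolding C1_differentiable_on_def by blast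
    have "((\<lambda>u. 2 * T * u - T) has_vector_derivative 2 * T) (at u)"
      by (auto intro!: derivative_eq_intros)
    from vector_diff_chain_at[OF this D]
    have "(contour_path \<gamma> T has_vector_derivative (2 * T) *\<^sub>R D) (at u)"
      unfolding contour_path_def o_def .
    then have "(contour_path \<gamma> T has_vector_derivative (2 * T) *\<^sub>R D) (at u within {0..1})"
      by (rule has_vector_derivative_at_within)
    then have "vector_derivative (contour_path \<gamma> T) (at u within {0..1}) = (2 * T) *\<^sub>R D"
      by (rule vector_derivative_within_closed_interval[rotated 2]) (use u in auto)
    then show ?thesis
      by (simp only: vector_derivative_at[OF D] scaleR_conv_of_real)
  qed
  have "?A \<longleftrightarrow> ((\<lambda>u. f (contour_path \<gamma> T u) * vector_derivative (contour_path \<gamma> T) (at u within {0..1})) has_integral I) {0..1}"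
    by (simp add: has_contour_integral_def)
  also have "\<dots> \<longleftrightarrow> ((\<lambda>u. 2 * T * ?h (2 * T * u - T)) has_integral I) {0..1}"
  proof (rule has_integral_spike_finite_eq)
    show "finite (S' \<union> {0,1})" using S by (simp add: S'_def)
    show "2 * T * ?h (2 * T * u - T) = f (contour_path \<gamma> T u) * vector_derivative (contour_path \<gamma> T) (at u within {0..1})"
      if "u \<in> {0..1} - (S' \<union> {0,1})" for u
      by (subst vd[OF that]) (simp add: contour_path_def)
  qed
  also have "\<dots> \<longleftrightarrow> ?B"
  proof
    assume "((\<lambda>u. 2 * T * ?h (2 * T * u - T)) has_integral I) {0..1}"
    from has_integral_affinity'[where m = "1 / (2*T)" and c = "1/2", OF this[folded cbox_interval]] assms
    have "((\<lambda>x. 2 * T * ?h x) has_integral (2 * T) *\<^sub>R I) {-T..T}"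
      by (simp add: field_simps)
    from has_integral_mult_right[OF this, of "1 / (2 * T)"] assms show ?B
      by (simp add: scaleR_conv_of_real)
  next
    assume ?B
    from has_integral_affinity'[where m = "2*T" and c = "-T", OF this[folded cbox_interval]] assms
    have "((\<lambda>x. ?h (2 * T * x - T)) has_integral I /\<^sub>R (2 * T)) {0..1}"
      by simp
    from has_integral_mult_right[OF this, of "2 * T"]
    have "((\<lambda>u. 2 * T * ?h (2 * T * u - T)) has_integral 2 * T * (I /\<^sub>R (2 * T))) {0..1}" .
    moreover have "2 * T * (I /\<^sub>R (2 * T)) = I" using assms by (simp add: scaleR_conv_of_real field_simps)
    ultimately show "((\<lambda>u. 2 * T * ?h (2 * T * u - T)) has_integral I) {0..1}" by (simp only:)
  qed
  finally show ?thesis .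
qed

text \<open>The contour lies in one vertical strip. A half-plane or strip that contains a whole loop
  then shows that points further out have winding number 0.\<close>

lemma vertical_contour_bound:
  assumes "\<And>T. \<gamma> piecewise_C1_differentiable_on {-T..T}" "\<forall>t. \<bar>t\<bar> \<ge> R \<longrightarrow> \<gamma> t = Complex c t"
  shows "\<exists>M\<ge>\<bar>R\<bar> + 1. (\<forall>t. \<bar>Re (\<gamma> t)\<bar> \<le> M) \<and> (\<forall>t. \<bar>Im (\<gamma> t)\<bar> \<le> max M \<bar>t\<bar>)"
proof -
  have "continuous_on {-\<bar>R\<bar>..\<bar>R\<bar>} \<gamma>" using assms(1) by (auto simp: piecewise_C1_differentiable_on_def)
  then have "bounded (\<gamma> ` {-\<bar>R\<bar>..\<bar>R\<bar>})" by (intro compact_imp_bounded compact_continuous_image) auto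
  then obtain b where b: "\<And>t. t \<in> {-\<bar>R\<bar>..\<bar>R\<bar>} \<Longrightarrow> norm (\<gamma> t) \<le> b" by (force simp: bounded_iff)
  define M where "M = max b (\<bar>R\<bar> + \<bar>c\<bar> + 1)"
  have "\<bar>Re (\<gamma> t)\<bar> \<le> M \<and> \<bar>Im (\<gamma> t)\<bar> \<le> max M \<bar>t\<bar>" for t
  proof (cases "t \<in> {-\<bar>R\<bar>..\<bar>R\<bar>}")
    case True
    then show ?thesis using b[OF True] abs_Re_le_cmod[of "\<gamma> t"] abs_Im_le_cmod[of "\<gamma> t"] by (auto simp: M_def)
  next
    case False
    then have "\<bar>t\<bar> \<ge> R" by auto
    then have "\<gamma> t = Complex c t" using assms(2) by auto
    then show ?thesis by (auto simp: M_def)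
  qed
  moreover have "M \<ge> \<bar>R\<bar> + 1" by (auto simp: M_def)
  ultimately show ?thesis by blast
qed

text \<open>It makes the complement open, so that its connected components are path
  components.\<close>

lemma closed_range_contour:
  assumes "\<And>T. \<gamma> piecewise_C1_differentiable_on {-T..T}" "\<forall>t. \<bar>t\<bar> \<ge> R \<longrightarrow> \<gamma> t = Complex c t"
  shows "closed (range \<gamma>)"
proof -
  have "continuous_on {-\<bar>R\<bar>..\<bar>R\<bar>} \<gamma>" using assms(1) by (auto simp: piecewise_C1_differentiable_on_def)
  then have "compact (\<gamma> ` {-\<bar>R\<bar>..\<bar>R\<bar>})" by (intro compact_continuous_image) auto
  moreover have "closed (Complex c ` {t. \<bar>t\<bar> \<ge> \<bar>R\<bar>})"
  proof -
    have "Complex c ` {t. \<bar>t\<bar> \<ge> \<bar>R\<bar>} = {z. Re z = c} \<inter> {z. \<bar>Im z\<bar> \<ge> \<bar>R\<bar>}"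
      by (force simp: image_iff complex_eq_iff)
    moreover have "closed {z. Re z = c}" "closed {z. \<bar>Im z\<bar> \<ge> \<bar>R\<bar>}"
      by (auto intro!: closed_Collect_eq closed_Collect_le continuous_intros)
    ultimately show ?thesis by (simp add: closed_Int)
  qed
  moreover have "range \<gamma> = \<gamma> ` {-\<bar>R\<bar>..\<bar>R\<bar>} \<union> Complex c ` {t. \<bar>t\<bar> \<ge> \<bar>R\<bar>}"
  proof -
    have "UNIV = {-\<bar>R\<bar>..\<bar>R\<bar>} \<union> {t. \<bar>t\<bar> \<ge> \<bar>R\<bar>}" by auto
    then have "range \<gamma> = \<gamma> ` {-\<bar>R\<bar>..\<bar>R\<bar>} \<union> \<gamma> ` {t. \<bar>t\<bar> \<ge> \<bar>R\<bar>}" by (metis image_Un)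
    moreover have "\<gamma> ` {t. \<bar>t\<bar> \<ge> \<bar>R\<bar>} = Complex c ` {t. \<bar>t\<bar> \<ge> \<bar>R\<bar>}"
      using assms(2) by (intro image_cong) auto
    ultimately show ?thesis by simp
  qed
  ultimately show ?thesis by (simp add: compact_imp_closed closed_Un)
qed

text \<open>
  A point on the left side reaches the far left by a bounded path that avoids the contour, and
  this path also avoids the far right rectangle that closes the contour. The sign \<open>\<sigma>\<close> treats both
  sides at once.
\<close>

lemma winding_number_closed_contour_eq_0:
  assumes v: "\<And>T. \<gamma> piecewise_C1_differentiable_on {-T..T}" "\<forall>t. \<bar>t\<bar> \<ge> R \<longrightarrow> \<gamma> t = Complex c t"
    and far: "\<sigma> = 1 \<and> p \<in> left_side \<gamma> \<or> \<sigma> = -1 \<and> p \<in> right_side \<gamma>"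
  shows "\<exists>B. \<forall>A T. A \<ge> B \<and> T \<ge> B \<longrightarrow> p \<notin> path_image (closed_contour \<gamma> c (\<sigma> * A) T) \<and> winding_number (closed_contour \<gamma> c (\<sigma> * A) T) p = 0"
proof -
  obtain M where M: "M \<ge> \<bar>R\<bar> + 1" "\<And>t. \<bar>Re (\<gamma> t)\<bar> \<le> M" "\<And>t. \<bar>Im (\<gamma> t)\<bar> \<le> max M \<bar>t\<bar>"
    using vertical_contour_bound[OF v] by blast
  have s: "\<sigma> = 1 \<or> \<sigma> = -1" using far by auto
  \<comment> \<open>\<open>r\<close> is taken beyond the strip of the contour, on the side of
    \<open>p\<close>.\<close>
  obtain r where r: "\<sigma> * r < -M" "connected_component (- range \<gamma>) p (complex_of_real r)"
  proof -
    have "\<sigma> = 1 \<Longrightarrow> \<exists>r. r < -M \<and> connected_component (- range \<gamma>) p (complex_of_real r)"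
      using far eventually_happens[OF eventually_conj[OF _ eventually_gt_at_bot[of "-M"]]]
      by (force simp: left_side_def)
    moreover have "\<sigma> = -1 \<Longrightarrow> \<exists>r. r > M \<and> connected_component (- range \<gamma>) p (complex_of_real r)"
      using far eventually_happens[OF eventually_conj[OF _ eventually_gt_at_top[of "M"]]]
      by (force simp: right_side_def)
    ultimately show ?thesis using that s by fastforce
  qed
  have "open (- range \<gamma>)" using closed_range_contour[OF v] by auto
  then have "path_component (- range \<gamma>) p (complex_of_real r)"
    using r open_path_connected_component by metis
  then obtain h where h: "path h" "path_image h \<subseteq> - range \<gamma>" "pathstart h = p" "pathfinish h = complex_of_real r"
    by (auto simp: path_component_def)
  obtain b where b: "\<And>z. z \<in> path_image h \<Longrightarrow> norm z < b"
    using bounded_path_image[OF h(1)] bounded_pos_less[of "path_image h"] by blast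
  define B where "B = max b (M + 1)"
  show ?thesis
  proof (intro exI[of _ B] allI impI, elim conjE)
    fix A T assume AT: "A \<ge> B" "T \<ge> B"
    have T: "T > 0" "\<bar>R\<bar> \<le> T" "T \<ge> b" "A \<ge> M" "A \<ge> b" "\<bar>c\<bar> \<le> M" using AT M(1) M(2)[of "\<bar>R\<bar>"] v(2) by (auto simp: B_def)
    let ?L = "closed_contour \<gamma> c (\<sigma> * A) T"
    have ends: "\<gamma> T = Complex c T" "\<gamma> (-T) = Complex c (-T)" using v(2) T by auto
    have val: "valid_path ?L" unfolding closed_contour_def
      using T v(1) ends by (intro valid_path_join valid_contour_path) auto
    have loop: "pathfinish ?L = pathstart ?L" by (simp add: closed_contour_def ends)
    have img: "path_image ?L = \<gamma> ` {-T..T} \<union> (closed_segment (Complex c T) (Complex (\<sigma>*A) T) \<union>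
     closed_segment (Complex (\<sigma>*A) T) (Complex (\<sigma>*A) (-T)) \<union> closed_segment (Complex (\<sigma>*A) (-T)) (Complex c (-T)))"
      unfolding closed_contour_def using T ends by (subst path_image_join) (auto simp: path_image_contour_path)
    have far1: "norm z \<ge> b" if "z \<in> closed_segment (Complex c T) (Complex (\<sigma>*A) T) \<union>
     closed_segment (Complex (\<sigma>*A) T) (Complex (\<sigma>*A) (-T)) \<union> closed_segment (Complex (\<sigma>*A) (-T)) (Complex c (-T))" for z
    proof -
      have "\<bar>Im z\<bar> = T \<or> \<bar>Re z\<bar> = A"
        using that s T M(1) by (auto simp: closed_segment_same_Im closed_segment_same_Re)
      then show ?thesis using T abs_Re_le_cmod[of z] abs_Im_le_cmod[of z] by auto
    qed
    have dis: "path_image h \<inter> path_image ?L = {}"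
      using h(2) far1 b unfolding img by fastforce
    have "p \<in> path_image h" "complex_of_real r \<in> path_image h" using h by (metis pathstart_in_path_image, metis pathfinish_in_path_image)
    then have "winding_number ?L p = winding_number ?L (complex_of_real r)"
      using winding_number_eq[OF valid_path_imp_path[OF val] loop, of p "path_image h" "complex_of_real r"] h dis
      by (simp add: connected_path_image)
    \<comment> \<open>The loop lies in the half-plane \<open>\<sigma> * Re z \<ge> - M\<close>, and
      \<open>r\<close> does not.\<close>
    also have "\<dots> = 0"
    proof (rule winding_number_zero_outside)
      show "convex {z. \<sigma> * Re z \<ge> -M}"
        using s convex_halfspace_Re_ge[of "-M"] convex_halfspace_Re_le[of M] by auto
      show "path_image ?L \<subseteq> {z. \<sigma> * Re z \<ge> -M}"
      proof
        fix z assume "z \<in> path_image ?L"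
        then consider t where "z = \<gamma> t" | "Re z \<in> closed_segment c (\<sigma>*A)"
          unfolding img by (auto simp: closed_segment_same_Im closed_segment_same_Re closed_segment_commute)
        then show "z \<in> {z. \<sigma> * Re z \<ge> -M}"
        proof cases
          case 1 then show ?thesis using M(2)[of t] s by (auto simp: abs_le_iff)
        next
          case 2 then show ?thesis using T s by (auto simp: closed_segment_eq_real_ivl split: if_splits)
        qed
      qed
    qed (use val loop r in \<open>auto simp: valid_path_imp_path\<close>)
    finally show "p \<notin> path_image ?L \<and> winding_number ?L p = 0" using dis \<open>p \<in> path_image h\<close> by auto
  qed
qed


lemma contour_integral_closed_contour:
  assumes v: "\<And>T. \<gamma> piecewise_C1_differentiable_on {-T..T}" and T: "T > 0"
    and ends: "\<gamma> T = Complex c T" "\<gamma> (-T) = Complex c (-T)"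
    and f: "continuous_on (path_image (closed_contour \<gamma> c A T)) f" "f contour_integrable_on contour_path \<gamma> T"
  shows "contour_integral (closed_contour \<gamma> c A T) f = contour_integral (contour_path \<gamma> T) f +
     contour_integral (linepath (Complex c T) (Complex A T)) f + contour_integral (linepath (Complex A T) (Complex A (-T))) f +
     contour_integral (linepath (Complex A (-T)) (Complex c (-T))) f"
proof -
  have img: "path_image (closed_contour \<gamma> c A T) = path_image (contour_path \<gamma> T) \<union> path_image (closing_path c A T)"
    unfolding closed_contour_def using ends by (subst path_image_join) auto
  have i: "f contour_integrable_on linepath (Complex c T) (Complex A T)"
      "f contour_integrable_on linepath (Complex A T) (Complex A (-T))"
      "f contour_integrable_on linepath (Complex A (-T)) (Complex c (-T))"
    by (auto intro!: contour_integrable_continuous_linepath intro: continuous_on_subset[OF f(1)] simp: img)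
  show ?thesis unfolding closed_contour_def closing_path_def
    using i f v T ends by (simp add: contour_integrable_join valid_contour_path valid_path_join)
qed

text \<open>Cauchy's theorem for a possibly degenerate triangle. It is applied to three points of a
  horizontal line in any order, so \<open>b\<close> may lie outside the segment from
  \<open>a\<close> to \<open>c\<close>.\<close>

lemma contour_integral_linepath_collinear:
  assumes "convex S" "open S" "f holomorphic_on S" "a \<in> S" "b \<in> S" "c \<in> S"
  shows "contour_integral (linepath a c) f = contour_integral (linepath a b) f + contour_integral (linepath b c) f"
proof -
  have sub: "closed_segment a b \<subseteq> S" "closed_segment b c \<subseteq> S" "closed_segment a c \<subseteq> S" "closed_segment c a \<subseteq> S"
    using assms by (auto simp: closed_segment_subset)
  have i: "f contour_integrable_on linepath u v" if "closed_segment u v \<subseteq> S" for u v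
    using that assms(3) by (intro contour_integrable_continuous_linepath) (meson continuous_on_subset holomorphic_on_imp_continuous_on)
  have "(f has_contour_integral 0) (linepath a b +++ linepath b c +++ linepath c a)"
    by (rule Cauchy_theorem_convex_simple[of f S]) (use assms sub in \<open>auto simp: path_image_join\<close>)
  then have "contour_integral (linepath a b +++ linepath b c +++ linepath c a) f = 0"
    by (rule contour_integral_unique)
  moreover have "contour_integral (linepath a b +++ linepath b c +++ linepath c a) f =
      contour_integral (linepath a b) f + (contour_integral (linepath b c) f + contour_integral (linepath c a) f)"
    using i sub by (simp add: contour_integrable_join valid_path_join)
  moreover have "contour_integral (linepath c a) f = - contour_integral (linepath a c) f"
    using sub assms(3) by (intro contour_integral_reverse_linepath) (meson continuous_on_subset holomorphic_on_imp_continuous_on)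
  ultimately show ?thesis by (simp add: algebra_simps)
qed

text \<open>Moving the closing edge from \<open>y\<close> to \<open>x\<close> adds the boundary of
  the rectangle between them. Integrals of \<open>1 / (w - p)\<close> are compared instead of paths,
  because \<open>c\<close> may lie anywhere relative to \<open>x\<close> and \<open>y\<close> and
  the horizontal edges then overlap or cancel.\<close>

lemma winding_number_closed_contour_move:
  assumes v: "\<And>T. \<gamma> piecewise_C1_differentiable_on {-T..T}" and T: "\<bar>Im p\<bar> < T"
    and ends: "\<gamma> T = Complex c T" "\<gamma> (-T) = Complex c (-T)"
    and xy: "x < y" "Re p \<noteq> x" "Re p \<noteq> y" "p \<notin> \<gamma> ` {-T..T}"
  shows "winding_number (closed_contour \<gamma> c x T) p = winding_number (closed_contour \<gamma> c y T) p +
           winding_number (rectpath (Complex x (-T)) (Complex y T)) p"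
proof -
  have T0: "T > 0" using T by auto
  define f where "f = (\<lambda>w. 1 / (w - p))"
  have img: "path_image (closed_contour \<gamma> c A T) = path_image (contour_path \<gamma> T) \<union> path_image (closing_path c A T)" for A
    unfolding closed_contour_def using ends by (subst path_image_join) auto
  have notin: "p \<notin> path_image (closed_contour \<gamma> c A T)" if "Re p \<noteq> A" for A
    using that xy T T0 unfolding img by (auto simp: path_image_contour_path closed_segment_same_Im closed_segment_same_Re)
  have val: "valid_path (closed_contour \<gamma> c A T)" for A
    unfolding closed_contour_def using ends v T0 by (intro valid_path_join valid_contour_path) auto
  have cont: "continuous_on X f" if "p \<notin> X" for X
    unfolding f_def using that by (auto intro!: continuous_intros)
  have fi: "f contour_integrable_on contour_path \<gamma> T"
    unfolding f_def using xy v T0 by (intro contour_integrable_inversediff valid_contour_path) (auto simp: path_image_contour_path)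
  note cc = contour_integral_closed_contour[OF v T0 ends cont[OF notin] fi]
  have top: "contour_integral (linepath (Complex a T) (Complex d T)) f = contour_integral (linepath (Complex a T) (Complex b T)) f
      + contour_integral (linepath (Complex b T) (Complex d T)) f" for a b d
    by (rule contour_integral_linepath_collinear[of "{z. Im z > Im p}"])
       (use T in \<open>auto simp: f_def convex_halfspace_Im_gt open_halfspace_Im_gt intro!: holomorphic_intros\<close>)
  have bot: "contour_integral (linepath (Complex a (-T)) (Complex d (-T))) f = contour_integral (linepath (Complex a (-T)) (Complex b (-T))) f
      + contour_integral (linepath (Complex b (-T)) (Complex d (-T))) f" for a b d
    by (rule contour_integral_linepath_collinear[of "{z. Im z < Im p}"])
       (use T in \<open>auto simp: f_def convex_halfspace_Im_lt open_halfspace_Im_lt intro!: holomorphic_intros\<close>)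
  have rimg: "p \<notin> path_image (rectpath (Complex x (-T)) (Complex y T))"
    using T xy by (auto simp: path_image_rectpath)
  have ci: "f contour_integrable_on linepath u w" if "p \<notin> closed_segment u w" for u w
    using that by (intro contour_integrable_continuous_linepath cont)
  have sides: "p \<notin> closed_segment (Complex u (-T)) (Complex u' (-T))" "p \<notin> closed_segment (Complex u T) (Complex u' T)"
    "p \<notin> closed_segment (Complex y (-T)) (Complex y T)" "p \<notin> closed_segment (Complex x T) (Complex x (-T))"
    "p \<notin> closed_segment (Complex y T) (Complex y (-T))" for u u'
    using T xy by (auto simp: closed_segment_same_Im closed_segment_same_Re)
  have rect: "contour_integral (rectpath (Complex x (-T)) (Complex y T)) f =
     contour_integral (linepath (Complex x (-T)) (Complex y (-T))) f + contour_integral (linepath (Complex y (-T)) (Complex y T)) f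
     + contour_integral (linepath (Complex y T) (Complex x T)) f + contour_integral (linepath (Complex x T) (Complex x (-T))) f"
    unfolding rectpath_def Let_def by (simp add: ci sides contour_integrable_join valid_path_join)
  have rev: "contour_integral (linepath (Complex y (-T)) (Complex y T)) f = - contour_integral (linepath (Complex y T) (Complex y (-T))) f"
     using contour_integral_reverse_linepath[OF cont[OF sides(3)]] by simp
  have "contour_integral (closed_contour \<gamma> c x T) f = contour_integral (closed_contour \<gamma> c y T) f +
           contour_integral (rectpath (Complex x (-T)) (Complex y T)) f"
    using cc xy top[of c x y] bot[of x c y] by (simp add: rect rev)
  then show ?thesis using val notin rimg xy
    by (simp add: winding_number_valid_path f_def divide_simps)
qed


text \<open>With a closing edge far on the side opposite to \<open>p\<close> the winding number is
  0. Moving that edge to \<open>a\<close> passes over a rectangle. For \<open>p\<close> on the left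
  side the edge comes from the far right and passes over \<open>p\<close> if
  \<open>Re p > a\<close>; for \<open>p\<close> on the right side it comes from the far left and
  stops before \<open>p\<close>.\<close>

lemma eventually_winding_number_closed_contour:
  assumes v: "\<And>T. \<gamma> piecewise_C1_differentiable_on {-T..T}" "\<forall>t. \<bar>t\<bar> \<ge> R \<longrightarrow> \<gamma> t = Complex c t"
    and p: "Re p \<noteq> a" "p \<in> left_side \<gamma> \<or> p \<in> right_side \<gamma> \<and> Re p > a"
  shows "\<forall>\<^sub>F T in at_top. p \<notin> path_image (closed_contour \<gamma> c a T) \<and>
           winding_number (closed_contour \<gamma> c a T) p = (if p \<in> left_side \<gamma> \<and> Re p > a then 1 else 0)"
proof -
  define \<sigma> :: real where "\<sigma> = (if p \<in> left_side \<gamma> then 1 else -1)"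
  obtain B where B: "\<And>A T. A \<ge> B \<Longrightarrow> T \<ge> B \<Longrightarrow> p \<notin> path_image (closed_contour \<gamma> c (\<sigma> * A) T) \<and> winding_number (closed_contour \<gamma> c (\<sigma> * A) T) p = 0"
  proof -
    have "\<sigma> = 1 \<and> p \<in> left_side \<gamma> \<or> \<sigma> = -1 \<and> p \<in> right_side \<gamma>" using p by (auto simp: \<sigma>_def)
    from winding_number_closed_contour_eq_0[OF v this] that show ?thesis by blast
  qed
  define A where "A = max B (\<bar>a\<bar> + \<bar>Re p\<bar> + 1)"
  have A: "A \<ge> B" "A > \<bar>a\<bar>" "A > \<bar>Re p\<bar>" by (auto simp: A_def)
  have "\<forall>\<^sub>F T in at_top. T \<ge> B \<and> T > \<bar>Im p\<bar> \<and> T \<ge> R"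
    by (intro eventually_conj eventually_ge_at_top eventually_gt_at_top)
  then show ?thesis
  proof eventually_elim
    case (elim T)
    then have T: "T \<ge> B" "T > \<bar>Im p\<bar>" "T > 0" by auto
    have ends: "\<gamma> T = Complex c T" "\<gamma> (-T) = Complex c (-T)" using v(2) elim by auto
    have img: "path_image (closed_contour \<gamma> c A T) = \<gamma> ` {-T..T} \<union> path_image (closing_path c A T)" for A
      unfolding closed_contour_def using ends T by (subst path_image_join) (auto simp: path_image_contour_path)
    have pn: "p \<notin> \<gamma> ` {-T..T}" using B[OF A(1) T(1)] unfolding img by auto
    then have 1: "p \<notin> path_image (closed_contour \<gamma> c a T)"
      unfolding img using T p by (auto simp: closed_segment_same_Im closed_segment_same_Re)
    show ?case
    proof (cases "p \<in> left_side \<gamma>")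
      case True
      then have "winding_number (closed_contour \<gamma> c a T) p = 0 + winding_number (rectpath (Complex a (-T)) (Complex A T)) p"
        using winding_number_closed_contour_move[OF v(1) T(2) ends, of a A] B[OF A(1) T(1)] A p pn by (auto simp: \<sigma>_def)
      also have "winding_number (rectpath (Complex a (-T)) (Complex A T)) p = (if Re p > a then 1 else 0)"
        using A T p by (auto intro!: winding_number_rectpath winding_number_rectpath_outside simp: in_box_complex_iff in_cbox_complex_iff)
      finally show ?thesis using 1 True by auto
    next
      case False
      then have "0 = winding_number (closed_contour \<gamma> c a T) p + winding_number (rectpath (Complex (-A) (-T)) (Complex a T)) p"
        using winding_number_closed_contour_move[OF v(1) T(2) ends, of "-A" a] B[OF A(1) T(1)] A p pn by (auto simp: \<sigma>_def)
      also have "winding_number (rectpath (Complex (-A) (-T)) (Complex a T)) p = 0"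
        using A T p False by (auto intro!: winding_number_rectpath_outside simp: in_cbox_complex_iff)
      finally show ?thesis using 1 False by auto
    qed
  qed
qed

text \<open>A point on both sides would have winding number 0 for the closing edge far left and for
  the one far right, but the two loops differ by a large rectangle around the point.\<close>

lemma sides_disjoint:
  assumes v: "\<And>T. \<gamma> piecewise_C1_differentiable_on {-T..T}" "\<forall>t. \<bar>t\<bar> \<ge> R \<longrightarrow> \<gamma> t = Complex c t"
  shows "left_side \<gamma> \<inter> right_side \<gamma> = {}"
proof (rule ccontr)
  assume "left_side \<gamma> \<inter> right_side \<gamma> \<noteq> {}"
  then obtain p where p: "p \<in> left_side \<gamma>" "p \<in> right_side \<gamma>" by auto
  obtain B1 where B1: "\<And>A T. A \<ge> B1 \<Longrightarrow> T \<ge> B1 \<Longrightarrow> p \<notin> path_image (closed_contour \<gamma> c (1 * A) T) \<and> winding_number (closed_contour \<gamma> c (1 * A) T) p = 0"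
    using winding_number_closed_contour_eq_0[OF v, of 1 p] p(1) by blast
  obtain B2 where B2: "\<And>A T. A \<ge> B2 \<Longrightarrow> T \<ge> B2 \<Longrightarrow> p \<notin> path_image (closed_contour \<gamma> c (-1 * A) T) \<and> winding_number (closed_contour \<gamma> c (-1 * A) T) p = 0"
    using winding_number_closed_contour_eq_0[OF v, of "-1" p] p(2) by blast
  define A where "A = \<bar>B1\<bar> + \<bar>B2\<bar> + \<bar>R\<bar> + \<bar>Re p\<bar> + \<bar>Im p\<bar> + 1"
  have A: "A \<ge> B1" "A \<ge> B2" "A \<ge> R" "A > \<bar>Re p\<bar>" "A > \<bar>Im p\<bar>" "A > 0" unfolding A_def by linarith+
  have ends: "\<gamma> A = Complex c A" "\<gamma> (-A) = Complex c (-A)" using v(2) A by auto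
  have "p \<notin> \<gamma> ` {-A..A}"
    using B1[OF A(1) A(1)] A ends unfolding closed_contour_def by (subst (asm) path_image_join) (auto simp: path_image_contour_path)
  then have "0 = winding_number (rectpath (Complex (-A) (-A)) (Complex A A)) p"
    using winding_number_closed_contour_move[OF v(1) A(5) ends, of "-A" A] B1[OF A(1) A(1)] B2[OF A(2) A(2)] A by auto
  also have "\<dots> = 1" using A by (intro winding_number_rectpath) (auto simp: in_box_complex_iff)
  finally show False by simp
qed

text \<open>Prepares the residue theorem on \<open>- P\<close>: removing a countable closed set from
  the plane leaves an open connected set.\<close>

lemma closed_of_locally_finite_strips:
  assumes "\<And>M. finite {p\<in>P. \<bar>Re p\<bar> \<le> M}"
  shows "closed P" "countable P"
proof -
  have "x \<in> P" if "x islimpt P" for x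
  proof -
    have "x islimpt (P \<inter> ball x 1)"
      using that by (subst islimpt_Int_eventually) (auto simp: eventually_at intro!: exI[of _ 1] simp: dist_commute)
    moreover have "P \<inter> ball x 1 \<subseteq> {p\<in>P. \<bar>Re p\<bar> \<le> \<bar>Re x\<bar> + 1}"
    proof safe
      fix p assume "p \<in> ball x 1"
      then have "\<bar>Re (x - p)\<bar> < 1" using abs_Re_le_cmod[of "x - p"] by (auto simp: dist_norm)
      then show "\<bar>Re p\<bar> \<le> \<bar>Re x\<bar> + 1" by auto
    qed
    then have "finite (P \<inter> ball x 1)" using assms finite_subset by blast
    ultimately show ?thesis using islimpt_finite by blast
  qed
  then show "closed P" by (auto simp: closed_limpt)
  have "P = (\<Union>n::nat. {p\<in>P. \<bar>Re p\<bar> \<le> real n})" using real_arch_simple by blast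
  moreover have "countable (\<Union>n::nat. {p\<in>P. \<bar>Re p\<bar> \<le> real n})" by (rule countable_UN) (auto intro: countable_finite assms)
  ultimately show "countable P" by simp
qed

lemma has_integral_UNIV_imp_tendsto:
  fixes f :: "real \<Rightarrow> complex"
  assumes "(f has_integral I) UNIV"
  shows "((\<lambda>T. integral {-T..T} f) \<longlongrightarrow> I) at_top"
proof (rule tendstoI)
  fix e :: real assume "e > 0"
  then have "\<exists>B>0. \<forall>a b. ball 0 B \<subseteq> cbox a b \<longrightarrow> (\<exists>z. (f has_integral z) (cbox a b) \<and> norm (z - I) < e)"
    using assms has_integral'[of f I UNIV] by simp
  then obtain B where B: "B > 0" "\<And>a b. ball 0 B \<subseteq> cbox a b \<Longrightarrow> \<exists>z. (f has_integral z) (cbox a b) \<and> norm (z - I) < e"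
    by blast
  show "\<forall>\<^sub>F T in at_top. dist (integral {-T..T} f) I < e"
    using eventually_ge_at_top[of B]
  proof eventually_elim
    case (elim T)
    have "ball 0 B \<subseteq> cbox (-T) T" using elim by (auto simp: dist_norm)
    then obtain z where "(f has_integral z) (cbox (-T) T)" "norm (z - I) < e" using B by blast
    then show ?case by (auto simp: dist_norm integral_unique)
  qed
qed

text \<open>The poles in \<open>PL\<close> and \<open>PR\<close> lie on the same side of the line
  \<open>Re w = a\<close> as of the contour; \<open>p0\<close> does not. The factor
  \<open>\<i>\<close> before \<open>J\<close> is the derivative of the line, and the horizontal
  edges of the loop vanish in the limit by \<open>decay\<close>.\<close>

theorem contour_shift:
  assumes v: "\<And>T. \<gamma> piecewise_C1_differentiable_on {-T..T}" "\<forall>t. \<bar>t\<bar> \<ge> R \<longrightarrow> \<gamma> t = Complex c t"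
    and holo: "F holomorphic_on - (PL \<union> PR \<union> {p0})"
    and p0: "p0 \<in> left_side \<gamma>" "Re p0 > a"
    and PL: "PL \<subseteq> left_side \<gamma>" "\<And>p. p \<in> PL \<Longrightarrow> Re p < a"
    and PR: "PR \<subseteq> right_side \<gamma>" "\<And>p. p \<in> PR \<Longrightarrow> Re p > a"
    and fin: "\<And>M. finite {p\<in>PL \<union> PR. \<bar>Re p\<bar> \<le> M}"
    and decay: "\<And>M. \<exists>C Y. \<forall>z. \<bar>Re z\<bar> \<le> M \<and> \<bar>Im z\<bar> \<ge> Y \<longrightarrow> norm (F z) \<le> C * exp (- \<bar>Im z\<bar>)"
    and I: "((\<lambda>t. F (\<gamma> t) * vector_derivative \<gamma> (at t)) has_integral I) UNIV"
    and J: "((\<lambda>t. F (Complex a t)) has_integral J) UNIV"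
  shows "I = \<i> * J + 2 * pi * \<i> * residue F p0"
proof -
  let ?I = "\<lambda>T. integral {-T..T} (\<lambda>t. F (\<gamma> t) * vector_derivative \<gamma> (at t))"
  let ?J = "\<lambda>T. integral {-T..T} (\<lambda>t. F (Complex a t))"
  define P where "P = PL \<union> PR"
  have P: "closed P" "countable P" using closed_of_locally_finite_strips[OF fin] by (auto simp: P_def)
  have p0P: "p0 \<notin> P" using p0 PL(2)[of p0] PR(1) sides_disjoint[OF v] by (auto simp: P_def)
  let ?L = "\<lambda>T. closed_contour \<gamma> c a T"
  obtain M0 where M0: "M0 \<ge> \<bar>R\<bar> + 1" "\<And>t. \<bar>Re (\<gamma> t)\<bar> \<le> M0"
    using vertical_contour_bound[OF v] by blast
  define M where "M = max M0 \<bar>a\<bar>"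
  have cM: "\<bar>c\<bar> \<le> M" "\<bar>a\<bar> \<le> M" using M0(2)[of "\<bar>R\<bar>"] v(2) by (auto simp: M_def)
  have evP: "\<forall>\<^sub>F T in at_top. p \<notin> path_image (?L T) \<and> winding_number (?L T) p = (if p = p0 then 1 else 0)"
     if "p \<in> insert p0 P" for p
  proof -
    have "Re p \<noteq> a" "p \<in> left_side \<gamma> \<or> p \<in> right_side \<gamma> \<and> Re p > a" "p \<in> left_side \<gamma> \<and> Re p > a \<longleftrightarrow> p = p0"
      using that p0 PL PR sides_disjoint[OF v] by (fastforce simp: P_def)+
    with eventually_winding_number_closed_contour[OF v, of p a] show ?thesis by simp
  qed
  obtain C Y where CY: "\<And>z. \<bar>Re z\<bar> \<le> M \<and> \<bar>Im z\<bar> \<ge> Y \<Longrightarrow> norm (F z) \<le> C * exp (- \<bar>Im z\<bar>)"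
    using decay[of M] by blast
  \<comment> \<open>The winding number around a given pole is known only from some height on, which
    depends on the pole. All loops lie in the strip \<open>|Re z| \<le> M\<close>, so only the
    finitely many poles in it are treated this way; the others lie outside the strip.\<close>
  have "\<forall>\<^sub>F T in at_top. \<forall>p\<in>insert p0 {p\<in>P. \<bar>Re p\<bar> \<le> M}. p \<notin> path_image (?L T) \<and> winding_number (?L T) p = (if p = p0 then 1 else 0)"
  proof (rule eventually_ball_finite)
    show "finite (insert p0 {p\<in>P. \<bar>Re p\<bar> \<le> M})" using fin[of M] by (simp add: P_def)
  qed (use evP in blast)
  moreover have "\<forall>\<^sub>F T in at_top. T \<ge> \<bar>R\<bar> + 1" by (rule eventually_ge_at_top)
  moreover have "\<forall>\<^sub>F T in at_top. T \<ge> Y" by (rule eventually_ge_at_top)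
  ultimately have ev: "\<forall>\<^sub>F T in at_top. norm (?I T
       - \<i> * ?J T - 2 * pi * \<i> * residue F p0) \<le> 2 * \<bar>C\<bar> * exp (- T) * \<bar>a - c\<bar>"
  proof eventually_elim
    case (elim T)
    have T: "T > 0" "T \<ge> Y" "\<bar>R\<bar> + 1 \<le> T" using elim by auto
    note TY = T(2)
    have ends: "\<gamma> T = Complex c T" "\<gamma> (-T) = Complex c (-T)" using v(2) T(3) by auto
    note T = T(1)
    have val: "valid_path (?L T)"
      unfolding closed_contour_def using ends v T by (intro valid_path_join valid_contour_path) auto
    have loop: "pathfinish (?L T) = pathstart (?L T)" by (simp add: closed_contour_def ends)
    have img: "path_image (?L T) = \<gamma> ` {-T..T} \<union> path_image (closing_path c a T)"
      unfolding closed_contour_def using ends T by (subst path_image_join) (auto simp: path_image_contour_path)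
    have strip: "path_image (?L T) \<subseteq> {z. -M \<le> Re z} \<inter> {z. Re z \<le> M}"
    proof
      fix z assume "z \<in> path_image (?L T)"
      then consider t where "z = \<gamma> t" | "Re z \<in> closed_segment c a"
        unfolding img by (auto simp: closed_segment_same_Im closed_segment_same_Re closed_segment_commute)
      then show "z \<in> {z. -M \<le> Re z} \<inter> {z. Re z \<le> M}"
      proof cases
        case 1 then show ?thesis using M0(2)[of t] by (auto simp: abs_le_iff M_def)
      next
        case 2 then show ?thesis using cM by (auto simp: closed_segment_eq_real_ivl split: if_splits)
      qed
    qed
    have wn: "p \<notin> path_image (?L T) \<and> winding_number (?L T) p = 0" if "p \<in> P" for p
    proof (cases "\<bar>Re p\<bar> \<le> M")
      case True
      then show ?thesis using elim that p0P by auto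
    next
      case False
      then have "p \<notin> {z. -M \<le> Re z} \<inter> {z. Re z \<le> M}" by auto
      moreover have "winding_number (?L T) p = 0"
        by (rule winding_number_zero_outside[OF _ _ loop calculation strip])
           (use val in \<open>auto intro!: valid_path_imp_path convex_Int convex_halfspace_Re_ge convex_halfspace_Re_le\<close>)
      ultimately show ?thesis using strip by auto
    qed
    have p0w: "p0 \<notin> path_image (?L T)" "winding_number (?L T) p0 = 1" using elim by auto
    have holo': "F holomorphic_on - P - {p0}"
      by (rule holomorphic_on_subset[OF holo]) (auto simp: P_def)
    have sub: "path_image (?L T) \<subseteq> - P - {p0}" using p0w wn by auto
    \<comment> \<open>\<open>P\<close> may be infinite, so its points are removed from the domain
      instead of being listed as singularities; this is allowed because the loop does not wind
      around them.\<close>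
    have "contour_integral (?L T) F = 2 * pi * \<i> * (\<Sum>p\<in>{p0}. winding_number (?L T) p * residue F p)"
    proof (rule Residue_theorem[OF _ _ _ holo' val loop sub])
      show "connected (- P)" using connected_open_diff_countable[of UNIV P] P connected_UNIV by (simp add: Compl_eq_Diff_UNIV)
      show "open (- P)" using P(1) by blast
      show "\<forall>z. z \<notin> - P \<longrightarrow> winding_number (?L T) z = 0" using wn by blast
    qed simp
    then have res: "contour_integral (?L T) F = 2 * pi * \<i> * residue F p0" using p0w by simp
    have cont: "continuous_on (- P - {p0}) F" using holo' by (rule holomorphic_on_imp_continuous_on)
    have Fi: "F contour_integrable_on contour_path \<gamma> T"
    proof (rule contour_integrable_holomorphic_simple[OF holo'])
      show "open (- P - {p0})" using P by auto
      show "valid_path (contour_path \<gamma> T)" using v T by (intro valid_contour_path) auto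
      show "path_image (contour_path \<gamma> T) \<subseteq> - P - {p0}" using sub T unfolding img by (auto simp: path_image_contour_path)
    qed
    have seg: "F contour_integrable_on linepath u w" if "closed_segment u w \<subseteq> path_image (?L T)" for u w
      using that sub by (intro contour_integrable_continuous_linepath continuous_on_subset[OF cont]) auto
    have segs: "closed_segment (Complex c T) (Complex a T) \<subseteq> path_image (?L T)"
       "closed_segment (Complex a T) (Complex a (-T)) \<subseteq> path_image (?L T)"
       "closed_segment (Complex a (-T)) (Complex c (-T)) \<subseteq> path_image (?L T)"
      unfolding img by auto
    have g: "contour_integral (contour_path \<gamma> T) F = ?I T"
      using has_contour_integral_integral[OF Fi] unfolding has_contour_integral_contour_path[OF T v(1)]
      by (rule integral_unique[symmetric])
    have cs: "closed_segment (Complex a (-T)) (Complex a T) \<subseteq> path_image (?L T)"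
      using segs(2) unfolding closed_segment_commute[of "Complex a T" "Complex a (-T)"] .
    have "((\<lambda>t. F (Complex a t)) has_integral - \<i> * contour_integral (linepath (Complex a (-T)) (Complex a T)) F) {-T..T}"
      using has_contour_integral_integral[OF seg[OF cs]] T
        has_contour_integral_linepath_same_Re_iff[of "Complex a (-T)" a "Complex a T" "-T" T F] by simp
    from integral_unique[OF this]
    have "contour_integral (linepath (Complex a (-T)) (Complex a T)) F = \<i> * ?J T"
      by simp
    moreover have "contour_integral (linepath (Complex a (-T)) (Complex a T)) F = - contour_integral (linepath (Complex a T) (Complex a (-T))) F"
      by (rule contour_integral_reverse_linepath[OF continuous_on_subset[OF cont]]) (use cs sub in blast)
    ultimately have l: "contour_integral (linepath (Complex a T) (Complex a (-T))) F = - \<i> * ?J T"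
      by (metis (no_types) minus_minus mult_minus_left)
    have hor: "norm (contour_integral (linepath (Complex u T') (Complex w T')) F) \<le> \<bar>C\<bar> * exp (-T) * \<bar>a - c\<bar>"
      if "{u, w} = {a, c}" "\<bar>T'\<bar> = T" "closed_segment (Complex u T') (Complex w T') \<subseteq> path_image (?L T)" for u w T'
    proof -
      have "norm (contour_integral (linepath (Complex u T') (Complex w T')) F) \<le> (\<bar>C\<bar> * exp (-T)) * norm (Complex w T' - Complex u T')"
      proof (rule contour_integral_bound_linepath)
        fix z assume z: "z \<in> closed_segment (Complex u T') (Complex w T')"
        then have "Im z = T'" by (auto simp: closed_segment_same_Im)
        moreover have "\<bar>Re z\<bar> \<le> M" using subsetD[OF strip subsetD[OF that(3) z]] by auto
        ultimately have "norm (F z) \<le> C * exp (-T)" using CY[of z] TY that(2) by auto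
        also have "\<dots> \<le> \<bar>C\<bar> * exp (-T)" by (intro mult_right_mono) auto
        finally show "norm (F z) \<le> \<bar>C\<bar> * exp (-T)" .
      next
        show "F contour_integrable_on linepath (Complex u T') (Complex w T')" by (rule seg[OF that(3)])
      qed auto
      also have "Complex w T' - Complex u T' = of_real (w - u)" by (simp add: complex_eq_iff)
      also have "norm (of_real (w - u) :: complex) = \<bar>a - c\<bar>"
        using that(1) unfolding norm_of_real by (auto simp: doubleton_eq_iff)
      finally show ?thesis .
    qed
    have "?I T - \<i> * ?J T - 2 * pi * \<i> * residue F p0
       = - contour_integral (linepath (Complex c T) (Complex a T)) F - contour_integral (linepath (Complex a (-T)) (Complex c (-T))) F"
      using contour_integral_closed_contour[OF v(1) T ends continuous_on_subset[OF cont sub] Fi] by (simp add: res g l algebra_simps)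
    also have "norm \<dots> \<le> norm (contour_integral (linepath (Complex c T) (Complex a T)) F) + norm (contour_integral (linepath (Complex a (-T)) (Complex c (-T))) F)"
      by (metis norm_minus_cancel norm_triangle_ineq4)
    also have "\<dots> \<le> \<bar>C\<bar> * exp (-T) * \<bar>a - c\<bar> + \<bar>C\<bar> * exp (-T) * \<bar>a - c\<bar>"
    proof (rule add_mono)
      show "norm (contour_integral (linepath (Complex c T) (Complex a T)) F) \<le> \<bar>C\<bar> * exp (-T) * \<bar>a - c\<bar>"
        by (rule hor[OF insert_commute _ segs(1)]) (use T in simp)
      show "norm (contour_integral (linepath (Complex a (-T)) (Complex c (-T))) F) \<le> \<bar>C\<bar> * exp (-T) * \<bar>a - c\<bar>"
        by (rule hor[OF refl _ segs(3)]) (use T in simp)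
    qed
    also have "\<dots> = 2 * \<bar>C\<bar> * exp (- T) * \<bar>a - c\<bar>" by simp
    finally show ?case .
  qed
  have lim: "((\<lambda>T. ?I T
       - \<i> * ?J T - 2 * pi * \<i> * residue F p0) \<longlongrightarrow> I - \<i> * J - 2 * pi * \<i> * residue F p0) at_top"
    by (intro tendsto_intros has_integral_UNIV_imp_tendsto I J)
  have "((\<lambda>T. exp (-T)) \<longlongrightarrow> 0) (at_top :: real filter)"
    by (rule filterlim_compose[OF exp_at_bot filterlim_uminus_at_bot_at_top])
  then have "((\<lambda>T. 2 * \<bar>C\<bar> * exp (- T) * \<bar>a - c\<bar>) \<longlongrightarrow> 2 * \<bar>C\<bar> * 0 * \<bar>a - c\<bar>) at_top"
    by (intro tendsto_mult tendsto_const)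
  then have null: "((\<lambda>T. 2 * \<bar>C\<bar> * exp (- T) * \<bar>a - c\<bar>) \<longlongrightarrow> 0) at_top" by (simp only: mult_zero_right mult_zero_left)
  have "((\<lambda>T. ?I T
       - \<i> * ?J T - 2 * pi * \<i> * residue F p0) \<longlongrightarrow> 0) at_top"
    by (rule Lim_null_comparison[OF ev null])
  with lim have "I - \<i> * J - 2 * pi * \<i> * residue F p0 = 0"
    by (rule tendsto_unique[rotated]) simp
  then show ?thesis by (simp add: algebra_simps)
qed

section \<open>The multiplication formula for the Gamma function\<close>

text \<open>Sorted by their index modulo \<open>K\<close>, the \<open>K * n\<close> factors on the
  left form the \<open>K\<close> pochhammer terms on the right.\<close>

lemma pochhammer_mult_nat:
  fixes z :: complex
  assumes "K > 0"
  shows "pochhammer (of_nat K * z) (K * n) = of_nat K ^ (K * n) * (\<Prod>j<K. pochhammer (z + of_nat j / of_nat K) n)"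
proof (induction n)
  case (Suc n)
  have "pochhammer (of_nat K * z + of_nat (K * n)) K = (\<Prod>j<K. of_nat K * (z + of_nat j / of_nat K + of_nat n))"
    unfolding pochhammer_prod atLeast0LessThan by (rule prod.cong[OF refl]) (use assms in \<open>simp add: field_simps\<close>)
  also have "\<dots> = of_nat K ^ K * (\<Prod>j<K. z + of_nat j / of_nat K + of_nat n)"
    by (simp add: prod.distrib)
  finally have 1: "pochhammer (of_nat K * z + of_nat (K * n)) K = of_nat K ^ K * (\<Prod>j<K. z + of_nat j / of_nat K + of_nat n)" .
  have "pochhammer (of_nat K * z) (K * Suc n) = pochhammer (of_nat K * z) (K * n) * pochhammer (of_nat K * z + of_nat (K * n)) K"
    using pochhammer_product'[of "of_nat K * z" "K * n" K] by (simp add: add.commute)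
  then show ?case unfolding Suc.IH 1
    by (simp add: pochhammer_Suc prod.distrib power_add)
qed simp

text \<open>Gauss's formula with an unevaluated constant, which cancels in
  \<open>Gamma_quotient_product\<close>. The Euler products of the \<open>K\<close> factors at index
  \<open>n\<close> and that of \<open>K z\<close> at index \<open>m n\<close> contain the same
  pochhammer terms. The remaining ratio \<open>a n\<close> does not depend on \<open>z\<close>, so
  its limit \<open>A\<close> may be read off at a single point.\<close>

lemma rGamma_multiplication:
  assumes "K > 0"
  obtains A :: complex where "A \<noteq> 0"
    "\<And>z. A * (\<Prod>j<K. rGamma (z + of_nat j / of_nat K)) = exp (of_nat K * z * of_real (ln K)) * rGamma (of_nat K * z)"
proof -
  \<comment> \<open>\<open>rGamma_series\<close> at index \<open>n\<close> has a pochhammer term of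
    \<open>n + 1\<close> factors, so the match is \<open>m n + 1 = K * (n + 1)\<close>.\<close>
  define m where "m = (\<lambda>n. K * (n + 1) - 1)"
  define P where "P = (\<lambda>z::complex. \<lambda>n. \<Prod>j<K. rGamma_series (z + of_nat j / of_nat K) n)"
  define R where "R = (\<lambda>z::complex. \<lambda>n. rGamma_series (of_nat K * z) (m n))"
  \<comment> \<open>Replaces the normalising power of \<open>m n\<close> in \<open>R\<close> by that
    of \<open>n\<close>; it tends to the power of \<open>K\<close> in the formula.\<close>
  define e where "e = (\<lambda>z::complex. \<lambda>n. exp (of_nat K * z * of_real (ln (real (m n)) - ln (real n))))"
  define S where "S = (\<Sum>j<K. of_nat j / of_nat K :: complex)"
  define a where "a = (\<lambda>n. of_nat K ^ (K * (n + 1)) * fact n ^ K * exp (S * of_real (ln (real n))) / (fact (m n) :: complex))"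
  have m1: "m n + 1 = K * (n + 1)" for n using assms by (simp add: m_def)
  have Pn: "P z n = (\<Prod>j<K. pochhammer (z + of_nat j / of_nat K) (n + 1)) / (fact n ^ K * exp ((of_nat K * z + S) * of_real (ln (real n))))" for z n
  proof -
    have "(\<Prod>j<K. exp ((z + of_nat j / of_nat K) * of_real (ln (real n)))) = exp (\<Sum>j<K. (z + of_nat j / of_nat K) * of_real (ln (real n)))"
      by (simp add: exp_sum)
    also have "(\<Sum>j<K. (z + of_nat j / of_nat K) * of_real (ln (real n))) = (of_nat K * z + S) * of_real (ln (real n))"
      by (simp add: S_def sum_distrib_right[symmetric] sum.distrib)
    finally show ?thesis unfolding P_def rGamma_series_def by (simp add: prod_dividef prod.distrib)
  qed
  have eq: "R z n * e z n = P z n * a n" for z n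
  proof -
    have "R z n = of_nat K ^ (K * (n + 1)) * (\<Prod>j<K. pochhammer (z + of_nat j / of_nat K) (n + 1)) / (fact (m n) * exp (of_nat K * z * of_real (ln (real (m n)))))"
      unfolding R_def rGamma_series_def m1 pochhammer_mult_nat[OF assms] by simp
    moreover have "e z n = exp (of_nat K * z * of_real (ln (real (m n)))) / exp (of_nat K * z * of_real (ln (real n)))"
      unfolding e_def by (simp add: exp_diff right_diff_distrib)
    moreover have "exp ((of_nat K * z + S) * of_real (ln (real n))) = exp (of_nat K * z * of_real (ln (real n))) * exp (S * of_real (ln (real n)))"
      by (simp add: exp_add distrib_right)
    ultimately show ?thesis unfolding Pn a_def by (simp add: field_simps)
  qed
  have Plim: "P z \<longlonglongrightarrow> (\<Prod>j<K. rGamma (z + of_nat j / of_nat K))" for z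
    unfolding P_def by (intro tendsto_intros)
  have "filterlim m at_top sequentially"
    unfolding filterlim_at_top
  proof
    fix Z show "\<forall>\<^sub>F n in sequentially. Z \<le> m n"
      using eventually_ge_at_top[of Z]
    proof eventually_elim
      case (elim n)
      have "1 * (n + 1) \<le> K * (n + 1)" using assms by (intro mult_right_mono) auto
      then show ?case using elim by (simp add: m_def)
    qed
  qed
  then have Rlim: "R z \<longlonglongrightarrow> rGamma (of_nat K * z)" for z
    unfolding R_def by (rule filterlim_compose[OF rGamma_series_LIMSEQ])
  have lnlim: "(\<lambda>n. ln (real (m n)) - ln (real n)) \<longlonglongrightarrow> ln (real K)"
  proof -
    have "(\<lambda>n. real K + (real K - 1) * inverse (real n)) \<longlonglongrightarrow> real K + (real K - 1) * 0"
      by (intro tendsto_intros lim_inverse_n)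
    then have "(\<lambda>n. ln (real K + (real K - 1) * inverse (real n))) \<longlonglongrightarrow> ln (real K)"
      using assms by (intro tendsto_ln) auto
    moreover have "\<forall>\<^sub>F n in sequentially. ln (real K + (real K - 1) * inverse (real n)) = ln (real (m n)) - ln (real n)"
      using eventually_gt_at_top[of 0]
    proof eventually_elim
      case (elim n)
      have mr: "real (m n) = real K * (real n + 1) - 1" using m1[of n] by (metis add_diff_cancel_right' of_nat_1 of_nat_add of_nat_mult)
      have "1 * (real n + 1) \<le> real K * (real n + 1)" using assms by (intro mult_right_mono) auto
      then have "1 < real K * (real n + 1)"
        by (rule less_le_trans[rotated]) (use elim in simp)
      then have "real (m n) > 0" unfolding mr by simp
      then have "ln (real (m n)) - ln (real n) = ln (real (m n) / real n)" using elim by (simp add: ln_div)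
      also have "real (m n) / real n = real K + (real K - 1) * inverse (real n)" using elim unfolding mr by (simp add: field_simps)
      finally show ?case by simp
    qed
    ultimately show ?thesis by (rule Lim_transform_eventually)
  qed
  have elim: "e z \<longlonglongrightarrow> exp (of_nat K * z * of_real (ln (real K)))" for z
    unfolding e_def by (intro tendsto_intros lnlim)
  \<comment> \<open>At \<open>z = 1\<close> every reciprocal Gamma value is nonzero, so the limit of
    \<open>a\<close> is a quotient of limits.\<close>
  define A where "A = rGamma (of_nat K) * exp (of_nat K * of_real (ln (real K))) / (\<Prod>j<K. rGamma (1 + of_nat j / of_nat K :: complex))"
  have nz: "rGamma (1 + of_nat j / of_nat K :: complex) \<noteq> 0" for j
  proof
    assume "rGamma (1 + of_nat j / of_nat K :: complex) = 0"
    then have "1 + of_nat j / of_nat K \<in> (\<int>\<^sub>\<le>\<^sub>0 :: complex set)" by (simp add: rGamma_eq_zero_iff)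
    then obtain i where i: "i \<le> 0" "1 + of_nat j / of_nat K = (of_int i :: complex)" by (elim nonpos_Ints_cases)
    have "1 + real j / real K = of_int i" using arg_cong[OF i(2), of Re] by simp
    moreover have "real j / real K \<ge> 0" by simp
    ultimately show False using i(1) by linarith
  qed
  have pnz: "(\<Prod>j<K. rGamma (1 + of_nat j / of_nat K :: complex)) \<noteq> 0" using nz by simp
  have knz: "rGamma (of_nat K :: complex) \<noteq> 0"
    using assms Gamma_fact[of "K - 1", where 'a = complex] by (auto simp: rGamma_inverse_Gamma of_nat_diff)
  have alim: "a \<longlonglongrightarrow> A"
  proof -
    have "(\<lambda>n. R 1 n * e 1 n / P 1 n) \<longlonglongrightarrow> A"
      using tendsto_divide[OF tendsto_mult[OF Rlim[of 1] elim[of 1]] Plim[of 1] pnz] by (simp add: A_def)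
    moreover have "\<forall>\<^sub>F n in sequentially. P 1 n \<noteq> 0"
      by (rule tendsto_imp_eventually_ne[OF Plim pnz])
    then have "\<forall>\<^sub>F n in sequentially. R 1 n * e 1 n / P 1 n = a n"
      by eventually_elim (simp add: eq)
    ultimately show ?thesis by (rule Lim_transform_eventually)
  qed
  show ?thesis
  proof
    show "A \<noteq> 0" using knz pnz by (simp add: A_def)
    fix z
    have "(\<lambda>n. P z n * a n) \<longlonglongrightarrow> (\<Prod>j<K. rGamma (z + of_nat j / of_nat K)) * A"
      by (intro tendsto_mult Plim alim)
    moreover have "(\<lambda>n. P z n * a n) \<longlonglongrightarrow> rGamma (of_nat K * z) * exp (of_nat K * z * of_real (ln (real K)))"
      unfolding eq[symmetric] by (intro tendsto_mult Rlim elim)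
    ultimately have "(\<Prod>j<K. rGamma (z + of_nat j / of_nat K)) * A = rGamma (of_nat K * z) * exp (of_nat K * z * of_real (ln (real K)))"
      by (rule LIMSEQ_unique)
    then show "A * (\<Prod>j<K. rGamma (z + of_nat j / of_nat K)) = exp (of_nat K * z * of_real (ln K)) * rGamma (of_nat K * z)"
      by (simp add: mult_ac)
  qed
qed

section \<open>Laplace transforms of powers\<close>

definition laplace_integrand :: "complex \<Rightarrow> complex \<Rightarrow> real \<Rightarrow> complex" where
  "laplace_integrand v p u = indicator {0<..} u *\<^sub>R (of_real u powr (v - 1) * exp (- p * of_real u))"

lemma laplace_integrand_measurable [measurable]: "laplace_integrand v p \<in> borel_measurable borel"
proof -
  have "(\<lambda>u. indicator {0<..} u *\<^sub>R (of_real u powr (v - 1) * exp (- p * of_real u)) :: complex) \<in> borel_measurable borel"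
    by (rule borel_measurable_continuous_on_indicator) (auto intro!: continuous_intros)
  then show ?thesis by (simp add: laplace_integrand_def[abs_def])
qed

lemma norm_laplace_integrand:
  "norm (laplace_integrand v p u) = Re (laplace_integrand (of_real (Re v)) (of_real (Re p)) u)"
proof (cases "u > 0")
  case True
  have "(complex_of_real (Re v) - 1) = of_real (Re v - 1)" by simp
  then have "of_real u powr (of_real (Re v) - 1) = complex_of_real (u powr (Re v - 1))"
    using True by (simp only: powr_of_real less_imp_le)
  moreover have "exp (- complex_of_real (Re p) * of_real u) = of_real (exp (- Re p * u))"
    by (simp flip: exp_of_real)
  ultimately show ?thesis using True
    by (simp add: laplace_integrand_def norm_mult norm_powr_real_powr)
qed (simp add: laplace_integrand_def)

text \<open>For real \<open>p\<close> this is Euler's integral after scaling \<open>u\<close> by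
  \<open>a\<close>. It supplies the value at the centre of the expansion in
  \<open>laplace_integral\<close>.\<close>

lemma laplace_integral_real:
  assumes "Re v > 0" "a > 0"
  shows "integrable lborel (laplace_integrand v (of_real a))" (is ?A)
    and "integral\<^sup>L lborel (laplace_integrand v (of_real a)) = Gamma v * of_real a powr (- v)" (is ?B)
proof -
  have eq: "laplace_integrand v (of_real a) = (\<lambda>u. indicator {0<..} u *\<^sub>R (of_real u powr (v - 1) / of_real (exp (a * u))))" for a
    by (auto simp: laplace_integrand_def fun_eq_iff exp_minus field_simps indicator_def simp flip: exp_of_real)
  have int: "integrable lborel (laplace_integrand v (of_real a))" if "a > 0" for a
    using absolutely_integrable_Gamma_integral[OF assms(1) that] unfolding set_integrable_def eq[symmetric]
    by (subst (asm) integrable_completion) auto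
  show ?A by (rule int) fact
  have "(laplace_integrand v 1 has_integral integral\<^sup>L lborel (laplace_integrand v 1)) UNIV"
    using has_integral_integral_lborel[OF int[of 1]] by simp
  moreover have "(laplace_integrand v 1 has_integral Gamma v) UNIV"
  proof -
    have "((\<lambda>t. if t \<in> {0<..} then complex_of_real t powr (v - 1) / of_real (exp t) else 0) has_integral Gamma v) UNIV"
      using Gamma_integral_complex'[OF assms(1)] by (subst has_integral_restrict_UNIV)
    moreover have "(\<lambda>t. if t \<in> {0<..} then complex_of_real t powr (v - 1) / of_real (exp t) else 0) = laplace_integrand v 1"
      using eq[of 1] by (auto simp: fun_eq_iff)
    ultimately show ?thesis by simp
  qed
  ultimately have G: "Gamma v = integral\<^sup>L lborel (laplace_integrand v 1)" by (metis has_integral_unique)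
  also have "\<dots> = \<bar>a\<bar> *\<^sub>R (\<integral>u. laplace_integrand v 1 (0 + a * u) \<partial>lborel)"
    using assms by (intro lborel_integral_real_affine) auto
  also have "(\<lambda>u. laplace_integrand v 1 (0 + a * u)) = (\<lambda>u. of_real a powr (v - 1) * laplace_integrand v (of_real a) u)"
  proof
    fix u
    have "of_real (a * u) powr (v - 1) = of_real a powr (v - 1) * complex_of_real u powr (v - 1)" if "u > 0"
      using assms that by (simp add: powr_times_real)
    then show "laplace_integrand v 1 (0 + a * u) = of_real a powr (v - 1) * laplace_integrand v (of_real a) u"
      using assms by (auto simp: laplace_integrand_def indicator_def zero_less_mult_iff)
  qed
  finally have "Gamma v = of_real a * of_real a powr (v - 1) * integral\<^sup>L lborel (laplace_integrand v (of_real a))"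
    using assms by (simp add: scaleR_conv_of_real)
  also have "of_real a * of_real a powr (v - 1) = of_real a powr v"
    using assms by (simp add: powr_diff)
  finally show ?B using assms by (simp add: powr_minus field_simps)
qed

lemma laplace_integrable:
  assumes "Re v > 0" "Re p > 0"
  shows "integrable lborel (laplace_integrand v p)"
proof (rule Bochner_Integration.integrable_bound)
  show "integrable lborel (laplace_integrand (of_real (Re v)) (of_real (Re p)))"
    using assms by (intro laplace_integral_real) auto
  show "AE u in lborel. norm (laplace_integrand v p u) \<le> norm (laplace_integrand (of_real (Re v)) (of_real (Re p)) u)"
    by (simp add: norm_laplace_integrand)
qed simp

lemma laplace_integral_norm:
  assumes "Re v > 0" "Re p > 0"
  shows "(\<integral>u. norm (laplace_integrand v p u) \<partial>lborel) = Gamma (Re v) * Re p powr (- Re v)"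
proof -
  have "(\<integral>u. norm (laplace_integrand v p u) \<partial>lborel) = Re (\<integral>u. laplace_integrand (of_real (Re v)) (of_real (Re p)) u \<partial>lborel)"
    unfolding norm_laplace_integrand using assms by (intro integral_Re laplace_integrable) auto
  also have "(\<integral>u. laplace_integrand (of_real (Re v)) (of_real (Re p)) u \<partial>lborel) = of_real (Gamma (Re v) * Re p powr (- Re v))"
    using assms powr_of_real[of "Re p" "- Re v"] by (subst laplace_integral_real) (auto simp: Gamma_complex_of_real)
  finally show ?thesis by simp
qed

text \<open>
  Every \<open>p\<close> in the right half-plane lies in a disc \<open>\<bar>p - a\<bar> < a\<close> with \<open>a > 0\<close> real; expanding
  \<open>exp (- (p - a) u)\<close> there turns the integral into a binomial series.
\<close>

theorem laplace_integral:
  assumes v: "Re v > 0" and p: "Re p > 0"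
  shows "integral\<^sup>L lborel (laplace_integrand v p) = Gamma v * p powr (- v)"
proof -
  \<comment> \<open>\<open>|p - a| < a\<close> holds iff
    \<open>a > |p|\<^sup>2 / (2 * Re p)\<close>; this is twice the threshold.\<close>
  define a where "a = (norm p)\<^sup>2 / Re p"
  have p0: "p \<noteq> 0" using p by auto
  have a: "a > 0" using p p0 by (auto simp: a_def)
  define q where "q = p - of_real a"
  have "(norm q)\<^sup>2 < a\<^sup>2"
  proof -
    have "(norm q)\<^sup>2 = (norm p)\<^sup>2 - 2 * a * Re p + a\<^sup>2"
      unfolding cmod_power2 q_def by (simp add: power2_eq_square algebra_simps)
    moreover have "a * Re p = (norm p)\<^sup>2" using p by (simp add: a_def)
    moreover have "(norm p)\<^sup>2 > 0" using p0 by simp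
    ultimately show ?thesis by (simp add: mult.assoc)
  qed
  then have q: "norm q < a" using a by (auto intro: power2_less_imp_less)
  have qa: "norm (q / of_real a) < 1" using q a by (simp add: norm_divide)
  have nv: "v \<notin> \<int>\<^sub>\<le>\<^sub>0" using v by (auto elim!: nonpos_Ints_cases)
  define x where "x = Re v"
  have x: "x > 0" "x \<notin> \<int>\<^sub>\<le>\<^sub>0" using v by (auto simp: x_def elim!: nonpos_Ints_cases)
  define f where "f = (\<lambda>n u. (-q) ^ n / fact n * laplace_integrand (v + of_nat n) (of_real a) u)"
  have f_eq: "f n u = laplace_integrand v (of_real a) u * ((- q * of_real u) ^ n /\<^sub>R fact n)" for n u
  proof (cases "u > 0")
    case True
    have "complex_of_real u powr (v + of_nat n - 1) = of_real u powr (v - 1) * of_real u ^ n"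
      using True powr_add[of "of_real u" "v - 1" "of_nat n"] by (simp add: powr_nat' algebra_simps)
    then show ?thesis using True
      by (simp add: f_def laplace_integrand_def scaleR_conv_of_real field_simps power_mult_distrib[symmetric])
  qed (simp add: f_def laplace_integrand_def)
  have fi: "integrable lborel (f n)" for n
    unfolding f_def using v a by (intro integrable_mult_right laplace_integrable) auto
  have "(\<lambda>n. f n u) sums (laplace_integrand v (of_real a) u * exp (- q * of_real u))" for u
    unfolding f_eq by (intro sums_mult exp_converges)
  moreover have "laplace_integrand v (of_real a) u * exp (- q * of_real u) = laplace_integrand v p u" for u
    by (cases "u > 0") (simp_all add: laplace_integrand_def q_def exp_add[symmetric] algebra_simps)
  ultimately have fs: "(\<Sum>n. f n u) = laplace_integrand v p u" for u by (metis sums_unique)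
  have ints: "integral\<^sup>L lborel (f n) = (Gamma v * of_real a powr (- v)) * (((- v) gchoose n) * (q / of_real a) ^ n)" for n
  proof -
    have "integral\<^sup>L lborel (f n) = (-q) ^ n / fact n * (Gamma (v + of_nat n) * of_real a powr (- (v + of_nat n)))"
      unfolding f_def using v a by (subst integral_mult_right_zero, subst laplace_integral_real) auto
    also have "Gamma (v + of_nat n) = pochhammer v n * Gamma v"
      using pochhammer_Gamma[OF nv, of n] nv by (simp add: Gamma_eq_zero_iff)
    also have "of_real a powr (- (v + of_nat n)) = of_real a powr (- v) / of_real a ^ n"
      using a by (simp add: powr_diff powr_nat')
    finally show ?thesis
      by (simp add: gbinomial_pochhammer power_mult_distrib[symmetric] power_divide field_simps)
  qed
  have intn: "(\<integral>u. norm (f n u) \<partial>lborel) = (Gamma x * a powr (- x)) * (((- x) gchoose n) * (- norm q / a) ^ n)" for n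
  proof -
    have "(\<integral>u. norm (f n u) \<partial>lborel) = norm q ^ n / fact n * (Gamma (x + real n) * a powr (- (x + real n)))"
      using v a laplace_integral_norm[of "v + of_nat n" "of_real a"]
      by (simp add: f_def norm_mult norm_divide norm_power x_def)
    also have "Gamma (x + real n) = pochhammer x n * Gamma x"
      using pochhammer_Gamma[OF x(2), of n] x by (simp add: Gamma_eq_zero_iff)
    also have "a powr (- (x + real n)) = a powr (- x) / a ^ n"
      using a powr_diff[of a "- x" "real n"] by (simp add: powr_realpow)
    finally show ?thesis
      by (simp add: gbinomial_pochhammer power_mult_distrib[symmetric] power_divide field_simps)
  qed
  \<comment> \<open>The integrals of the norms form, up to a factor, the binomial series at
    \<open>- norm q / a\<close>, which still has modulus below 1; this justifies integrating term by
    term.\<close>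
  have "summable (\<lambda>n. ((- x) gchoose n) * (- norm q / a) ^ n)"
    using gen_binomial_real[of "- norm q / a" "- x"] q a by (auto intro: sums_summable)
  then have "summable (\<lambda>n. \<integral>u. norm (f n u) \<partial>lborel)" unfolding intn by (rule summable_mult)
  moreover have "summable (\<lambda>n. norm (f n u))" for u
    unfolding f_eq norm_mult by (intro summable_mult summable_norm_exp)
  ultimately have "(\<lambda>n. integral\<^sup>L lborel (f n)) sums (\<integral>u. (\<Sum>n. f n u) \<partial>lborel)"
    by (intro sums_integral fi) auto
  then have "(\<lambda>n. integral\<^sup>L lborel (f n)) sums integral\<^sup>L lborel (laplace_integrand v p)"
    unfolding fs .
  moreover have "(\<lambda>n. integral\<^sup>L lborel (f n)) sums ((Gamma v * of_real a powr (- v)) * (1 + q / of_real a) powr (- v))"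
    unfolding ints by (intro sums_mult gen_binomial_complex qa)
  ultimately have "integral\<^sup>L lborel (laplace_integrand v p) = Gamma v * (of_real a powr (- v) * (1 + q / of_real a) powr (- v))"
    by (metis sums_unique2 mult.assoc)
  also have "1 + q / of_real a = p / of_real a" using a by (simp add: q_def field_simps)
  also have "of_real a powr (- v) * (p / of_real a) powr (- v) = p powr (- v)"
  proof -
    have "Ln (of_real a * (p / of_real a)) = of_real (ln a) + Ln (p / of_real a)"
      using a p0 by (subst Ln_times_of_real) (auto simp: Ln_of_real)
    then have "Ln p = of_real (ln a) + Ln (p / of_real a)" using a by simp
    then show ?thesis using a p0 by (simp add: powr_def exp_add[symmetric] Ln_of_real distrib_left)
  qed
  finally show ?thesis .
qed

section \<open>Mellin inversion for powers of 1 + z\<close>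

lemma integrable_exp_minus_abs: "integrable lborel (\<lambda>t::real. exp (- \<bar>t\<bar>))"
proof -
  let ?g = "\<lambda>t. Re (laplace_integrand 1 1 t)"
  have g: "integrable lborel ?g" by (intro integrable_Re laplace_integrable) auto
  have "integrable lborel (\<lambda>t. ?g (0 + (-1) * t))" by (rule lborel_integrable_real_affine[OF g]) simp
  then have "integrable lborel (\<lambda>t. ?g t + ?g (- t))" using g by simp
  then show ?thesis
  proof (rule integrable_cong_AE_imp)
    show "AE t in lborel. ?g t + ?g (- t) = exp (- \<bar>t\<bar>)"
      using AE_lborel_singleton[of 0]
      by eventually_elim (auto simp: laplace_integrand_def indicator_def abs_if Re_exp)
    show "(\<lambda>t::real. exp (- \<bar>t\<bar>)) \<in> borel_measurable lborel" by measurable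
  qed
qed

lemma exp_decay_bound:
  fixes f :: "real \<Rightarrow> complex"
  assumes "continuous_on UNIV f" "\<And>t. \<bar>t\<bar> \<ge> Y \<Longrightarrow> norm (f t) \<le> C * exp (- \<bar>t\<bar>)"
  shows "\<exists>D\<ge>0. \<forall>t. norm (f t) \<le> D * exp (- \<bar>t\<bar>)"
proof -
  have "compact ((\<lambda>t. norm (f t) * exp \<bar>t\<bar>) ` {-\<bar>Y\<bar>..\<bar>Y\<bar>})"
    by (intro compact_continuous_image continuous_intros continuous_on_subset[OF assms(1)]) auto
  then obtain b where b: "\<And>t. t \<in> {-\<bar>Y\<bar>..\<bar>Y\<bar>} \<Longrightarrow> \<bar>norm (f t) * exp \<bar>t\<bar>\<bar> \<le> b"
    by (force dest!: compact_imp_bounded simp: bounded_iff)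
  show ?thesis
  proof (intro exI[of _ "max \<bar>C\<bar> b"] conjI allI)
    fix t
    show "norm (f t) \<le> max \<bar>C\<bar> b * exp (- \<bar>t\<bar>)"
    proof (cases "\<bar>t\<bar> \<ge> \<bar>Y\<bar>")
      case True
      then have "norm (f t) \<le> C * exp (- \<bar>t\<bar>)" using assms(2) by auto
      also have "\<dots> \<le> max \<bar>C\<bar> b * exp (- \<bar>t\<bar>)" by (intro mult_right_mono) auto
      finally show ?thesis .
    next
      case False
      then have "\<bar>t\<bar> \<le> \<bar>Y\<bar>" by linarith
      then have "norm (f t) * exp \<bar>t\<bar> \<le> b" using b[of t] by (simp add: abs_le_iff)
      then have "norm (f t) \<le> b * exp (- \<bar>t\<bar>)" by (simp add: exp_minus field_simps)
      also have "\<dots> \<le> max \<bar>C\<bar> b * exp (- \<bar>t\<bar>)" by (intro mult_right_mono) auto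
      finally show ?thesis .
    qed
  qed auto
qed

lemma integrable_exp_decay:
  fixes f :: "real \<Rightarrow> complex"
  assumes "f \<in> borel_measurable borel" "\<And>t. norm (f t) \<le> D * exp (- \<bar>t\<bar>)"
  shows "integrable lborel f"
proof (rule Bochner_Integration.integrable_bound)
  show "integrable lborel (\<lambda>t. D * exp (- \<bar>t\<bar>))" by (intro integrable_mult_right integrable_exp_minus_abs)
  show "AE t in lborel. norm (f t) \<le> norm (D * exp (- \<bar>t\<bar>))"
    using assms(2) by (intro AE_I2) (smt (verit) real_norm_def)
qed (use assms in simp)

text \<open>With \<open>\<eta> = pi / 2 - 1\<close> each factor decays at rate 1. Any total rate
  below \<open>pi\<close> could be had; rate 2 leaves room for weights of growth
  \<open>exp |t|\<close> on the line.\<close>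

lemma Gamma_product_bound:
  assumes "M \<ge> 0"
  shows "\<exists>C>0. \<forall>\<tau>. \<bar>Re \<tau>\<bar> \<le> M \<and> \<bar>Im \<tau>\<bar> \<ge> \<bar>Im s\<bar> + 1 \<longrightarrow> norm (Gamma \<tau> * Gamma (s - \<tau>)) \<le> C * exp (- 2 * \<bar>Im \<tau>\<bar>)"
proof -
  define \<eta> where "\<eta> = pi / 2 - 1"
  have eta: "\<eta> > 0" "pi / 2 - \<eta> = 1" using pi_gt3 by (auto simp: \<eta>_def)
  obtain C1 where C1: "C1 > 0" "\<And>z. \<bar>Re z\<bar> \<le> M + \<bar>Re s\<bar> \<Longrightarrow> \<bar>Im z\<bar> \<ge> 1 \<Longrightarrow> norm (Gamma z) \<le> C1 * exp (- \<bar>Im z\<bar>)"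
    using Gamma_cmod_exp_bound[of "M + \<bar>Re s\<bar>" \<eta>] assms eta by auto
  show ?thesis
  proof (intro exI[of _ "C1 * C1 * exp \<bar>Im s\<bar>"] conjI allI impI)
    fix \<tau> assume t: "\<bar>Re \<tau>\<bar> \<le> M \<and> \<bar>Im \<tau>\<bar> \<ge> \<bar>Im s\<bar> + 1"
    have "norm (Gamma \<tau>) \<le> C1 * exp (- \<bar>Im \<tau>\<bar>)" using t by (intro C1) auto
    moreover have "norm (Gamma (s - \<tau>)) \<le> C1 * exp (\<bar>Im s\<bar> - \<bar>Im \<tau>\<bar>)"
    proof -
      have "norm (Gamma (s - \<tau>)) \<le> C1 * exp (- \<bar>Im (s - \<tau>)\<bar>)" using t by (intro C1) auto
      also have "\<dots> \<le> C1 * exp (\<bar>Im s\<bar> - \<bar>Im \<tau>\<bar>)" using C1(1) by (intro mult_left_mono) auto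
      finally show ?thesis .
    qed
    ultimately have "norm (Gamma \<tau> * Gamma (s - \<tau>)) \<le> (C1 * exp (- \<bar>Im \<tau>\<bar>)) * (C1 * exp (\<bar>Im s\<bar> - \<bar>Im \<tau>\<bar>))"
      unfolding norm_mult using C1(1) by (intro mult_mono) auto
    also have "\<dots> = C1 * C1 * exp \<bar>Im s\<bar> * (exp (- \<bar>Im \<tau>\<bar>) * exp (- \<bar>Im \<tau>\<bar>))"
      by (simp add: exp_diff exp_minus field_simps)
    also have "exp (- \<bar>Im \<tau>\<bar>) * exp (- \<bar>Im \<tau>\<bar>) = exp (- 2 * \<bar>Im \<tau>\<bar>)" by (simp flip: exp_add)
    finally show "norm (Gamma \<tau> * Gamma (s - \<tau>)) \<le> C1 * C1 * exp \<bar>Im s\<bar> * exp (- 2 * \<bar>Im \<tau>\<bar>)" .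
  qed (use C1 in auto)
qed

section \<open>Differentiation under the integral sign\<close>

lemma has_vector_derivative_iff_tendsto_quotient:
  fixes f :: "real \<Rightarrow> complex"
  shows "(f has_vector_derivative D) (at x) \<longleftrightarrow> (\<lambda>y. (f y - f x) /\<^sub>R (y - x)) \<midarrow>x\<rightarrow> D"
proof -
  have "(f has_vector_derivative D) (at x) \<longleftrightarrow> (\<lambda>y. norm (f y - f x - (y - x) *\<^sub>R D) / norm (y - x)) \<midarrow>x\<rightarrow> 0"
    unfolding has_vector_derivative_def has_derivative_iff_norm by (simp add: bounded_linear_scaleR_left)
  also have "\<dots> \<longleftrightarrow> (\<lambda>y. norm ((f y - f x) /\<^sub>R (y - x) - D)) \<midarrow>x\<rightarrow> 0"
  proof (rule tendsto_cong)
    show "\<forall>\<^sub>F y in at x. norm (f y - f x - (y - x) *\<^sub>R D) / norm (y - x) = norm ((f y - f x) /\<^sub>R (y - x) - D)"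
    proof (rule eventually_mono[OF eventually_neq_at_within])
      fix y assume "y \<noteq> x"
      then have "(f y - f x) /\<^sub>R (y - x) - D = (f y - f x - (y - x) *\<^sub>R D) /\<^sub>R (y - x)"
        by (simp add: scaleR_diff_right)
      then show "norm (f y - f x - (y - x) *\<^sub>R D) / norm (y - x) = norm ((f y - f x) /\<^sub>R (y - x) - D)"
        by (simp add: divide_inverse mult.commute)
    qed
  qed
  also have "\<dots> \<longleftrightarrow> (\<lambda>y. (f y - f x) /\<^sub>R (y - x)) \<midarrow>x\<rightarrow> D"
    unfolding tendsto_norm_zero_iff by (rule LIM_zero_iff)
  finally show ?thesis .
qed

text \<open>The mean value inequality bounds the difference quotients by \<open>w\<close>, and
  dominated convergence applies along every sequence tending to \<open>x0\<close>.\<close>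

lemma has_vector_derivative_integral_param:
  fixes f f' :: "real \<Rightarrow> real \<Rightarrow> complex"
  assumes S: "open S" "convex S" "x0 \<in> S"
    and f: "\<And>x. x \<in> S \<Longrightarrow> integrable lborel (f x)"
    and d: "\<And>x t. x \<in> S \<Longrightarrow> ((\<lambda>x. f x t) has_vector_derivative f' x t) (at x)"
    and w: "integrable lborel w" "\<And>x t. x \<in> S \<Longrightarrow> norm (f' x t) \<le> w t"
    and f': "f' x0 \<in> borel_measurable lborel"
  shows "((\<lambda>x. \<integral>t. f x t \<partial>lborel) has_vector_derivative (\<integral>t. f' x0 t \<partial>lborel)) (at x0)"
proof -
  let ?Q = "\<lambda>x t. (f x t - f x0 t) /\<^sub>R (x - x0)"
  have lim: "(\<lambda>x. ?Q x t) \<midarrow>x0\<rightarrow> f' x0 t" for t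
    using d[OF S(3), of t] by (simp add: has_vector_derivative_iff_tendsto_quotient)
  have Qi: "integrable lborel (?Q x)" if "x \<in> S" for x
    using f that S(3) by (intro integrable_scaleR_right Bochner_Integration.integrable_diff)
  have bd: "norm (?Q x t) \<le> w t" if "x \<in> S" "x \<noteq> x0" for x t
  proof -
    have "norm (f x t - f x0 t) \<le> w t * norm (x - x0)"
    proof (rule differentiable_bound[OF S(2) _ _ that(1) S(3)])
      show "((\<lambda>x. f x t) has_derivative (\<lambda>h. h *\<^sub>R f' y t)) (at y within S)" if "y \<in> S" for y
        using d[OF that] unfolding has_vector_derivative_def by (rule has_derivative_at_withinI)
      show "onorm (\<lambda>h. h *\<^sub>R f' y t) \<le> w t" if "y \<in> S" for y
        by (rule onorm_le) (use w(2)[OF that, of t] in \<open>simp add: mult.commute mult_left_mono\<close>)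
    qed
    moreover have "norm (?Q x t) = norm (f x t - f x0 t) / norm (x - x0)" by (simp add: divide_inverse mult.commute)
    ultimately show ?thesis using that by (simp only: pos_divide_le_eq zero_less_norm_iff right_minus_eq not_False_eq_True)
  qed
  have eqQ: "((\<integral>t. f x t \<partial>lborel) - (\<integral>t. f x0 t \<partial>lborel)) /\<^sub>R (x - x0) = (\<integral>t. ?Q x t \<partial>lborel)" if "x \<in> S" for x
    using f[OF that] f[OF S(3)] by simp
  have "((\<lambda>x. ((\<integral>t. f x t \<partial>lborel) - (\<integral>t. f x0 t \<partial>lborel)) /\<^sub>R (x - x0)) \<longlongrightarrow> (\<integral>t. f' x0 t \<partial>lborel)) (at x0 within S)"
    unfolding tendsto_at_iff_sequentially
  proof (intro allI impI)
    fix X assume X: "\<forall>i. X i \<in> S - {x0}" "X \<longlonglongrightarrow> x0"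
    have "(\<lambda>i. \<integral>t. ?Q (X i) t \<partial>lborel) \<longlonglongrightarrow> (\<integral>t. f' x0 t \<partial>lborel)"
    proof (rule integral_dominated_convergence[OF f' _ w(1)])
      show "?Q (X i) \<in> borel_measurable lborel" for i using Qi[of "X i"] X by auto
      show "AE t in lborel. (\<lambda>i. ?Q (X i) t) \<longlonglongrightarrow> f' x0 t"
      proof (rule AE_I2)
        fix t
        have "filterlim X (at x0) sequentially" using X by (auto simp: filterlim_at)
        from filterlim_compose[OF lim this] show "(\<lambda>i. ?Q (X i) t) \<longlonglongrightarrow> f' x0 t" .
      qed
      show "AE t in lborel. norm (?Q (X i) t) \<le> w t" for i using bd[of "X i"] X by auto
    qed
    moreover have "((\<lambda>x. ((\<integral>t. f x t \<partial>lborel) - (\<integral>t. f x0 t \<partial>lborel)) /\<^sub>R (x - x0)) \<circ> X) = (\<lambda>i. \<integral>t. ?Q (X i) t \<partial>lborel)"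
      using eqQ X(1) by (auto simp: fun_eq_iff)
    ultimately show "((\<lambda>x. ((\<integral>t. f x t \<partial>lborel) - (\<integral>t. f x0 t \<partial>lborel)) /\<^sub>R (x - x0)) \<circ> X) \<longlonglongrightarrow> (\<integral>t. f' x0 t \<partial>lborel)"
      by (simp only:)
  qed
  moreover have "at x0 within S = at x0" using S by (intro at_within_open)
  ultimately show ?thesis by (simp only: has_vector_derivative_iff_tendsto_quotient)
qed

section \<open>Poles and residues of Gamma factors\<close>

lemma finite_affine_nonpos_Ints:
  fixes c :: real and d :: complex
  assumes "c \<noteq> 0"
  shows "finite {p. of_real c * p + d \<in> \<int>\<^sub>\<le>\<^sub>0 \<and> \<bar>Re p\<bar> \<le> M}"
proof (rule finite_subset)
  show "{p. of_real c * p + d \<in> \<int>\<^sub>\<le>\<^sub>0 \<and> \<bar>Re p\<bar> \<le> M} \<subseteq> (\<lambda>n. (of_int n - d) / of_real c) ` {- \<lceil>\<bar>c\<bar> * M + \<bar>Re d\<bar>\<rceil> .. 0}"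
  proof safe
    fix p assume p: "of_real c * p + d \<in> \<int>\<^sub>\<le>\<^sub>0" "\<bar>Re p\<bar> \<le> M"
    then obtain n where n: "n \<le> 0" "of_real c * p + d = of_int n" by (elim nonpos_Ints_cases)
    have "c * Re p + Re d = of_int n" using arg_cong[OF n(2), of Re] by simp
    moreover have "\<bar>c * Re p\<bar> \<le> \<bar>c\<bar> * M" using p(2) by (simp add: abs_mult mult_left_mono)
    ultimately have "- of_int n \<le> \<bar>c\<bar> * M + \<bar>Re d\<bar>" by linarith
    then have "n \<ge> - \<lceil>\<bar>c\<bar> * M + \<bar>Re d\<bar>\<rceil>" by linarith
    moreover have "p = (of_int n - d) / of_real c" using n(2) assms by (simp add: field_simps flip: n(2))
    ultimately show "p \<in> (\<lambda>n. (of_int n - d) / of_real c) ` {- \<lceil>\<bar>c\<bar> * M + \<bar>Re d\<bar>\<rceil> .. 0}" using n(1) by auto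
  qed
qed auto

text \<open>The recurrence \<open>Gamma z = Gamma (z + 1) / z\<close> exhibits the simple pole as
  \<open>h w / (w - p)\<close> with \<open>h\<close> holomorphic near \<open>p\<close>.\<close>

lemma residue_Gamma_mult:
  assumes "open S" "p \<in> S" "g holomorphic_on S" "c \<noteq> 0"
  shows "residue (\<lambda>w. Gamma (of_real c * (w - p)) * g w) p = g p / of_real c"
proof -
  define S' where "S' = S \<inter> {w. of_real c * (w - p) + 1 \<notin> \<int>\<^sub>\<le>\<^sub>0}"
  have "closed {w. of_real c * (w - p) + 1 \<in> \<int>\<^sub>\<le>\<^sub>0}"
  proof -
    have "closed ((\<lambda>w. of_real c * (w - p) + 1) -` \<int>\<^sub>\<le>\<^sub>0)"
      by (intro closed_vimage continuous_intros) auto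
    then show ?thesis by (simp add: vimage_def)
  qed
  then have "open {w. of_real c * (w - p) + 1 \<notin> \<int>\<^sub>\<le>\<^sub>0}" by (simp add: Collect_neg_eq open_Compl)
  then have S': "open S'" "p \<in> S'" using assms by (auto simp: S'_def)
  define h where "h = (\<lambda>w. Gamma (of_real c * (w - p) + 1) * g w / of_real c)"
  have "h holomorphic_on S'"
    unfolding h_def using assms by (auto intro!: holomorphic_intros holomorphic_on_subset[OF assms(3)] simp: S'_def)
  then have "residue (\<lambda>w. h w / (w - p)) p = h p" using S' by (intro residue_simple)
  moreover have "residue (\<lambda>w. Gamma (of_real c * (w - p)) * g w) p = residue (\<lambda>w. h w / (w - p)) p"
  proof (rule residue_cong)
    have "\<forall>\<^sub>F w in at p. w \<in> S' - {p}" using S' by (intro eventually_at_in_open) auto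
    then show "\<forall>\<^sub>F w in at p. Gamma (of_real c * (w - p)) * g w = h w / (w - p)"
    proof eventually_elim
      case (elim w)
      show ?case
      proof (cases "of_real c * (w - p) \<in> \<int>\<^sub>\<le>\<^sub>0")
        case True
        then obtain n where n: "n \<le> 0" "of_real c * (w - p) = of_int n" by (elim nonpos_Ints_cases)
        with elim assms have "n \<noteq> 0" by auto
        then have "of_real c * (w - p) + 1 = (of_int (n + 1) :: complex)" "n + 1 \<le> 0" using n by auto
        then have "of_real c * (w - p) + 1 \<in> \<int>\<^sub>\<le>\<^sub>0" by (metis nonpos_Ints_of_int)
        then show ?thesis using elim by (auto simp: S'_def)
      next
        case False
        then show ?thesis using elim assms by (simp add: h_def Gamma_plus1)
      qed
    qed
  qed simp
  ultimately show ?thesis by (simp add: h_def)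
qed


section \<open>Vertical lines as contours\<close>

lemma vertical_line_sides:
  "{w. Re w < b} \<subseteq> left_side (Complex b)" "{w. Re w > b} \<subseteq> right_side (Complex b)"
proof safe
  fix w assume w: "Re w < b"
  have "connected_component (- range (Complex b)) w (of_real r)" if "r < b" for r
    unfolding connected_component_def
    by (rule exI[of _ "{w. Re w < b}"]) (use w that in \<open>auto intro: convex_connected convex_halfspace_Re_lt\<close>)
  then show "w \<in> left_side (Complex b)"
    unfolding left_side_def mem_Collect_eq by (rule eventually_mono[OF eventually_gt_at_bot[of b]])
next
  fix w assume w: "Re w > b"
  have "connected_component (- range (Complex b)) w (of_real r)" if "r > b" for r
    unfolding connected_component_def
    by (rule exI[of _ "{w. Re w > b}"]) (use w that in \<open>auto intro: convex_connected convex_halfspace_Re_gt\<close>)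
  then show "w \<in> right_side (Complex b)"
    unfolding right_side_def mem_Collect_eq by (rule eventually_mono[OF eventually_gt_at_top[of b]])
qed

lemma vertical_line_has_vector_derivative: "(Complex b has_vector_derivative \<i>) (at t)"
proof -
  have "((\<lambda>t. of_real b + of_real t * \<i>) has_vector_derivative \<i>) (at t)"
    by (auto intro!: derivative_eq_intros)
  moreover have "Complex b = (\<lambda>t. of_real b + of_real t * \<i>)" by (auto simp: fun_eq_iff complex_eq_iff)
  ultimately show ?thesis by (simp only:)
qed

lemma vertical_line_C1: "Complex b piecewise_C1_differentiable_on {-T..T}"
  by (rule C1_differentiable_imp_piecewise)
     (auto simp: C1_differentiable_on_def intro!: exI[of _ "\<lambda>_. \<i>"] vertical_line_has_vector_derivative)

lemma norm_powr_real_bound: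
  assumes "z > 0" "\<bar>Re w\<bar> \<le> M"
  shows "norm (complex_of_real z powr w) \<le> exp (M * \<bar>ln z\<bar>)"
proof -
  have "norm (complex_of_real z powr w) = exp (Re w * ln z)" using assms by (simp add: norm_powr_real_powr powr_def)
  also have "Re w * ln z \<le> \<bar>Re w\<bar> * \<bar>ln z\<bar>" by (simp add: abs_mult[symmetric])
  also have "\<dots> \<le> M * \<bar>ln z\<bar>" using assms by (intro mult_right_mono) auto
  finally show ?thesis by simp
qed

text \<open>
  \<open>B\<close> is the kernel \<open>\<Gamma>(\<tau>) \<Gamma>(s - \<tau>)\<close> on the line \<open>Re \<tau> = \<sigma>\<close> and \<open>F z\<close> its inverse Mellin transform.
  As \<open>\<sigma>\<close> lies to the left of the pole \<open>\<tau> = 0\<close>, it equals \<open>(1 + z) powr (- s) - 1\<close> up to the factor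
  \<open>2 \<pi> \<Gamma>(s)\<close>.
\<close>

locale mellin_line =
  fixes s :: complex and \<sigma> :: real
  assumes s: "Re s > 0" and \<sigma>: "-1 < \<sigma>" "\<sigma> < 0"
begin

definition B :: "real \<Rightarrow> complex" where
  "B t = Gamma (Complex \<sigma> t) * Gamma (s - Complex \<sigma> t)"

lemma line_avoids_poles: "Complex \<sigma> t \<notin> \<int>\<^sub>\<le>\<^sub>0" "s - Complex \<sigma> t \<notin> \<int>\<^sub>\<le>\<^sub>0"
proof -
  show "Complex \<sigma> t \<notin> \<int>\<^sub>\<le>\<^sub>0"
  proof
    assume "Complex \<sigma> t \<in> \<int>\<^sub>\<le>\<^sub>0"
    then obtain n where n: "Complex \<sigma> t = of_int n" by (elim nonpos_Ints_cases)
    have "\<sigma> = of_int n" using arg_cong[OF n, of Re] by simp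
    then show False using \<sigma> by auto
  qed
  show "s - Complex \<sigma> t \<notin> \<int>\<^sub>\<le>\<^sub>0"
  proof
    assume "s - Complex \<sigma> t \<in> \<int>\<^sub>\<le>\<^sub>0"
    then obtain n where n: "n \<le> 0" "s - Complex \<sigma> t = of_int n" by (elim nonpos_Ints_cases)
    have "Re s - \<sigma> = of_int n" using arg_cong[OF n(2), of Re] by simp
    then show False using \<sigma> s n(1) by simp
  qed
qed

lemma continuous_on_Complex [continuous_intros]:
  "continuous_on A f \<Longrightarrow> continuous_on A (\<lambda>x. Complex \<sigma> (f x))"
  unfolding Complex_eq by (intro continuous_intros)

lemma Complex_measurable [measurable]: "Complex \<sigma> \<in> borel_measurable borel"
  by (rule borel_measurable_continuous_onI) (use continuous_on_Complex[OF continuous_on_id, of UNIV] in simp)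

lemma B_continuous: "continuous_on UNIV B"
proof -
  have "continuous_on UNIV (\<lambda>t. Gamma (Complex \<sigma> t))"
    by (rule continuous_on_compose2[of "- \<int>\<^sub>\<le>\<^sub>0" Gamma]) (use line_avoids_poles in \<open>auto intro!: continuous_intros\<close>)
  moreover have "continuous_on UNIV (\<lambda>t. Gamma (s - Complex \<sigma> t))"
    by (rule continuous_on_compose2[of "- \<int>\<^sub>\<le>\<^sub>0" Gamma]) (use line_avoids_poles in \<open>auto intro!: continuous_intros\<close>)
  ultimately show ?thesis unfolding B_def[abs_def] by (intro continuous_intros)
qed

lemma B_measurable [measurable]: "B \<in> borel_measurable borel"
  using B_continuous by (rule borel_measurable_continuous_onI)

lemma B_bound: obtains D where "D \<ge> 0" "\<And>t. norm (B t) \<le> D * exp (- 2 * \<bar>t\<bar>)"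
proof -
  obtain C where C: "C > 0" "\<And>\<tau>. \<bar>Re \<tau>\<bar> \<le> 1 \<and> \<bar>Im \<tau>\<bar> \<ge> \<bar>Im s\<bar> + 1 \<Longrightarrow> norm (Gamma \<tau> * Gamma (s - \<tau>)) \<le> C * exp (- 2 * \<bar>Im \<tau>\<bar>)"
    using Gamma_product_bound[of 1 s] by auto
  \<comment> \<open>\<open>exp_decay_bound\<close> yields rate 1; applied to \<open>B t\<close>
    times \<open>exp |t|\<close> it gives rate 2 for \<open>B\<close>.\<close>
  have "\<exists>D\<ge>0. \<forall>t. norm (B t * of_real (exp \<bar>t\<bar>)) \<le> D * exp (- \<bar>t\<bar>)"
  proof (rule exp_decay_bound)
    show "continuous_on UNIV (\<lambda>t. B t * of_real (exp \<bar>t\<bar>))" by (intro continuous_intros B_continuous)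
    fix t assume "\<bar>t\<bar> \<ge> \<bar>Im s\<bar> + 1"
    then have "norm (B t) \<le> C * exp (- 2 * \<bar>t\<bar>)" using C(2)[of "Complex \<sigma> t"] \<sigma> by (simp add: B_def)
    then have "norm (B t) * exp \<bar>t\<bar> \<le> C * exp (- 2 * \<bar>t\<bar>) * exp \<bar>t\<bar>" by (intro mult_right_mono) auto
    also have "\<dots> = C * exp (- \<bar>t\<bar>)" by (simp add: mult.assoc flip: exp_add)
    finally show "norm (B t * of_real (exp \<bar>t\<bar>)) \<le> C * exp (- \<bar>t\<bar>)" by (simp add: norm_mult)
  qed
  then obtain D where D: "D \<ge> 0" "\<And>t. norm (B t * of_real (exp \<bar>t\<bar>)) \<le> D * exp (- \<bar>t\<bar>)" by blast
  show ?thesis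
  proof (rule that[OF D(1)])
    fix t
    have "norm (B t) * exp \<bar>t\<bar> \<le> D * exp (- \<bar>t\<bar>)" using D(2)[of t] by (simp add: norm_mult)
    then have "norm (B t) \<le> D * (exp (- \<bar>t\<bar>) * exp (- \<bar>t\<bar>))" by (simp add: exp_minus field_simps)
    then show "norm (B t) \<le> D * exp (- 2 * \<bar>t\<bar>)" by (simp flip: exp_add)
  qed
qed

lemma norm_line_le: "norm (Complex \<sigma> t) \<le> 2 * exp \<bar>t\<bar>"
proof -
  have "norm (Complex \<sigma> t) \<le> 1 + \<bar>t\<bar>" using cmod_le[of "Complex \<sigma> t"] \<sigma> by simp
  also have "\<dots> \<le> exp \<bar>t\<bar>" by (rule exp_ge_add_one_self)
  finally show ?thesis by (smt (verit) exp_gt_zero)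
qed

text \<open>The weight may grow like \<open>exp |t|\<close>: \<open>B\<close> decays at rate 2, and
  one unit of this is kept for integrability. The Gamma factor and the power of
  \<open>\<plusminus> \<i> y\<close> together will have growth of just this order.\<close>

lemma line_integrable:
  assumes "w \<in> borel_measurable borel" "\<And>t. norm (w t) \<le> c * exp \<bar>t\<bar>"
  shows "integrable lborel (\<lambda>t. B t * w t)"
proof -
  obtain D where D: "D \<ge> 0" "\<And>t. norm (B t) \<le> D * exp (- 2 * \<bar>t\<bar>)" using B_bound by blast
  show ?thesis
  proof (rule integrable_exp_decay)
    show "(\<lambda>t. B t * w t) \<in> borel_measurable borel" using assms(1) by measurable
    fix t
    have "norm (B t * w t) \<le> (D * exp (- 2 * \<bar>t\<bar>)) * (c * exp \<bar>t\<bar>)"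
      unfolding norm_mult using D assms(2) by (intro mult_mono) auto
    also have "\<dots> = D * c * exp (- \<bar>t\<bar>)" by (simp add: mult_ac flip: exp_add)
    finally show "norm (B t * w t) \<le> D * c * exp (- \<bar>t\<bar>)" .
  qed
qed

lemma powr_line_measurable [measurable]: "(\<lambda>t. complex_of_real z powr (- Complex \<sigma> t + a)) \<in> borel_measurable borel"
proof (cases "z = 0")
  case False
  then show ?thesis unfolding powr_def by (auto intro!: borel_measurable_continuous_onI continuous_intros)
qed simp

lemma norm_powr_line: "z > 0 \<Longrightarrow> norm (complex_of_real z powr (- Complex \<sigma> t)) = z powr (- \<sigma>)"
  by (simp add: norm_powr_real_powr)

definition F :: "real \<Rightarrow> complex" where
  "F z = (\<integral>t. B t * of_real z powr (- Complex \<sigma> t) \<partial>lborel)"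

lemma F_integrable:
  assumes "z > 0" shows "integrable lborel (\<lambda>t. B t * of_real z powr (- Complex \<sigma> t))"
proof (rule line_integrable[where c = "z powr - \<sigma>"])
  show "norm (complex_of_real z powr (- Complex \<sigma> t)) \<le> z powr (- \<sigma>) * exp \<bar>t\<bar>" for t
    using assms by (simp add: norm_powr_line)
qed (use powr_line_measurable[of z 0] in simp)

definition F' :: "real \<Rightarrow> complex" where
  "F' z = (\<integral>t. B t * (- Complex \<sigma> t * of_real z powr (- Complex \<sigma> t - 1)) \<partial>lborel)"

lemma F_has_derivative:
  assumes z: "z > 0"
  shows "(F has_vector_derivative F' z) (at z)"
proof -
  obtain D where D: "D \<ge> 0" "\<And>t. norm (B t) \<le> D * exp (- 2 * \<bar>t\<bar>)" using B_bound by blast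
  \<comment> \<open>The exponent is negative, so on \<open>{z/2<..<2*z}\<close> the power is bounded
    by its value at the left end.\<close>
  define c where "c = (z/2) powr (- \<sigma> - 1)"
  show ?thesis unfolding F_def[abs_def] F'_def
  proof (rule has_vector_derivative_integral_param[where S = "{z/2<..<2*z}" and
   f' = "\<lambda>z t. B t * (- Complex \<sigma> t * of_real z powr (- Complex \<sigma> t - 1))"])
  show "integrable lborel (\<lambda>t. 2 * D * c * exp (- \<bar>t\<bar>))"
    by (intro integrable_mult_right integrable_exp_minus_abs)
  show "norm (B t * (- Complex \<sigma> t * of_real x powr (- Complex \<sigma> t - 1))) \<le> 2 * D * c * exp (- \<bar>t\<bar>)" if x: "x \<in> {z/2<..<2*z}" for x t
  proof -
    have "norm (complex_of_real x powr (- Complex \<sigma> t - 1)) = x powr (- \<sigma> - 1)"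
      using x z by (simp add: norm_powr_real_powr)
    also have "\<dots> \<le> c" unfolding c_def using x z \<sigma> by (intro powr_mono2') auto
    finally have "norm (B t * (- Complex \<sigma> t * of_real x powr (- Complex \<sigma> t - 1))) \<le> (D * exp (- 2 * \<bar>t\<bar>)) * ((2 * exp \<bar>t\<bar>) * c)"
      unfolding norm_mult norm_minus_cancel using D norm_line_le by (intro mult_mono) auto
    also have "\<dots> = 2 * D * c * (exp (- 2 * \<bar>t\<bar>) * exp \<bar>t\<bar>)" by simp
    also have "exp (- 2 * \<bar>t\<bar>) * exp \<bar>t\<bar> = exp (- \<bar>t\<bar>)" by (simp flip: exp_add)
    finally show ?thesis .
  qed
  show "((\<lambda>x. B t * of_real x powr (- Complex \<sigma> t)) has_vector_derivative B t * (- Complex \<sigma> t * of_real x powr (- Complex \<sigma> t - 1))) (at x)"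
    if "x \<in> {z/2<..<2*z}" for x t
  proof -
    have "x > 0" using that z by auto
    then have "((\<lambda>w. B t * w powr (- Complex \<sigma> t)) has_field_derivative B t * (- Complex \<sigma> t * of_real x powr (- Complex \<sigma> t - 1))) (at (of_real x))"
      by (auto intro!: derivative_eq_intros)
    then show ?thesis by (rule has_vector_derivative_real_field)
  qed
  show "(\<lambda>t. B t * (- Complex \<sigma> t * of_real z powr (- Complex \<sigma> t - 1))) \<in> borel_measurable lborel"
    using powr_line_measurable[of z "-1"] by simp
qed (use z F_integrable in auto)
qed

text \<open>
  \<open>\<Phi>\<close> on the line \<open>Re \<tau> = \<sigma> + 1\<close> integrates to \<open>- F'\<close> and on \<open>Re \<tau> = \<sigma>\<close> to \<open>s F + z F'\<close>; between the
  two lines lies only the pole \<open>0\<close>.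
\<close>

lemma F_ode:
  assumes z: "z > 0"
  shows "of_real (1 + z) * F' z = - s * (F z + 2 * pi * Gamma s)"
proof -
  define \<Phi> where "\<Phi> = (\<lambda>\<tau>. Gamma \<tau> * Gamma (s + 1 - \<tau>) * of_real z powr (- \<tau>))"
  have ti: "integrable lborel (\<lambda>t. B t * (Complex \<sigma> t * of_real z powr (- Complex \<sigma> t)))"
  proof (rule line_integrable[where c = "2 * z powr - \<sigma>"])
    show "(\<lambda>t. Complex \<sigma> t * of_real z powr (- Complex \<sigma> t)) \<in> borel_measurable borel"
      using powr_line_measurable[of z 0] by (auto intro!: borel_measurable_times borel_measurable_continuous_onI[of "\<lambda>t. Complex \<sigma> t"] continuous_intros)
    show "norm (Complex \<sigma> t * complex_of_real z powr (- Complex \<sigma> t)) \<le> 2 * z powr (- \<sigma>) * exp \<bar>t\<bar>" for t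
      using z norm_line_le[of t] by (simp add: norm_mult norm_powr_line mult_right_mono)
  qed
  define E where "E = (\<integral>t. B t * (Complex \<sigma> t * of_real z powr (- Complex \<sigma> t)) \<partial>lborel)"
  have F'E: "F' z = - E / of_real z"
  proof -
    have "(\<lambda>t. B t * (- Complex \<sigma> t * of_real z powr (- Complex \<sigma> t - 1))) = (\<lambda>t. (- 1 / of_real z) * (B t * (Complex \<sigma> t * of_real z powr (- Complex \<sigma> t))))"
      using z by (auto simp: powr_diff fun_eq_iff)
    then show ?thesis unfolding F'_def E_def by simp
  qed
  have up: "\<Phi> (Complex (\<sigma> + 1) t) = B t * (Complex \<sigma> t * of_real z powr (- Complex \<sigma> t)) / of_real z" for t
  proof -
    have "Complex (\<sigma> + 1) t = Complex \<sigma> t + 1" by (simp add: complex_eq_iff)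
    then have "\<Phi> (Complex (\<sigma> + 1) t) = (Complex \<sigma> t * Gamma (Complex \<sigma> t)) * Gamma (s - Complex \<sigma> t) * of_real z powr (- Complex \<sigma> t - 1)"
      using line_avoids_poles(1)[of t] by (simp add: \<Phi>_def Gamma_plus1)
    then show ?thesis using z by (simp add: B_def powr_diff)
  qed
  have lo: "\<Phi> (Complex \<sigma> t) = s * (B t * of_real z powr (- Complex \<sigma> t)) - B t * (Complex \<sigma> t * of_real z powr (- Complex \<sigma> t))" for t
  proof -
    have eq: "Gamma (s + 1 - Complex \<sigma> t) = (s - Complex \<sigma> t) * Gamma (s - Complex \<sigma> t)"
      using Gamma_plus1[OF line_avoids_poles(2)[of t]] by (simp add: algebra_simps)
    show ?thesis unfolding \<Phi>_def B_def by (subst eq) (simp add: algebra_simps)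
  qed
  have "\<i> * (E / of_real z) = \<i> * (s * F z - E) + 2 * pi * \<i> * residue \<Phi> 0"
  proof (rule contour_shift[where \<gamma> = "Complex (\<sigma> + 1)" and R = 0 and c = "\<sigma> + 1" and PL = "\<int>\<^sub>\<le>\<^sub>0 - {0}" and PR = "{\<tau>. s + 1 - \<tau> \<in> \<int>\<^sub>\<le>\<^sub>0}"])
    show "\<Phi> holomorphic_on - (\<int>\<^sub>\<le>\<^sub>0 - {0} \<union> {\<tau>. s + 1 - \<tau> \<in> \<int>\<^sub>\<le>\<^sub>0} \<union> {0})"
      unfolding \<Phi>_def using z by (auto intro!: holomorphic_intros)
    show "0 \<in> left_side (Complex (\<sigma> + 1))" using vertical_line_sides(1)[of "\<sigma> + 1"] \<sigma> by auto
    have neg: "Re p \<le> -1" if "p \<in> \<int>\<^sub>\<le>\<^sub>0 - {0}" for p :: complex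
    proof -
      from that obtain n where "n \<le> 0" "p = of_int n" "n \<noteq> 0" by (auto elim!: nonpos_Ints_cases)
      then show ?thesis by simp
    qed
    show "Re p < \<sigma>" if "p \<in> \<int>\<^sub>\<le>\<^sub>0 - {0}" for p using neg[OF that] \<sigma> by simp
    show "\<int>\<^sub>\<le>\<^sub>0 - {0} \<subseteq> left_side (Complex (\<sigma> + 1))"
    proof
      fix p :: complex assume "p \<in> \<int>\<^sub>\<le>\<^sub>0 - {0}"
      from neg[OF this] have "p \<in> {w. Re w < \<sigma> + 1}" using \<sigma> by simp
      then show "p \<in> left_side (Complex (\<sigma> + 1))" using vertical_line_sides(1) by (rule subsetD[rotated])
    qed
    have pos: "Re p > \<sigma> + 1" if "p \<in> {\<tau>. s + 1 - \<tau> \<in> \<int>\<^sub>\<le>\<^sub>0}" for p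
    proof -
      from that obtain n where n: "n \<le> 0" "s + 1 - p = of_int n" by (auto elim!: nonpos_Ints_cases)
      have "Re s + 1 - Re p = of_int n" using arg_cong[OF n(2), of Re] by simp
      moreover have "of_int n \<le> (0::real)" using n(1) by simp
      ultimately show ?thesis using s \<sigma> by linarith
    qed
    show "Re p > \<sigma>" if "p \<in> {\<tau>. s + 1 - \<tau> \<in> \<int>\<^sub>\<le>\<^sub>0}" for p using pos[OF that] by simp
    show "{\<tau>. s + 1 - \<tau> \<in> \<int>\<^sub>\<le>\<^sub>0} \<subseteq> right_side (Complex (\<sigma> + 1))"
      using pos by (intro order_trans[OF _ vertical_line_sides(2)] subsetI) (simp only: mem_Collect_eq)
    show "finite {p \<in> \<int>\<^sub>\<le>\<^sub>0 - {0} \<union> {\<tau>. s + 1 - \<tau> \<in> \<int>\<^sub>\<le>\<^sub>0}. \<bar>Re p\<bar> \<le> M}" for M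
      by (rule finite_subset[OF _ finite_UnI[OF finite_affine_nonpos_Ints[of 1 0 M] finite_affine_nonpos_Ints[of "-1" "s + 1" M]]]) auto
    show "\<exists>C Y. \<forall>w. \<bar>Re w\<bar> \<le> M \<and> \<bar>Im w\<bar> \<ge> Y \<longrightarrow> norm (\<Phi> w) \<le> C * exp (- \<bar>Im w\<bar>)" for M
    proof -
      obtain C where C: "C > 0" "\<And>\<tau>. \<bar>Re \<tau>\<bar> \<le> \<bar>M\<bar> \<and> \<bar>Im \<tau>\<bar> \<ge> \<bar>Im (s + 1)\<bar> + 1 \<Longrightarrow> norm (Gamma \<tau> * Gamma (s + 1 - \<tau>)) \<le> C * exp (- 2 * \<bar>Im \<tau>\<bar>)"
        using Gamma_product_bound[of "\<bar>M\<bar>" "s + 1"] by auto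
      show ?thesis
      proof (rule exI[of _ "C * exp (\<bar>M\<bar> * \<bar>ln z\<bar>)"], rule exI[of _ "\<bar>Im (s + 1)\<bar> + 1"], intro allI impI)
        fix w assume w: "\<bar>Re w\<bar> \<le> M \<and> \<bar>Im (s + 1)\<bar> + 1 \<le> \<bar>Im w\<bar>"
        have "norm (\<Phi> w) \<le> (C * exp (- 2 * \<bar>Im w\<bar>)) * exp (\<bar>M\<bar> * \<bar>ln z\<bar>)"
          unfolding \<Phi>_def norm_mult[of "Gamma w * Gamma (s + 1 - w)"]
        proof (rule mult_mono)
          show "norm (Gamma w * Gamma (s + 1 - w)) \<le> C * exp (- 2 * \<bar>Im w\<bar>)" by (rule C(2)) (use w in auto)
          show "norm (of_real z powr (- w)) \<le> exp (\<bar>M\<bar> * \<bar>ln z\<bar>)" by (rule norm_powr_real_bound) (use w z in auto)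
        qed (use C in auto)
        also have "\<dots> \<le> (C * exp (- \<bar>Im w\<bar>)) * exp (\<bar>M\<bar> * \<bar>ln z\<bar>)"
          using C(1) by (intro mult_right_mono mult_left_mono) auto
        finally show "norm (\<Phi> w) \<le> C * exp (\<bar>M\<bar> * \<bar>ln z\<bar>) * exp (- \<bar>Im w\<bar>)" by (simp add: mult_ac)
      qed
    qed
    have "((\<lambda>t. B t * (Complex \<sigma> t * of_real z powr (- Complex \<sigma> t)) / of_real z * \<i>) has_integral (E / of_real z * \<i>)) UNIV"
      unfolding E_def by (intro has_integral_mult_left has_integral_divide has_integral_integral_lborel ti)
    then show "((\<lambda>t. \<Phi> (Complex (\<sigma> + 1) t) * vector_derivative (Complex (\<sigma> + 1)) (at t)) has_integral \<i> * (E / of_real z)) UNIV"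
      by (simp add: up vector_derivative_at[OF vertical_line_has_vector_derivative] mult.commute)
    show "((\<lambda>t. \<Phi> (Complex \<sigma> t)) has_integral (s * F z - E)) UNIV"
      unfolding lo F_def E_def using z by (intro has_integral_diff has_integral_mult_right has_integral_integral_lborel ti F_integrable)
  qed (use \<sigma> vertical_line_C1 in auto)
  also have "residue \<Phi> 0 = Gamma (s + 1)"
  proof -
    have "residue (\<lambda>w. Gamma (of_real 1 * (w - 0)) * (Gamma (s + 1 - w) * of_real z powr (- w))) 0 = Gamma (s + 1 - 0) * of_real z powr (- 0) / of_real 1"
    proof (rule residue_Gamma_mult)
      have "closed ((\<lambda>w. s + 1 - w) -` \<int>\<^sub>\<le>\<^sub>0)" by (intro closed_vimage continuous_intros) auto
      then show "open (- ((\<lambda>w. s + 1 - w) -` \<int>\<^sub>\<le>\<^sub>0))" by (rule open_Compl)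
      show "0 \<in> - ((\<lambda>w. s + 1 - w) -` \<int>\<^sub>\<le>\<^sub>0)"
        using s by (auto elim!: nonpos_Ints_cases simp: complex_eq_iff)
      show "(\<lambda>w. Gamma (s + 1 - w) * of_real z powr (- w)) holomorphic_on - ((\<lambda>w. s + 1 - w) -` \<int>\<^sub>\<le>\<^sub>0)"
        using z by (auto intro!: holomorphic_intros)
    qed simp
    then show ?thesis using z by (simp add: \<Phi>_def mult.assoc)
  qed
  also have "Gamma (s + 1) = s * Gamma s"
    using s by (intro Gamma_plus1) (auto elim!: nonpos_Ints_cases)
  finally have "\<i> * (E / of_real z) = \<i> * (s * F z - E + 2 * pi * (s * Gamma s))" by (simp add: algebra_simps)
  then have "E / of_real z = s * F z - E + 2 * pi * (s * Gamma s)" by (metis mult_left_cancel complex_i_not_zero)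
  moreover have "E = - of_real z * F' z" using F'E z by simp
  ultimately have "- F' z = s * F z + of_real z * F' z + 2 * pi * (s * Gamma s)" using z by simp
  then show ?thesis by (simp add: algebra_simps) (metis add.commute add.left_commute add_diff_cancel diff_add_cancel minus_diff_eq uminus_add_conv_diff)
qed

text \<open>By \<open>F_ode\<close> the function \<open>h\<close> is constant. Its value is the
  limit at 0, where \<open>F\<close> vanishes because the powers on the line have modulus
  \<open>z powr (- \<sigma>)\<close> and \<open>\<sigma> < 0\<close>.\<close>

lemma mellin_inversion:
  assumes z: "z > 0"
  shows "F z = 2 * pi * Gamma s * (of_real (1 + z) powr (- s) - 1)"
proof -
  define c where "c = 2 * pi * Gamma s"
  define h where "h = (\<lambda>z. of_real (1 + z) powr s * (F z + c))"
  have "(h has_vector_derivative 0) (at x within {0<..})" if "x \<in> {0<..}" for x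
  proof (rule has_vector_derivative_at_within)
    have x: "x > 0" using that by simp
    have "((\<lambda>w. (1 + w) powr s) has_field_derivative s * (1 + of_real x) powr (s - 1)) (at (of_real x))"
      using x by (auto intro!: derivative_eq_intros simp: complex_nonpos_Reals_iff)
    from has_vector_derivative_real_field[OF this]
    have "((\<lambda>x. of_real (1 + x) powr s) has_vector_derivative s * (of_real (1 + x)) powr (s - 1)) (at x)"
      by simp
    moreover have "((\<lambda>z. F z + c) has_vector_derivative F' x + 0) (at x)"
      by (intro has_vector_derivative_add F_has_derivative x has_vector_derivative_const)
    ultimately have "(h has_vector_derivative of_real (1 + x) powr s * (F' x + 0) + s * (of_real (1 + x)) powr (s - 1) * (F x + c)) (at x)"
      unfolding h_def by (rule has_vector_derivative_mult)
    moreover have "of_real (1 + x) powr s = of_real (1 + x) * of_real (1 + x) powr (s - 1)"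
    proof -
      have "complex_of_real (1 + x) \<noteq> 0" using x unfolding of_real_eq_0_iff by simp
      then show ?thesis by (simp add: powr_diff)
    qed
    then have "of_real (1 + x) powr s * (F' x + 0) + s * (of_real (1 + x)) powr (s - 1) * (F x + c) =
       of_real (1 + x) powr (s - 1) * (of_real (1 + x) * F' x + s * (F x + c))" by (simp add: algebra_simps)
    also have "\<dots> = 0" unfolding F_ode[OF x] c_def by simp
    ultimately show "(h has_vector_derivative 0) (at x)" by (simp only:)
  qed
  then obtain C where C: "\<And>x. x \<in> {0<..} \<Longrightarrow> h x = C"
    using has_vector_derivative_zero_constant[of "{0<..}" h] by (auto simp: convex_real_interval)
  have "(F \<longlongrightarrow> 0) (at_right 0)"
  proof (rule Lim_null_comparison)
    show "\<forall>\<^sub>F z in at_right 0. norm (F z) \<le> (\<integral>t. norm (B t) \<partial>lborel) * z powr (- \<sigma>)"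
      using eventually_at_right_less[of 0]
    proof eventually_elim
      case (elim z)
      have "norm (F z) \<le> (\<integral>t. norm (B t * of_real z powr (- Complex \<sigma> t)) \<partial>lborel)"
        unfolding F_def by (rule integral_norm_bound)
      also have "\<dots> = (\<integral>t. norm (B t) \<partial>lborel) * z powr (- \<sigma>)" using elim by (simp add: norm_mult norm_powr_line)
      finally show ?case .
    qed
    have "((\<lambda>z. z powr (- \<sigma>)) \<longlongrightarrow> 0 powr (- \<sigma>)) (at_right (0::real))"
      by (intro tendsto_powr' tendsto_const tendsto_ident_at)
         (use \<sigma> eventually_at_right_less[of "0::real"] in \<open>auto elim: eventually_mono\<close>)
    from tendsto_mult[OF tendsto_const this]
    show "((\<lambda>z. (\<integral>t. norm (B t) \<partial>lborel) * z powr (- \<sigma>)) \<longlongrightarrow> 0) (at_right 0)" by simp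
  qed
  moreover have "((\<lambda>z. complex_of_real (1 + z) powr s) \<longlongrightarrow> of_real (1 + 0) powr s) (at_right 0)"
    by (intro tendsto_intros) (auto simp: complex_nonpos_Reals_iff)
  ultimately have "(h \<longlongrightarrow> of_real (1 + 0) powr s * (0 + c)) (at_right 0)"
    unfolding h_def by (intro tendsto_mult tendsto_add tendsto_const)
  moreover have "(h \<longlongrightarrow> C) (at_right 0)"
    by (rule tendsto_eventually) (use eventually_at_right_less[of "0::real"] C in \<open>auto elim: eventually_mono\<close>)
  ultimately have "C = c" using tendsto_unique[of "at_right (0::real)"] by fastforce
  then have "of_real (1 + z) powr s * (F z + c) = c" using C[of z] z by (simp add: h_def)
  moreover have "complex_of_real (1 + z) \<noteq> 0" using z unfolding of_real_eq_0_iff by simp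
  ultimately have "F z + c = c * of_real (1 + z) powr (- s)" by (simp add: powr_minus field_simps)
  then show ?thesis by (simp add: c_def algebra_simps)
qed

end

section \<open>The cosine transform as a Mellin-Barnes integral\<close>

lemma integrable_powr_0_1:
  assumes "a > -1"
  shows "integrable lborel (\<lambda>u::real. indicator {0<..1} u *\<^sub>R u powr a)"
proof -
  have "(\<lambda>u. u powr a) absolutely_integrable_on {0<..1}"
    using integrable_on_powr_from_0'[OF assms, of 1] by (intro nonnegative_absolutely_integrable_1) auto
  then show ?thesis unfolding set_integrable_def
    by (subst (asm) integrable_completion) (auto intro!: borel_measurable_continuous_on_indicator continuous_intros)
qed

lemma integrable_powr_1_inf:
  assumes "a < -1"
  shows "integrable lborel (\<lambda>u::real. indicator {1..} u *\<^sub>R u powr a)"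
proof -
  have "(\<lambda>u. u powr a) integrable_on {1..}"
    using has_integral_powr_to_inf[of a 1] assms by (auto simp: integrable_on_def)
  then have "(\<lambda>u. u powr a) absolutely_integrable_on {1..}"
    by (intro nonnegative_absolutely_integrable_1) auto
  then show ?thesis unfolding set_integrable_def
    by (subst (asm) integrable_completion) (auto intro!: borel_measurable_continuous_on_indicator continuous_intros)
qed

text \<open>
  \<open>v\<close> is the exponent that the substitution \<open>x = u ^ K\<close> leaves for the Laplace transform in \<open>u\<close>;
  the conditions on \<open>\<sigma>\<close> say that its real part \<open>r\<close> lies in the unit interval.
\<close>

locale mellin_barnes = mellin_line +
  fixes K :: nat
  assumes K: "K > 0" and s1: "Re s > 1" and K\<sigma>: "- Re s < K * \<sigma>" "K * \<sigma> < 1 - Re s"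
begin

definition v :: "real \<Rightarrow> complex" where "v t = 1 - s - of_nat K * Complex \<sigma> t"

definition r :: real where "r = 1 - Re s - K * \<sigma>"

lemma v_simps [simp]: "Re (v t) = r" "Im (v t) = - Im s - real K * t"
  by (simp_all add: v_def r_def)

lemma r: "0 < r" "r < 1" using K\<sigma> by (auto simp: r_def)

definition \<phi> :: "real \<Rightarrow> complex" where
  "\<phi> u = indicator {0<..} u *\<^sub>R ((of_real (1 + u ^ K) powr (- s) - 1) * of_real u powr (- s))"

lemma \<phi>_measurable [measurable]: "\<phi> \<in> borel_measurable borel"
proof -
  have "\<phi> = (\<lambda>u. indicator {0<..} u *\<^sub>R ((exp (- s * of_real (ln (1 + u ^ K))) - 1) * exp (- s * of_real (ln u))))"
  proof
    fix u
    have "of_real (1 + u ^ K) powr (- s) = exp (- s * of_real (ln (1 + u ^ K)))" if "u > 0"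
    proof -
      have "1 + u ^ K > 0" using that by (intro add_pos_pos) auto
      then show ?thesis unfolding powr_def Ln_of_real[OF \<open>1 + u ^ K > 0\<close>] of_real_eq_0_iff by auto
    qed
    then show "\<phi> u = indicator {0<..} u *\<^sub>R ((exp (- s * of_real (ln (1 + u ^ K))) - 1) * exp (- s * of_real (ln u)))"
      unfolding \<phi>_def by (cases "u > 0") (simp_all add: powr_def[of "of_real u"] Ln_of_real)
  qed
  then show ?thesis by (simp only:) measurable
qed

lemma v_measurable [measurable]: "v \<in> borel_measurable borel"
  unfolding v_def[abs_def] by measurable

lemma \<phi>_eq:
  assumes u: "u > 0"
  shows "2 * pi * Gamma s * \<phi> u = (\<integral>t. B t * of_real u powr (v t - 1) \<partial>lborel)"
proof -
  have uK: "u ^ K > 0" using u by simp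
  have "2 * pi * Gamma s * \<phi> u = F (u ^ K) * of_real u powr (- s)"
    using u unfolding mellin_inversion[OF uK] by (simp add: \<phi>_def)
  also have "\<dots> = (\<integral>t. B t * of_real (u ^ K) powr (- Complex \<sigma> t) * of_real u powr (- s) \<partial>lborel)"
    unfolding F_def by simp
  also have "(\<lambda>t. B t * of_real (u ^ K) powr (- Complex \<sigma> t) * of_real u powr (- s)) = (\<lambda>t. B t * of_real u powr (v t - 1))"
  proof
    fix t
    have "complex_of_real (u ^ K) powr (- Complex \<sigma> t) * of_real u powr (- s) = of_real u powr (v t - 1)"
      using u uK by (simp add: powr_def Ln_of_real ln_realpow exp_add[symmetric] v_def algebra_simps del: of_real_power)
    then show "B t * of_real (u ^ K) powr (- Complex \<sigma> t) * of_real u powr (- s) = B t * of_real u powr (v t - 1)"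
      by (simp add: mult.assoc)
  qed
  finally show ?thesis .
qed

text \<open>Near 0 the representation \<open>\<phi>_eq\<close> bounds \<open>\<phi>\<close> by a
  multiple of \<open>u powr (r - 1)\<close>, integrable as \<open>r > 0\<close>. Beyond 1 the
  bracket has norm at most 2 and \<open>Re s > 1\<close> suffices.\<close>

lemma \<phi>_integrable: "integrable lborel \<phi>"
proof (rule Bochner_Integration.integrable_bound)
  define c where "c = (\<integral>t. norm (B t) \<partial>lborel) / norm (2 * pi * Gamma s)"
  have c0: "c \<ge> 0" unfolding c_def by (intro divide_nonneg_nonneg integral_nonneg) auto
  show "integrable lborel (\<lambda>u. c * (indicator {0<..1} u *\<^sub>R u powr (r - 1)) + 2 * (indicator {1..} u *\<^sub>R u powr (- Re s)))"
    using r s1 by (intro Bochner_Integration.integrable_add integrable_mult_right integrable_powr_0_1 integrable_powr_1_inf) auto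
  have G: "Gamma s \<noteq> 0" using s by (auto simp: Gamma_eq_zero_iff elim!: nonpos_Ints_cases)
  have "norm (\<phi> u) \<le> c * (indicator {0<..1} u *\<^sub>R u powr (r - 1)) + 2 * (indicator {1..} u *\<^sub>R u powr (- Re s))" for u
  proof (cases "u \<le> 0")
    case True then show ?thesis by (simp add: \<phi>_def)
  next
    case False
    show ?thesis
    proof (cases "u \<le> 1")
      case True
      have "norm (2 * pi * Gamma s) * norm (\<phi> u) \<le> (\<integral>t. norm (B t * of_real u powr (v t - 1)) \<partial>lborel)"
        unfolding norm_mult[symmetric] using False by (subst \<phi>_eq) (auto intro: integral_norm_bound)
      also have "\<dots> = (\<integral>t. norm (B t) \<partial>lborel) * u powr (r - 1)"
        using False by (simp add: norm_mult norm_powr_real_powr)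
      finally have "norm (\<phi> u) \<le> c * u powr (r - 1)" using G by (simp add: c_def norm_mult field_simps)
      then show ?thesis using True False by (auto simp: indicator_def)
    next
      case u: False
      have "norm (complex_of_real (1 + u ^ K) powr (- s)) = (1 + u ^ K) powr (- Re s)"
        using False by (subst norm_powr_real_powr) auto
      also have "\<dots> \<le> 1 powr (- Re s)" using s False by (intro powr_mono2') auto
      finally have "norm (complex_of_real (1 + u ^ K) powr (- s) - 1) \<le> 2"
        using norm_triangle_ineq4[of "complex_of_real (1 + u ^ K) powr (- s)" 1] by simp
      then have "norm (\<phi> u) \<le> 2 * u powr (- Re s)"
        using False by (simp add: \<phi>_def norm_mult norm_powr_real_powr mult_right_mono)
      then show ?thesis using u by (auto simp: indicator_def)
    qed
  qed
  then show "AE u in lborel. norm (\<phi> u) \<le> norm (c * (indicator {0<..1} u *\<^sub>R u powr (r - 1)) + 2 * (indicator {1..} u *\<^sub>R u powr (- Re s)))"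
    by (intro AE_I2) (smt (verit) real_norm_def)
qed simp

text \<open>For \<open>Re p > 0\<close> Fubini's theorem applies: the inner integral of the norm is
  \<open>norm (B t)\<close> times a constant, by \<open>laplace_integral_norm\<close>.\<close>

lemma laplace_\<phi>:
  assumes p: "Re p > 0"
  shows "2 * pi * Gamma s * (\<integral>u. \<phi> u * exp (- p * of_real u) \<partial>lborel) = (\<integral>t. B t * (Gamma (v t) * p powr (- v t)) \<partial>lborel)"
proof -
  define g where "g = (\<lambda>t u. B t * laplace_integrand (v t) p u)"
  have g_eq: "case_prod g = (\<lambda>(t, u). B t * (indicator {0<..} u *\<^sub>R (exp ((v t - 1) * of_real (ln u)) * exp (- p * of_real u))))"
    by (auto simp: g_def laplace_integrand_def fun_eq_iff indicator_def powr_def Ln_of_real)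
  have meas: "case_prod g \<in> borel_measurable (lborel \<Otimes>\<^sub>M lborel)"
    unfolding g_eq by measurable
  have int: "integrable (lborel \<Otimes>\<^sub>M lborel) (case_prod g)"
  proof (rule lborel_pair.Fubini_integrable[OF meas])
    have "(\<lambda>t. \<integral>u. norm (case_prod g (t, u)) \<partial>lborel) = (\<lambda>t. norm (B t * of_real (Gamma r * Re p powr (- r))))"
      using p r by (auto simp: g_def norm_mult laplace_integral_norm fun_eq_iff abs_mult)
    moreover have "integrable lborel (\<lambda>t. B t * of_real (Gamma r * Re p powr (- r)))"
    proof (rule line_integrable)
      show "norm (complex_of_real (Gamma r * Re p powr (- r))) \<le> \<bar>Gamma r * Re p powr (- r)\<bar> * exp \<bar>t\<bar>" for t
        using mult_left_mono[of 1 "exp \<bar>t\<bar>" "\<bar>Gamma r * Re p powr (- r)\<bar>"] unfolding norm_of_real by simp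
    qed simp
    ultimately show "integrable lborel (\<lambda>t. \<integral>u. norm (case_prod g (t, u)) \<partial>lborel)"
      by (simp only:) (rule integrable_norm)
    show "AE t in lborel. integrable lborel (\<lambda>u. case_prod g (t, u))"
      using p r by (auto simp: g_def intro!: integrable_mult_right laplace_integrable)
  qed
  have "(\<integral>u. (\<integral>t. g t u \<partial>lborel) \<partial>lborel) = (\<integral>t. (\<integral>u. g t u \<partial>lborel) \<partial>lborel)"
    by (rule lborel_pair.Fubini_integral[OF int])
  also have "(\<lambda>u. \<integral>t. g t u \<partial>lborel) = (\<lambda>u. 2 * pi * Gamma s * (\<phi> u * exp (- p * of_real u)))"
  proof
    fix u
    show "(\<integral>t. g t u \<partial>lborel) = 2 * pi * Gamma s * (\<phi> u * exp (- p * of_real u))"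
    proof (cases "u > 0")
      case True
      then have "(\<integral>t. g t u \<partial>lborel) = (\<integral>t. (B t * of_real u powr (v t - 1)) * exp (- p * of_real u) \<partial>lborel)"
        by (simp add: g_def laplace_integrand_def mult.assoc)
      also have "\<dots> = (\<integral>t. (B t * of_real u powr (v t - 1)) \<partial>lborel) * exp (- p * of_real u)" by simp
      finally show ?thesis unfolding \<phi>_eq[OF True, symmetric] by (simp add: mult.assoc)
    qed (simp add: g_def laplace_integrand_def \<phi>_def)
  qed
  also have "(\<lambda>t. \<integral>u. g t u \<partial>lborel) = (\<lambda>t. B t * (Gamma (v t) * p powr (- v t)))"
    using p r by (auto simp: g_def laplace_integral fun_eq_iff)
  finally show ?thesis by simp
qed

text \<open>On the imaginary axis the power \<open>p powr (- v)\<close> can grow like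
  \<open>exp (pi / 2 * |Im v|)\<close>, the very rate at which \<open>Gamma v\<close> decays. What
  remains is a loss of \<open>\<eta> * |Im v|\<close>. As \<open>Im v = - Im s - K t\<close>, the
  choice \<open>\<eta> = 1 / K\<close> turns it into a constant plus \<open>|t|\<close>, which
  \<open>B\<close> absorbs.\<close>

lemma Gamma_v_bound:
  obtains C where "C \<ge> 0" "\<And>t. norm (Gamma (v t)) * exp (pi / 2 * \<bar>Im (v t)\<bar>) \<le> C * exp \<bar>t\<bar>"
proof -
  define \<eta> where "\<eta> = 1 / real K"
  have \<eta>: "\<eta> > 0" "\<eta> * K = 1" using K by (auto simp: \<eta>_def)
  obtain C where C: "C > 0" "\<And>z. \<bar>Re z\<bar> \<le> 1 \<Longrightarrow> \<bar>Im z\<bar> \<ge> 1 \<Longrightarrow> norm (Gamma z) \<le> C * exp (- (pi / 2 - \<eta>) * \<bar>Im z\<bar>)"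
    using Gamma_cmod_exp_bound[of 1 \<eta>] \<eta> by auto
  define D where "D = max (C * exp (\<eta> * \<bar>Im s\<bar>)) (Gamma r * exp (pi / 2))"
  show ?thesis
  proof (rule that[of D])
    show "D \<ge> 0" using C by (simp add: D_def le_max_iff_disj)
    fix t
    show "norm (Gamma (v t)) * exp (pi / 2 * \<bar>Im (v t)\<bar>) \<le> D * exp \<bar>t\<bar>"
    proof (cases "\<bar>Im (v t)\<bar> \<ge> 1")
      case True
      have "norm (Gamma (v t)) * exp (pi / 2 * \<bar>Im (v t)\<bar>) \<le> (C * exp (- (pi / 2 - \<eta>) * \<bar>Im (v t)\<bar>)) * exp (pi / 2 * \<bar>Im (v t)\<bar>)"
        using C(2)[OF _ True] r by (intro mult_right_mono) (auto simp del: v_simps(2))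
      also have "\<dots> = C * exp (\<eta> * \<bar>Im (v t)\<bar>)"
      proof -
        have "- (a - \<eta>) * x + a * x = \<eta> * x" for a x :: real by (simp add: left_diff_distrib)
        then show ?thesis by (simp only: mult.assoc[of C] exp_add[symmetric])
      qed
      also have "\<dots> \<le> C * exp (\<eta> * \<bar>Im s\<bar> + \<bar>t\<bar>)"
      proof (intro mult_left_mono)
        have "\<bar>Im (v t)\<bar> \<le> \<bar>Im s\<bar> + \<bar>real K * t\<bar>" unfolding v_simps by linarith
        then have "\<bar>Im (v t)\<bar> \<le> \<bar>Im s\<bar> + K * \<bar>t\<bar>" by (simp only: abs_mult abs_of_nat)
        then have "\<eta> * \<bar>Im (v t)\<bar> \<le> \<eta> * (\<bar>Im s\<bar> + K * \<bar>t\<bar>)" using \<eta> by (intro mult_left_mono) auto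
        also have "\<dots> = \<eta> * \<bar>Im s\<bar> + (\<eta> * K) * \<bar>t\<bar>" by (simp add: algebra_simps)
        finally show "exp (\<eta> * \<bar>Im (v t)\<bar>) \<le> exp (\<eta> * \<bar>Im s\<bar> + \<bar>t\<bar>)" using \<eta> by simp
      qed (use C in auto)
      also have "\<dots> = C * exp (\<eta> * \<bar>Im s\<bar>) * exp \<bar>t\<bar>" by (simp add: exp_add)
      also have "\<dots> \<le> D * exp \<bar>t\<bar>" by (intro mult_right_mono) (auto simp: D_def)
      finally show ?thesis .
    next
      case False
      have "Gamma (v t) = integral\<^sup>L lborel (laplace_integrand (v t) 1)" using r by (subst laplace_integral) auto
      also have "norm \<dots> \<le> (\<integral>u. norm (laplace_integrand (v t) 1 u) \<partial>lborel)" by (rule integral_norm_bound)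
      also have "\<dots> = Gamma r" using r by (subst laplace_integral_norm) auto
      finally have 1: "norm (Gamma (v t)) \<le> Gamma r" .
      have "norm (Gamma (v t)) * exp (pi / 2 * \<bar>Im (v t)\<bar>) \<le> Gamma r * exp (pi / 2 * 1)"
        using False 1 r by (intro mult_mono) auto
      also have "\<dots> \<le> D * 1" by (simp add: D_def)
      also have "\<dots> \<le> D * exp \<bar>t\<bar>" using \<open>D \<ge> 0\<close> by (intro mult_left_mono) auto
      finally show ?thesis .
    qed
  qed
qed

text \<open>In the closed right half-plane the argument of \<open>p\<close> is at most
  \<open>pi / 2\<close> in modulus. The bound depends on \<open>Im p\<close> alone, so it stays
  valid while \<open>p\<close> approaches the imaginary axis.\<close>

lemma norm_powr_v_le:
  assumes "Re p \<ge> 0" "Im p = y" "y \<noteq> 0"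
  shows "norm (p powr (- v t)) \<le> \<bar>y\<bar> powr (- r) * exp (pi / 2 * \<bar>Im (v t)\<bar>)"
proof -
  have p0: "p \<noteq> 0" using assms by auto
  have arg: "\<bar>Im (Ln p)\<bar> \<le> pi / 2" using assms p0 Re_Ln_pos_le by blast
  have "norm (p powr (- v t)) = exp (Re (- v t * Ln p))" using p0 by (simp add: powr_def)
  also have "Re (- v t * Ln p) = - r * ln (norm p) + Im (v t) * Im (Ln p)" using p0 by simp
  also have "exp \<dots> = norm p powr (- r) * exp (Im (v t) * Im (Ln p))"
    unfolding exp_add using p0 by (simp add: powr_def)
  also have "\<dots> \<le> \<bar>y\<bar> powr (- r) * exp (pi / 2 * \<bar>Im (v t)\<bar>)"
  proof (intro mult_mono)
    show "norm p powr (- r) \<le> \<bar>y\<bar> powr (- r)"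
      using assms r abs_Im_le_cmod[of p] by (intro powr_mono2') auto
    have "Im (v t) * Im (Ln p) \<le> \<bar>Im (v t)\<bar> * \<bar>Im (Ln p)\<bar>" by (simp only: abs_mult[symmetric] abs_ge_self)
    also have "\<dots> \<le> \<bar>Im (v t)\<bar> * (pi / 2)" using arg by (intro mult_left_mono) auto
    finally show "exp (Im (v t) * Im (Ln p)) \<le> exp (pi / 2 * \<bar>Im (v t)\<bar>)" by (simp add: mult.commute)
  qed auto
  finally show ?thesis .
qed

lemma Gamma_v_measurable [measurable]: "(\<lambda>t. Gamma (v t)) \<in> borel_measurable borel"
proof (rule borel_measurable_continuous_onI)
  have "v t \<notin> \<int>\<^sub>\<le>\<^sub>0" for t
  proof
    assume "v t \<in> \<int>\<^sub>\<le>\<^sub>0"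
    then obtain n where n: "n \<le> 0" "v t = of_int n" by (elim nonpos_Ints_cases)
    have "r = Re (v t)" by simp
    also have "\<dots> = of_int n" unfolding n(2) by simp
    finally have "r = of_int n" .
    then show False using r n(1) by simp
  qed
  then have 1: "range v \<subseteq> - \<int>\<^sub>\<le>\<^sub>0" by blast
  have 2: "continuous_on (- \<int>\<^sub>\<le>\<^sub>0) (Gamma :: complex \<Rightarrow> complex)" by (rule continuous_on_Gamma) blast
  have 3: "continuous_on UNIV v" unfolding v_def[abs_def] by (intro continuous_intros)
  show "continuous_on UNIV (\<lambda>t. Gamma (v t))" by (rule continuous_on_compose2[OF 2 3 1])
qed

lemma powr_v_measurable [measurable]: "(\<lambda>t. p powr (- v t)) \<in> borel_measurable borel"
  by (cases "p = 0") (simp_all add: powr_def)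

lemma boundary_integrable:
  assumes "Re p \<ge> 0" "Im p \<noteq> 0"
  shows "integrable lborel (\<lambda>t. B t * (Gamma (v t) * p powr (- v t)))"
proof -
  obtain C where C: "C \<ge> 0" "\<And>t. norm (Gamma (v t)) * exp (pi / 2 * \<bar>Im (v t)\<bar>) \<le> C * exp \<bar>t\<bar>" using Gamma_v_bound by blast
  show ?thesis
  proof (rule line_integrable)
    fix t
    have "norm (Gamma (v t) * p powr (- v t)) \<le> norm (Gamma (v t)) * (\<bar>Im p\<bar> powr (- r) * exp (pi / 2 * \<bar>Im (v t)\<bar>))"
      unfolding norm_mult using assms by (intro mult_left_mono norm_powr_v_le) auto
    also have "\<dots> = \<bar>Im p\<bar> powr (- r) * (norm (Gamma (v t)) * exp (pi / 2 * \<bar>Im (v t)\<bar>))" by simp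
    also have "\<dots> \<le> \<bar>Im p\<bar> powr (- r) * (C * exp \<bar>t\<bar>)" by (intro mult_left_mono C) auto
    finally show "norm (Gamma (v t) * p powr (- v t)) \<le> (\<bar>Im p\<bar> powr (- r) * C) * exp \<bar>t\<bar>" by (simp add: mult.assoc)
  qed measurable
qed

text \<open>Boundary values of \<open>laplace_\<phi>\<close> along points with fixed imaginary part
  \<open>y\<close>. The left side is dominated by \<open>norm (\<phi> u)\<close>, the right side
  through \<open>norm_powr_v_le\<close> and \<open>Gamma_v_bound\<close>.\<close>

lemma fourier_\<phi>:
  assumes y: "y \<noteq> 0"
  shows "2 * pi * Gamma s * (\<integral>u. \<phi> u * exp (- (\<i> * of_real y) * of_real u) \<partial>lborel) = (\<integral>t. B t * (Gamma (v t) * (\<i> * of_real y) powr (- v t)) \<partial>lborel)"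
proof -
  define p where "p = (\<lambda>n. Complex (inverse (real (Suc n))) y)"
  define q where "q = \<i> * of_real y"
  have p: "Re (p n) > 0" "Im (p n) = y" for n by (auto simp: p_def)
  have plim: "p \<longlonglongrightarrow> q"
  proof -
    have "p \<longlonglongrightarrow> Complex 0 y" unfolding p_def by (intro tendsto_Complex LIMSEQ_inverse_real_of_nat tendsto_const)
    then show ?thesis by (simp add: q_def Complex_eq)
  qed
  have qn: "q \<notin> \<real>\<^sub>\<le>\<^sub>0" using y by (auto simp: q_def complex_nonpos_Reals_iff)
  obtain C where C: "C \<ge> 0" "\<And>t. norm (Gamma (v t)) * exp (pi / 2 * \<bar>Im (v t)\<bar>) \<le> C * exp \<bar>t\<bar>" using Gamma_v_bound by blast
  have L: "(\<lambda>n. \<integral>u. \<phi> u * exp (- p n * of_real u) \<partial>lborel) \<longlonglongrightarrow> (\<integral>u. \<phi> u * exp (- q * of_real u) \<partial>lborel)"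
  proof (rule integral_dominated_convergence)
    show "integrable lborel (\<lambda>u. norm (\<phi> u))" using \<phi>_integrable by (rule integrable_norm)
    show "AE u in lborel. (\<lambda>n. \<phi> u * exp (- p n * of_real u)) \<longlonglongrightarrow> \<phi> u * exp (- q * of_real u)"
      by (intro AE_I2 tendsto_intros plim)
    show "AE u in lborel. norm (\<phi> u * exp (- p n * of_real u)) \<le> norm (\<phi> u)" for n
    proof (rule AE_I2)
      fix u
      show "norm (\<phi> u * exp (- p n * of_real u)) \<le> norm (\<phi> u)"
      proof (cases "u > 0")
        case True
        then have "norm (exp (- p n * of_real u)) \<le> 1" using p(1)[of n] by (simp add: norm_exp_eq_Re)
        then show ?thesis unfolding norm_mult by (intro mult_left_le) auto
      qed (simp add: \<phi>_def)
    qed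
  qed measurable
  have R: "(\<lambda>n. \<integral>t. B t * (Gamma (v t) * p n powr (- v t)) \<partial>lborel) \<longlonglongrightarrow> (\<integral>t. B t * (Gamma (v t) * q powr (- v t)) \<partial>lborel)"
  proof (rule integral_dominated_convergence)
    show "integrable lborel (\<lambda>t. norm (B t * of_real (\<bar>y\<bar> powr (- r) * (C * exp \<bar>t\<bar>))))"
      by (rule integrable_norm, rule line_integrable[where c = "\<bar>y\<bar> powr (- r) * C"]) (use C(1) in \<open>simp_all only: norm_of_real, simp_all add: abs_mult\<close>)
    show "AE t in lborel. (\<lambda>n. B t * (Gamma (v t) * p n powr (- v t))) \<longlonglongrightarrow> B t * (Gamma (v t) * q powr (- v t))"
      by (intro AE_I2 tendsto_intros plim) (use qn in auto)
    show "AE t in lborel. norm (B t * (Gamma (v t) * p n powr (- v t))) \<le> norm (B t * of_real (\<bar>y\<bar> powr (- r) * (C * exp \<bar>t\<bar>)))" for n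
    proof (rule AE_I2)
      fix t
      have "norm (Gamma (v t) * p n powr (- v t)) \<le> norm (Gamma (v t)) * (\<bar>y\<bar> powr (- r) * exp (pi / 2 * \<bar>Im (v t)\<bar>))"
        unfolding norm_mult using p[of n] y by (intro mult_left_mono norm_powr_v_le) auto
      also have "\<dots> = \<bar>y\<bar> powr (- r) * (norm (Gamma (v t)) * exp (pi / 2 * \<bar>Im (v t)\<bar>))" by simp
      also have "\<dots> \<le> \<bar>y\<bar> powr (- r) * (C * exp \<bar>t\<bar>)" by (intro mult_left_mono C) auto
      also have "\<dots> = norm (complex_of_real (\<bar>y\<bar> powr (- r) * (C * exp \<bar>t\<bar>)))" using C(1) by (simp only: norm_of_real) simp
      finally show "norm (B t * (Gamma (v t) * p n powr (- v t))) \<le> norm (B t * of_real (\<bar>y\<bar> powr (- r) * (C * exp \<bar>t\<bar>)))"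
        unfolding norm_mult[of "B t"] by (intro mult_left_mono) auto
    qed
  qed measurable
  have "(\<lambda>n. 2 * pi * Gamma s * (\<integral>u. \<phi> u * exp (- p n * of_real u) \<partial>lborel)) \<longlonglongrightarrow> 2 * pi * Gamma s * (\<integral>u. \<phi> u * exp (- q * of_real u) \<partial>lborel)"
    by (intro tendsto_intros L)
  then have "(\<lambda>n. \<integral>t. B t * (Gamma (v t) * p n powr (- v t)) \<partial>lborel) \<longlonglongrightarrow> 2 * pi * Gamma s * (\<integral>u. \<phi> u * exp (- q * of_real u) \<partial>lborel)"
    by (simp only: laplace_\<phi>[OF p(1)])
  with R show ?thesis unfolding q_def by (rule LIMSEQ_unique[rotated])
qed

text \<open>
  The cosine integral of \<open>u powr (v - 1)\<close> converges only conditionally, which rules out a direct use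
  of Fubini's theorem: hence the detour through \<open>Re p > 0\<close> and the limit \<open>p \<rightarrow> \<plusminus> i y\<close>.
\<close>

theorem cosine_transform:
  assumes y: "y > 0"
  shows "integrable lborel (\<lambda>t. B t * (Gamma (v t) * cos (of_real pi * v t / 2) * of_real y powr (- v t)))" (is ?A)
    and "2 * pi * Gamma s * (\<integral>u. \<phi> u * of_real (cos (y * u)) \<partial>lborel) =
      (\<integral>t. B t * (Gamma (v t) * cos (of_real pi * v t / 2) * of_real y powr (- v t)) \<partial>lborel)" (is ?B)
proof -
  let ?f = "\<lambda>z t. B t * (Gamma (v t) * z powr (- v t))"
  \<comment> \<open>The points \<open>\<i> y\<close> and \<open>- \<i> y\<close> have arguments
    \<open>pi / 2\<close> and \<open>- pi / 2\<close>; their powers are \<open>y powr (- v)\<close>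
    times two conjugate-looking exponentials that add up to twice the cosine.\<close>
  have pw: "(\<i> * of_real y) powr (- v t) + (\<i> * of_real (- y)) powr (- v t) = 2 * cos (of_real pi * v t / 2) * of_real y powr (- v t)" for t
  proof -
    have "(\<i> * of_real y) powr (- v t) = exp (- \<i> * (of_real pi * v t / 2)) * of_real y powr (- v t)"
      using y by (simp add: mult.commute[of \<i>] powr_times_real_left) (simp add: powr_def algebra_simps)
    moreover have "(\<i> * of_real (- y)) powr (- v t) = exp (\<i> * (of_real pi * v t / 2)) * of_real y powr (- v t)"
    proof -
      have "\<i> * complex_of_real (- y) = of_real y * (- \<i>)" by simp
      then show ?thesis
        using y by (simp only: powr_times_real_left[of "of_real y" "-\<i>"] Reals_of_real Re_complex_of_real less_imp_le) (simp add: powr_def algebra_simps)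
    qed
    ultimately show ?thesis by (simp add: cos_exp_eq algebra_simps)
  qed
  have i: "integrable lborel (?f (\<i> * of_real y))" "integrable lborel (?f (\<i> * of_real (- y)))"
    using y by (auto intro!: boundary_integrable)
  have eq: "(\<lambda>t. B t * (Gamma (v t) * cos (of_real pi * v t / 2) * of_real y powr (- v t))) = (\<lambda>t. (?f (\<i> * of_real y) t + ?f (\<i> * of_real (- y)) t) / 2)"
  proof
    fix t
    have "?f (\<i> * of_real y) t + ?f (\<i> * of_real (- y)) t = B t * Gamma (v t) * ((\<i> * of_real y) powr (- v t) + (\<i> * of_real (- y)) powr (- v t))"
      by (simp add: algebra_simps)
    then show "B t * (Gamma (v t) * cos (of_real pi * v t / 2) * of_real y powr (- v t)) = (?f (\<i> * of_real y) t + ?f (\<i> * of_real (- y)) t) / 2"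
      unfolding pw by simp
  qed
  show ?A unfolding eq using i by (intro integrable_divide Bochner_Integration.integrable_add)
  have e: "integrable lborel (\<lambda>u. \<phi> u * exp (- (\<i> * of_real x) * of_real u))" for x
  proof (rule Bochner_Integration.integrable_bound[OF \<phi>_integrable])
    show "AE u in lborel. norm (\<phi> u * exp (- (\<i> * of_real x) * of_real u)) \<le> norm (\<phi> u)"
      by (intro AE_I2) (simp add: norm_mult norm_exp_eq_Re)
  qed measurable
  have "(\<lambda>u. \<phi> u * of_real (cos (y * u))) = (\<lambda>u. (\<phi> u * exp (- (\<i> * of_real y) * of_real u) + \<phi> u * exp (- (\<i> * of_real (- y)) * of_real u)) / 2)"
    by (auto simp: fun_eq_iff cos_exp_eq algebra_simps simp flip: cos_of_real)
  then have "2 * pi * Gamma s * (\<integral>u. \<phi> u * of_real (cos (y * u)) \<partial>lborel) =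
    (2 * pi * Gamma s * (\<integral>u. \<phi> u * exp (- (\<i> * of_real y) * of_real u) \<partial>lborel) + 2 * pi * Gamma s * (\<integral>u. \<phi> u * exp (- (\<i> * of_real (- y)) * of_real u) \<partial>lborel)) / 2"
    using e[of y] e[of "- y"] by (simp add: algebra_simps)
  also have "\<dots> = ((\<integral>t. ?f (\<i> * of_real y) t \<partial>lborel) + (\<integral>t. ?f (\<i> * of_real (- y)) t \<partial>lborel)) / 2"
    using y fourier_\<phi>[of y] fourier_\<phi>[of "- y"] by (simp only:)
  also have "\<dots> = (\<integral>t. (?f (\<i> * of_real y) t + ?f (\<i> * of_real (- y)) t) / 2 \<partial>lborel)"
    using i by simp
  finally show ?B unfolding eq .
qed

end

section \<open>A separating contour\<close>

lemma connected_component_convex_chain: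
  fixes U V S :: "complex set"
  assumes "convex U" "convex V" "U \<subseteq> S" "V \<subseteq> S" "x \<in> U" "z \<in> U" "z \<in> V" "y \<in> V"
  shows "connected_component S x y"
proof -
  have "connected_component S x z"
    unfolding connected_component_def by (rule exI[of _ U]) (use assms convex_connected in auto)
  moreover have "connected_component S z y"
    unfolding connected_component_def by (rule exI[of _ V]) (use assms convex_connected in auto)
  ultimately show ?thesis by (rule connected_component_trans)
qed

lemma C1_Complex_affine: "(\<lambda>t. Complex (a * t + b) (a' * t + b')) C1_differentiable_on S"
proof -
  have "((\<lambda>t. of_real a * of_real t + of_real b + \<i> * (of_real a' * of_real t + of_real b')) has_vector_derivative (of_real a + \<i> * of_real a')) (at t)" for t
    by (auto intro!: derivative_eq_intros)
  moreover have "(\<lambda>t. Complex (a * t + b) (a' * t + b')) = (\<lambda>t. of_real a * of_real t + of_real b + \<i> * (of_real a' * of_real t + of_real b'))"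
    by (auto simp: fun_eq_iff complex_eq_iff)
  ultimately have "((\<lambda>t. Complex (a * t + b) (a' * t + b')) has_vector_derivative (of_real a + \<i> * of_real a')) (at t)" for t
    by (simp only:)
  then show ?thesis unfolding C1_differentiable_on_def by (intro exI[of _ "\<lambda>_. of_real a + \<i> * of_real a'"]) auto
qed

text \<open>
  The contour follows \<open>Re w = c\<close> up to the line \<open>Im w = h (Re w)\<close>, runs along that line, which passes
  above \<open>0\<close> and below \<open>p + i q\<close>, to the abscissa \<open>d\<close>, and returns along the line \<open>Im w = u (Re w)\<close>
  above \<open>p + i q\<close>.
\<close>

lemma separating_contour:
  fixes c p q d :: real
  assumes c: "c < 0" and p: "0 < p" "p < d"
  obtains \<gamma> R where "\<And>T. \<gamma> piecewise_C1_differentiable_on {-T..T}" "\<forall>t. \<bar>t\<bar> \<ge> R \<longrightarrow> \<gamma> t = Complex c t"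
    "{w. Re w < c} \<subseteq> left_side \<gamma>" "Complex p q \<in> left_side \<gamma>" "0 \<in> right_side \<gamma>" "{w. Re w > d} \<subseteq> right_side \<gamma>"
proof -
  \<comment> \<open>The slopes are chosen so that \<open>h 0 = 1\<close>,
    \<open>h p = q - 1\<close>, \<open>u p = q + 1\<close> and the two lines meet at
    \<open>d\<close>.\<close>
  define k where "k = (q - 2) / p"
  define m where "m = 2 / (d - p)"
  have m: "m > 0" using p by (simp add: m_def)
  define h where "h = (\<lambda>x. 1 + k * x)"
  define u where "u = (\<lambda>x. h x + m * (d - x))"
  have "m * (d - p) = 2" using nonzero_eq_divide_eq[of "d - p" m 2] m_def p by simp
  moreover have "k * p = q - 2" using p by (simp add: k_def)
  ultimately have hp: "h p = q - 1" "u p = q + 1" by (simp_all add: h_def u_def)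
  \<comment> \<open>The heights at which the two lines meet \<open>Re w = c\<close>; there the
    vertical ends are attached.\<close>
  define t1 t2 where "t1 = h c" and "t2 = u c"
  have t12: "t1 < t2" using m c p by (simp add: t1_def t2_def u_def)
  define w where "w = (t2 - t1) / 2"
  have w: "w > 0" "t1 + w = t2 - w" using t12 by (simp_all add: w_def field_simps)
  define x1 x2 where "x1 = (\<lambda>t. c + (d - c) * (t - t1) / w)" and "x2 = (\<lambda>t. c + (d - c) * (t2 - t) / w)"
  define \<gamma> where "\<gamma> = (\<lambda>t. if t \<le> t1 then Complex c t else if t \<le> t1 + w then Complex (x1 t) (h (x1 t))
      else if t \<le> t2 then Complex (x2 t) (u (x2 t)) else Complex c t)"
  define R where "R = \<bar>t1\<bar> + \<bar>t2\<bar> + 1"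
  show ?thesis
  proof (rule that[of \<gamma> R])
    show "\<gamma> piecewise_C1_differentiable_on {-T..T}" for T
    proof -
      define L where "L = max T R"
      have L: "-L \<le> t1" "t1 \<le> t1 + w" "t1 + w \<le> t2" "t2 \<le> L" using w by (auto simp: L_def R_def)
      have g1: "(\<lambda>t. Complex c t) piecewise_C1_differentiable_on S" for S
        using C1_Complex_affine[of 0 c 1 0 S] by (simp add: C1_differentiable_imp_piecewise)
      have g2: "(\<lambda>t. Complex (x1 t) (h (x1 t))) piecewise_C1_differentiable_on S" for S
      proof -
        have e: "(\<lambda>t. Complex (x1 t) (h (x1 t))) = (\<lambda>t. Complex ((d - c) / w * t + (c - (d - c) / w * t1)) (k * (d - c) / w * t + (1 + k * (c - (d - c) / w * t1))))"
          by (auto simp: fun_eq_iff x1_def h_def algebra_simps diff_divide_distrib add_divide_distrib)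
        show ?thesis unfolding e by (rule C1_differentiable_imp_piecewise[OF C1_Complex_affine])
      qed
      have g3: "(\<lambda>t. Complex (x2 t) (u (x2 t))) piecewise_C1_differentiable_on S" for S
      proof -
        have e: "(\<lambda>t. Complex (x2 t) (u (x2 t))) = (\<lambda>t. Complex (- (d - c) / w * t + (c + (d - c) / w * t2)) (- (k - m) * (d - c) / w * t + (1 + m * d + (k - m) * (c + (d - c) / w * t2))))"
          by (auto simp: fun_eq_iff x2_def u_def h_def algebra_simps diff_divide_distrib add_divide_distrib)
        show ?thesis unfolding e by (rule C1_differentiable_imp_piecewise[OF C1_Complex_affine])
      qed
      have tw: "t2 - (t1 + w) = w" using w by linarith
      have x: "x1 t1 = c" "x1 (t1 + w) = d" "x2 (t1 + w) = d" "x2 t2 = c" unfolding x1_def x2_def tw using w(1) by simp_all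
      have "\<gamma> piecewise_C1_differentiable_on {-L..L}"
        unfolding \<gamma>_def using L x
        by (intro piecewise_C1_differentiable_cases g1 g2 g3) (auto simp: t1_def t2_def u_def)
      then show ?thesis by (rule piecewise_C1_differentiable_on_subset) (auto simp: L_def)
    qed
    show "\<forall>t. \<bar>t\<bar> \<ge> R \<longrightarrow> \<gamma> t = Complex c t" using w by (auto simp: \<gamma>_def R_def)
    have rng: "Re z = c \<and> (Im z \<le> t1 \<or> t2 \<le> Im z) \<or> c \<le> Re z \<and> Re z \<le> d \<and> (Im z = h (Re z) \<or> Im z = u (Re z))" if "z \<in> range \<gamma>" for z
    proof -
      from that obtain t where t: "z = \<gamma> t" by auto
      consider "t \<le> t1" | "t1 < t" "t \<le> t1 + w" | "t1 + w < t" "t \<le> t2" | "t2 < t" by linarith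
      then show ?thesis
      proof cases
        case 2
        have "0 \<le> (t - t1) / w" "(t - t1) / w \<le> 1" using 2 w by (simp_all add: field_simps)
        then have "0 \<le> (d - c) * ((t - t1) / w)" "(d - c) * ((t - t1) / w) \<le> (d - c) * 1"
          using c p by (intro mult_nonneg_nonneg mult_left_mono; linarith)+
        then show ?thesis using 2 t by (auto simp: \<gamma>_def x1_def)
      next
        case 3
        have "0 \<le> (t2 - t) / w" "(t2 - t) / w \<le> 1" using 3 w by (simp_all add: field_simps)
        then have "0 \<le> (d - c) * ((t2 - t) / w)" "(d - c) * ((t2 - t) / w) \<le> (d - c) * 1"
          using c p by (intro mult_nonneg_nonneg mult_left_mono; linarith)+
        then show ?thesis using 3 t w by (auto simp: \<gamma>_def x2_def)
      qed (use t w in \<open>auto simp: \<gamma>_def\<close>)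
    qed
    \<comment> \<open>Four convex sets that miss the contour: two half-planes, the wedge
      \<open>W\<close> between the lines, which holds \<open>Complex p q\<close> and reaches into
      \<open>L\<close>, and the region \<open>V\<close> below the first line, which holds 0 and
      reaches into \<open>Rt\<close>.\<close>
    define L where "L = {z. Re z < c}"
    define Rt where "Rt = {z. Re z > d}"
    define W where "W = {z. inner (Complex (- k) 1) z > 1} \<inter> {z. inner (Complex (m - k) 1) z < 1 + m * d}"
    define V where "V = {z. inner (Complex (- k) 1) z < 1} \<inter> {z. Re z > c}"
    have W_iff: "z \<in> W \<longleftrightarrow> Im z > h (Re z) \<and> Im z < u (Re z)" for z
      by (auto simp: W_def inner_complex_def h_def u_def algebra_simps)
    have V_iff: "z \<in> V \<longleftrightarrow> Im z < h (Re z) \<and> Re z > c" for z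
      by (auto simp: V_def inner_complex_def h_def algebra_simps)
    have cv: "convex L" "convex Rt" "convex W" "convex V"
      unfolding L_def Rt_def W_def V_def
      by (intro convex_Int convex_halfspace_gt convex_halfspace_lt convex_halfspace_Re_lt convex_halfspace_Re_gt)+
    have uh: "u x \<ge> h x" if "x \<le> d" for x using that m by (simp add: u_def)
    have sub: "L \<subseteq> - range \<gamma>" "Rt \<subseteq> - range \<gamma>" "W \<subseteq> - range \<gamma>" "V \<subseteq> - range \<gamma>"
    proof -
      show "L \<subseteq> - range \<gamma>" using rng by (force simp: L_def)
      show "Rt \<subseteq> - range \<gamma>"
      proof (intro subsetI ComplI)
        fix z assume "z \<in> Rt" "z \<in> range \<gamma>"
        then show False using rng[of z] c p by (auto simp: Rt_def)
      qed
      show "W \<subseteq> - range \<gamma>"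
      proof (intro subsetI ComplI)
        fix z assume "z \<in> W" "z \<in> range \<gamma>"
        then show False using rng[of z] unfolding W_iff by (auto simp: t1_def t2_def)
      qed
      show "V \<subseteq> - range \<gamma>"
      proof (intro subsetI ComplI)
        fix z assume "z \<in> V" "z \<in> range \<gamma>"
        then show False using rng[of z] uh[of "Re z"] unfolding V_iff by auto
      qed
    qed
    have left: "z \<in> left_side \<gamma>" if "convex U" "U \<subseteq> - range \<gamma>" "z \<in> U" "y \<in> U" "y \<in> L" for z y U
      unfolding left_side_def mem_Collect_eq
    proof (rule eventually_mono[OF eventually_gt_at_bot[of c]])
      fix r assume "r < c"
      then show "connected_component (- range \<gamma>) z (of_real r)"
        using that by (intro connected_component_convex_chain[OF that(1) cv(1) that(2) sub(1) that(3,4,5)]) (simp add: L_def)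
    qed
    have right: "z \<in> right_side \<gamma>" if "convex U" "U \<subseteq> - range \<gamma>" "z \<in> U" "y \<in> U" "y \<in> Rt" for z y U
      unfolding right_side_def mem_Collect_eq
    proof (rule eventually_mono[OF eventually_gt_at_top[of d]])
      fix r assume "d < r"
      then show "connected_component (- range \<gamma>) z (of_real r)"
        using that by (intro connected_component_convex_chain[OF that(1) cv(2) that(2) sub(2) that(3,4,5)]) (simp add: Rt_def)
    qed
    show "{w. Re w < c} \<subseteq> left_side \<gamma>" using left[OF cv(1) sub(1)] by (auto simp: L_def)
    show "{w. Re w > d} \<subseteq> right_side \<gamma>" using right[OF cv(2) sub(2)] by (auto simp: Rt_def)
    show "Complex p q \<in> left_side \<gamma>"
    proof (rule left[OF cv(3) sub(3), where y = "Complex (c - 1) (h (c - 1) + m)"])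
      show "Complex p q \<in> W" unfolding W_iff by (simp add: hp)
      have "m * (d - c) > 0" using m c p by simp
      then show "Complex (c - 1) (h (c - 1) + m) \<in> W" unfolding W_iff using m
        by (simp add: u_def algebra_simps)
    qed (simp add: L_def)
    show "0 \<in> right_side \<gamma>"
    proof (rule right[OF cv(4) sub(4), where y = "Complex (d + 1) (h (d + 1) - 1)"])
      show "0 \<in> V" unfolding V_iff using c by (simp add: h_def)
      show "Complex (d + 1) (h (d + 1) - 1) \<in> V" unfolding V_iff using c p by simp
    qed (simp add: Rt_def)
  qed
qed

section \<open>The G-function\<close>

lemma is_pole_Gamma_iff:
  assumes "c \<noteq> 0"
  shows "is_pole (\<lambda>u. Gamma (c * u + d)) w \<longleftrightarrow> c * w + d \<in> (\<int>\<^sub>\<le>\<^sub>0 :: complex set)"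
proof
  assume pole: "is_pole (\<lambda>u. Gamma (c * u + d)) w"
  show "c * w + d \<in> \<int>\<^sub>\<le>\<^sub>0"
  proof (rule ccontr)
    assume "c * w + d \<notin> \<int>\<^sub>\<le>\<^sub>0"
    moreover have "open (- ((\<lambda>u. c * u + d) -` \<int>\<^sub>\<le>\<^sub>0))"
      by (intro open_Compl closed_vimage continuous_intros) auto
    moreover have "(\<lambda>u. Gamma (c * u + d)) holomorphic_on - ((\<lambda>u. c * u + d) -` \<int>\<^sub>\<le>\<^sub>0)"
      by (auto intro!: holomorphic_intros)
    ultimately show False using pole not_is_pole_holomorphic by blast
  qed
next
  assume "c * w + d \<in> \<int>\<^sub>\<le>\<^sub>0"
  then obtain n where n: "c * w + d = - of_nat n" by (elim nonpos_Ints_cases')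
  show "is_pole (\<lambda>u. Gamma (c * u + d)) w"
  proof (rule is_pole_compose[where f = Gamma and g = "\<lambda>u. c * u + d" and w = "- of_nat n"])
    show "(\<lambda>u. c * u + d) \<midarrow>w\<rightarrow> - of_nat n" unfolding n[symmetric] by (intro tendsto_intros)
    show "\<forall>\<^sub>F u in at w. c * u + d \<noteq> - of_nat n"
      unfolding n[symmetric] using assms eventually_neq_at_within[of w w UNIV] by (auto elim: eventually_mono)
  qed (rule is_pole_Gamma)
qed

text \<open>The duplication formula at the level of poles: even and odd \<open>n\<close> in
  \<open>2 * z = - n\<close> come from the first and the second factor.
  \<open>multiple_nonpos_Ints\<close> does the same for the multiplication formula, by residues
  modulo \<open>K\<close>.\<close>

lemma half_nonpos_Ints:
  fixes z :: complex
  shows "z \<in> \<int>\<^sub>\<le>\<^sub>0 \<or> z + 1 / 2 \<in> \<int>\<^sub>\<le>\<^sub>0 \<longleftrightarrow> 2 * z \<in> \<int>\<^sub>\<le>\<^sub>0"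
proof
  assume "z \<in> \<int>\<^sub>\<le>\<^sub>0 \<or> z + 1 / 2 \<in> \<int>\<^sub>\<le>\<^sub>0"
  then consider n where "z = - of_nat n" | n where "z + 1/2 = - of_nat n" by (auto elim!: nonpos_Ints_cases')
  then show "2 * z \<in> \<int>\<^sub>\<le>\<^sub>0"
  proof cases
    case 1
    then have "2 * z = - of_nat (2 * n)" by simp
    then show ?thesis by (simp only: minus_of_nat_in_nonpos_Ints)
  next
    case 2
    then have "z = - of_nat n - 1 / 2" by (simp add: eq_diff_eq)
    then have "2 * z = - of_nat (2 * n + 1)" by simp
    then show ?thesis by (simp only: minus_of_nat_in_nonpos_Ints)
  qed
next
  assume "2 * z \<in> \<int>\<^sub>\<le>\<^sub>0"
  then obtain n where n: "2 * z = - of_nat n" by (elim nonpos_Ints_cases')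
  show "z \<in> \<int>\<^sub>\<le>\<^sub>0 \<or> z + 1 / 2 \<in> \<int>\<^sub>\<le>\<^sub>0"
  proof (cases "even n")
    case True
    then obtain m where "n = 2 * m" by (elim evenE)
    then have "z = - of_nat m" using n by simp
    then show ?thesis by simp
  next
    case False
    then obtain m where "n = 2 * m + 1" by (elim oddE)
    then have "z = (- (2 * of_nat m + 1)) / 2" using n by (simp add: eq_divide_eq mult.commute)
    then have "z + 1 / 2 = - of_nat m" by (simp add: add_divide_distrib diff_divide_distrib)
    then show ?thesis by simp
  qed
qed

lemma multiple_nonpos_Ints:
  fixes z :: complex
  assumes "K > 0"
  shows "(\<exists>j<K. z + of_nat j / of_nat K \<in> \<int>\<^sub>\<le>\<^sub>0) \<longleftrightarrow> of_nat K * z \<in> \<int>\<^sub>\<le>\<^sub>0"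
proof
  assume "\<exists>j<K. z + of_nat j / of_nat K \<in> \<int>\<^sub>\<le>\<^sub>0"
  then obtain j n where "j < K" and n: "z + of_nat j / of_nat K = - of_nat n" by (auto elim!: nonpos_Ints_cases')
  have "of_nat K * z + of_nat j = of_nat K * (z + of_nat j / of_nat K)" using assms by (simp add: distrib_left)
  also have "\<dots> = - (of_nat K * of_nat n)" unfolding n by simp
  finally have "of_nat K * z = - of_nat (K * n + j)" by (simp add: eq_diff_eq flip: diff_conv_add_uminus)
  then show "of_nat K * z \<in> \<int>\<^sub>\<le>\<^sub>0" by (simp only: minus_of_nat_in_nonpos_Ints)
next
  assume "of_nat K * z \<in> \<int>\<^sub>\<le>\<^sub>0"
  then obtain n where n: "of_nat K * z = - of_nat n" by (elim nonpos_Ints_cases')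
  have "of_nat n = of_nat K * of_nat (n div K) + (of_nat (n mod K) :: complex)"
    by (metis mult_div_mod_eq of_nat_add of_nat_mult)
  moreover have "of_nat K * (z + of_nat (n mod K) / of_nat K) = of_nat K * z + of_nat (n mod K)"
    using assms by (simp add: distrib_left)
  ultimately have "of_nat K * (z + of_nat (n mod K) / of_nat K) = of_nat K * (- of_nat (n div K))"
    unfolding n by simp
  then have "z + of_nat (n mod K) / of_nat K = - of_nat (n div K)"
    using assms by (simp only: mult_left_cancel of_nat_eq_0_iff)
  then have "z + of_nat (n mod K) / of_nat K \<in> \<int>\<^sub>\<le>\<^sub>0" by (simp only: minus_of_nat_in_nonpos_Ints)
  then show "\<exists>j<K. z + of_nat j / of_nat K \<in> \<int>\<^sub>\<le>\<^sub>0" using assms by (intro exI[of _ "n mod K"]) simp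
qed

lemma Gamma_duplication:
  assumes "2 * z \<notin> (\<int>\<^sub>\<le>\<^sub>0 :: complex set)"
  shows "Gamma z * Gamma (z + 1 / 2) = exp ((1 - 2 * z) * of_real (ln 2)) * of_real (sqrt pi) * Gamma (2 * z)"
  using half_nonpos_Ints[of z] assms by (intro Gamma_legendre_duplication) auto

text \<open>Reflection at \<open>v / 2 + 1 / 2\<close> turns the reciprocal Gamma value into a Gamma
  value times the cosine, and duplication then merges the two Gamma values. This is the bridge
  between the cosine transform and the G-function.\<close>

lemma Gamma_half_quotient:
  assumes "v \<notin> (\<int>\<^sub>\<le>\<^sub>0 :: complex set)"
  shows "Gamma (v / 2) * rGamma (1 / 2 - v / 2) =
    exp ((1 - v) * of_real (ln 2)) * Gamma v * cos (of_real pi * v / 2) / of_real (sqrt pi)"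
proof -
  have n: "2 * (v / 2) \<notin> \<int>\<^sub>\<le>\<^sub>0" using assms by simp
  then have n2: "v / 2 + 1 / 2 \<notin> \<int>\<^sub>\<le>\<^sub>0" using half_nonpos_Ints[of "v / 2"] by blast
  have "rGamma (v / 2 + 1 / 2) * rGamma (1 - (v / 2 + 1 / 2)) = sin (of_real pi * (v / 2 + 1 / 2)) / of_real pi"
    by (rule rGamma_reflection_complex)
  also have "1 - (v / 2 + 1 / 2) = 1 / 2 - v / 2" by (simp add: field_simps)
  also have "sin (of_real pi * (v / 2 + 1 / 2)) = cos (of_real pi * v / 2)"
    using sin_add[of "of_real pi * v / 2" "of_real pi / 2"] by (simp add: distrib_left)
  finally have r: "rGamma (v / 2 + 1 / 2) * rGamma (1 / 2 - v / 2) = cos (of_real pi * v / 2) / of_real pi" .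
  have "Gamma (v / 2 + 1 / 2) * rGamma (v / 2 + 1 / 2) = 1"
    using n2 by (simp add: rGamma_inverse_Gamma Gamma_eq_zero_iff)
  then have "rGamma (1 / 2 - v / 2) = Gamma (v / 2 + 1 / 2) * (rGamma (v / 2 + 1 / 2) * rGamma (1 / 2 - v / 2))"
    by (simp flip: mult.assoc)
  then have "rGamma (1 / 2 - v / 2) = Gamma (v / 2 + 1 / 2) * cos (of_real pi * v / 2) / of_real pi"
    unfolding r by simp
  then have "Gamma (v / 2) * rGamma (1 / 2 - v / 2) = (Gamma (v / 2) * Gamma (v / 2 + 1 / 2)) * cos (of_real pi * v / 2) / of_real pi"
    by simp
  also have "Gamma (v / 2) * Gamma (v / 2 + 1 / 2) = exp ((1 - v) * of_real (ln 2)) * of_real (sqrt pi) * Gamma v"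
    using Gamma_duplication[OF n] by simp
  finally have "Gamma (v / 2) * rGamma (1 / 2 - v / 2) =
    exp ((1 - v) * of_real (ln 2)) * Gamma v * cos (of_real pi * v / 2) * (of_real (sqrt pi) / of_real pi)" by simp
  also have "of_real (sqrt pi) / of_real pi = 1 / (of_real (sqrt pi) :: complex)"
    by (simp add: real_div_sqrt flip: of_real_divide) (simp add: field_simps flip: of_real_mult)
  finally show ?thesis by simp
qed

text \<open>The right-hand side comes from \<open>Gamma_half_quotient\<close> at
  \<open>v = 1 - s\<close>. It is continuous on the whole strip, since \<open>(1 - s) / 2\<close>
  has real part between -1 and 0 there, and therefore also gives the extended value at
  \<open>s = 2\<close>.\<close>

lemma Gamma_sin_eq:
  assumes "1 < Re s" "Re s < 3"
  shows "Gamma_sin s = exp (- s * of_real (ln 2)) * of_real (sqrt pi) * Gamma ((1 - s) / 2) * rGamma (s / 2)"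
proof -
  define g :: "complex \<Rightarrow> complex" where "g = (\<lambda>s. exp (- s * of_real (ln 2)) * of_real (sqrt pi) * Gamma ((1 - s) / 2) * rGamma (s / 2))"
  have eq: "Gamma (1 - u) * sin (of_real pi * u / 2) = g u" if "1 - u \<notin> \<int>\<^sub>\<le>\<^sub>0" for u
  proof -
    have "exp (u * of_real (ln 2)) * Gamma (1 - u) * cos (of_real pi * (1 - u) / 2) / of_real (sqrt pi) = Gamma ((1 - u) / 2) * rGamma (1 / 2 - (1 - u) / 2)"
      using Gamma_half_quotient[OF that] by simp
    also have "1 / 2 - (1 - u) / 2 = u / 2" by (simp add: field_simps)
    also have "of_real pi * (1 - u) / 2 = of_real pi / 2 - of_real pi * u / 2" by (simp add: field_simps)
    also have "cos (of_real pi / 2 - of_real pi * u / 2) = sin (of_real pi * u / 2)" by (simp add: cos_diff)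
    finally show ?thesis by (simp add: g_def exp_minus field_simps)
  qed
  have n: "(1 - s) / 2 \<notin> \<int>\<^sub>\<le>\<^sub>0"
  proof
    assume "(1 - s) / 2 \<in> \<int>\<^sub>\<le>\<^sub>0"
    then obtain n where n: "(1 - s) / 2 = of_int n" by (elim nonpos_Ints_cases)
    have "1 - Re s = real_of_int (2 * n)" using arg_cong[OF n, of Re] by simp
    then have "real_of_int (- 2) < real_of_int (2 * n)" "real_of_int (2 * n) < real_of_int 0" using assms by simp_all
    then have "- 2 < 2 * n" "2 * n < 0" unfolding of_int_less_iff .
    then show False by presburger
  qed
  have "isCont g s" unfolding g_def using n by (intro continuous_intros) auto
  then have "g \<midarrow>s\<rightarrow> g s" by (simp add: isCont_def)
  moreover have "\<forall>\<^sub>F u in at s. Gamma (1 - u) * sin (of_real pi * u / 2) = g u"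
  proof -
    \<comment> \<open>Either \<open>1 - s\<close> avoids the closed set of poles, and so do nearby
      points, or it is an integer and no other integer is within distance 1.\<close>
    have "\<forall>\<^sub>F u in at s. 1 - u \<notin> \<int>\<^sub>\<le>\<^sub>0"
    proof -
      have "\<forall>\<^sub>F u in at s. u \<in> ball s 1 - {s}" by (intro eventually_at_in_open) auto
      moreover have "\<forall>\<^sub>F u in at s. 1 - u \<notin> \<int>\<^sub>\<le>\<^sub>0" if "1 - s \<notin> \<int>\<^sub>\<le>\<^sub>0"
      proof -
        have "open (- ((\<lambda>u. 1 - u) -` \<int>\<^sub>\<le>\<^sub>0 :: complex set))" by (intro open_Compl closed_vimage continuous_intros) auto
        then have "\<forall>\<^sub>F u in at s. u \<in> - ((\<lambda>u. 1 - u) -` \<int>\<^sub>\<le>\<^sub>0)" using that by (intro eventually_at_in_open') auto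
        then show ?thesis by eventually_elim auto
      qed
      moreover have "1 - u \<notin> \<int>\<^sub>\<le>\<^sub>0" if u: "u \<in> ball s 1 - {s}" and s': "1 - s \<in> \<int>\<^sub>\<le>\<^sub>0" for u
      proof
        assume "1 - u \<in> \<int>\<^sub>\<le>\<^sub>0"
        then obtain n where n: "1 - u = of_int n" by (elim nonpos_Ints_cases)
        obtain m where m: "1 - s = of_int m" using s' by (elim nonpos_Ints_cases)
        have "s - u = of_int (n - m)" using n m by (simp add: algebra_simps)
        then have "norm (of_int (n - m) :: complex) < 1" using u by (simp add: dist_norm)
        then have "n = m" by (simp only: norm_of_int)
        then show False using u n m by (metis DiffE diff_diff_eq2 add_diff_cancel_left' singletonI)
      qed
      ultimately show ?thesis by (cases "1 - s \<in> \<int>\<^sub>\<le>\<^sub>0") (auto elim: eventually_mono)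
    qed
    then show ?thesis by eventually_elim (rule eq)
  qed
  ultimately have "(\<lambda>u. Gamma (1 - u) * sin (of_real pi * u / 2)) \<midarrow>s\<rightarrow> g s"
    by (simp cong: filterlim_cong)
  then have "remove_sings (\<lambda>u. Gamma (1 - u) * sin (of_real pi * u / 2)) s = g s" by (rule remove_sings_eqI)
  then show ?thesis unfolding Gamma_sin_def g_def .
qed

lemma prod_list_map_upt: "(\<Prod>j\<leftarrow>[0..<n]. f j) = (\<Prod>j<n. f j :: 'a :: comm_monoid_mult)"
  by (simp add: prod.distinct_set_conv_list[symmetric] atLeast0LessThan)

text \<open>The multiplication formula is applied at \<open>- w\<close> in the numerator and at
  \<open>w + 1 / (2 K)\<close> in the denominator, so the unknown constant \<open>A\<close>
  cancels.\<close>

lemma Gamma_quotient_product: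
  fixes w :: complex
  assumes K: "K > 0" and w: "- (of_nat K * w) \<notin> \<int>\<^sub>\<le>\<^sub>0"
  shows "(\<Prod>j<K. Gamma (of_nat j / of_nat K - w)) / (\<Prod>j<K. Gamma (1 - (2 * of_nat j + 1) / (2 * of_nat K) + w)) =
    exp ((2 * of_nat K * w + 1 / 2) * of_real (ln K)) * Gamma (- (of_nat K * w)) * rGamma (of_nat K * w + 1 / 2)"
proof -
  obtain A :: complex where A: "A \<noteq> 0"
    "\<And>z. A * (\<Prod>j<K. rGamma (z + of_nat j / of_nat K)) = exp (of_nat K * z * of_real (ln K)) * rGamma (of_nat K * z)"
    using rGamma_multiplication[OF K] by blast
  have "(\<Prod>j<K. Gamma (of_nat j / of_nat K - w)) = inverse (\<Prod>j<K. rGamma (- w + of_nat j / of_nat K))"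
    by (simp add: rGamma_inverse_Gamma prod_inversef[symmetric])
  also have "\<dots> = A * inverse (exp (of_nat K * (- w) * of_real (ln K)) * rGamma (of_nat K * (- w)))"
    unfolding A(2)[symmetric] using A(1) by simp
  also have "\<dots> = A * (exp (of_nat K * w * of_real (ln K)) * Gamma (- (of_nat K * w)))"
    by (simp add: rGamma_inverse_Gamma exp_minus)
  finally have 1: "(\<Prod>j<K. Gamma (of_nat j / of_nat K - w)) = A * (exp (of_nat K * w * of_real (ln K)) * Gamma (- (of_nat K * w)))" .
  \<comment> \<open>Reversing the order of the factors makes the shifts increase: with
    \<open>K - 1 - j\<close> in place of \<open>j\<close>, \<open>1 - (2 j + 1) / (2 K)\<close>
    becomes \<open>1 / (2 K) + j / K\<close>.\<close>
  have "(\<Prod>j<K. Gamma (1 - (2 * of_nat j + 1) / (2 * of_nat K) + w)) = (\<Prod>j<K. Gamma (1 - (2 * of_nat (K - Suc j) + 1) / (2 * of_nat K) + w))"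
    by (rule prod.nat_diff_reindex[symmetric])
  also have "\<dots> = (\<Prod>j<K. Gamma ((w + 1 / (2 * of_nat K)) + of_nat j / of_nat K))"
  proof (rule prod.cong[OF refl])
    fix j assume "j \<in> {..<K}"
    then have e: "of_nat (K - Suc j) = of_nat K - 1 - (of_nat j :: complex)" by (simp add: of_nat_diff)
    have "1 - (2 * of_nat (K - Suc j) + 1) / (2 * of_nat K) + w = (w + 1 / (2 * of_nat K)) + of_nat j / (of_nat K :: complex)"
      unfolding e using K by (simp add: field_simps)
    then show "Gamma (1 - (2 * of_nat (K - Suc j) + 1) / (2 * of_nat K) + w) = Gamma ((w + 1 / (2 * of_nat K)) + of_nat j / of_nat K)"
      by (simp only:)
  qed
  finally have "inverse (\<Prod>j<K. Gamma (1 - (2 * of_nat j + 1) / (2 * of_nat K) + w)) = (\<Prod>j<K. rGamma ((w + 1 / (2 * of_nat K)) + of_nat j / of_nat K))"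
    by (simp add: rGamma_inverse_Gamma prod_inversef[symmetric])
  also have "\<dots> = exp (of_nat K * (w + 1 / (2 * of_nat K)) * of_real (ln K)) * rGamma (of_nat K * (w + 1 / (2 * of_nat K))) / A"
    using A(2)[of "w + 1 / (2 * of_nat K)"] A(1) by (simp add: field_simps)
  also have "of_nat K * (w + 1 / (2 * of_nat K)) = of_nat K * w + 1 / 2" using K by (simp add: field_simps)
  finally have 2: "inverse (\<Prod>j<K. Gamma (1 - (2 * of_nat j + 1) / (2 * of_nat K) + w)) = exp ((of_nat K * w + 1 / 2) * of_real (ln K)) * rGamma (of_nat K * w + 1 / 2) / A" .
  have e: "exp ((2 * of_nat K * w + 1 / 2) * of_real (ln K)) = exp (of_nat K * w * of_real (ln K)) * exp ((of_nat K * w + 1 / 2) * of_real (ln K))"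
    unfolding exp_add[symmetric] by (rule arg_cong[of _ _ exp]) (simp add: algebra_simps)
  have "x / y = x * inverse y" for x y :: complex by (rule divide_inverse)
  from this[of "\<Prod>j<K. Gamma (of_nat j / of_nat K - w)" "\<Prod>j<K. Gamma (1 - (2 * of_nat j + 1) / (2 * of_nat K) + w)"] show ?thesis unfolding 1 2 e using A(1) by simp
qed

lemma norm_cos_le_exp: "norm (cos z) \<le> exp \<bar>Im z\<bar>"
proof -
  have "norm (cos z) = norm (exp (\<i> * z) + exp (- (\<i> * z))) / 2" by (simp add: cos_exp_eq norm_divide)
  also have "\<dots> \<le> (norm (exp (\<i> * z)) + norm (exp (- (\<i> * z)))) / 2"
    by (intro divide_right_mono norm_triangle_ineq) simp
  also have "\<dots> \<le> (exp \<bar>Im z\<bar> + exp \<bar>Im z\<bar>) / 2"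
    by (intro divide_right_mono add_mono) (simp_all add: norm_exp_eq_Re)
  finally show ?thesis by simp
qed

text \<open>The integrand differs from the one on the line \<open>Re w = c\<close> only for bounded
  \<open>t\<close>, and there it is an ordinary contour integral.\<close>

lemma integrable_along_contour:
  assumes v: "\<And>T. \<gamma> piecewise_C1_differentiable_on {-T..T}" "\<forall>t. \<bar>t\<bar> \<ge> R \<longrightarrow> \<gamma> t = Complex c t"
    and F: "open S" "F holomorphic_on S" "range \<gamma> \<subseteq> S"
    and line: "(\<lambda>t. F (Complex c t)) integrable_on UNIV"
  shows "(\<lambda>t. F (\<gamma> t) * vector_derivative \<gamma> (at t)) integrable_on UNIV"
proof -
  define T where "T = \<bar>R\<bar> + 1"
  have T: "T > 0" by (simp add: T_def)
  let ?f = "\<lambda>t. F (\<gamma> t) * vector_derivative \<gamma> (at t)" and ?g = "\<lambda>t. F (Complex c t) * \<i>"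
  have "F contour_integrable_on contour_path \<gamma> T"
    by (rule contour_integrable_holomorphic_simple[OF F(2,1) valid_contour_path[OF v(1) T]])
       (use F(3) in \<open>auto simp: path_image_contour_path[OF T]\<close>)
  then have f: "?f integrable_on {-T..T}"
    unfolding contour_integrable_on_def has_contour_integral_contour_path[OF T v(1)] by (simp add: integrable_on_def)
  have g: "?g integrable_on UNIV" using line by (rule integrable_on_mult_left)
  have gT: "?g integrable_on {-T..T}" by (rule integrable_on_subinterval[OF g]) simp
  have same: "?f t - ?g t = 0" if "t \<notin> {-T..T}" for t
  proof -
    have "(\<gamma> has_vector_derivative \<i>) (at t)"
    proof (rule has_vector_derivative_transform_within_open[OF vertical_line_has_vector_derivative])
      show "open {x. \<bar>x\<bar> > \<bar>R\<bar>}" by (intro open_Collect_less continuous_intros)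
      show "t \<in> {x. \<bar>x\<bar> > \<bar>R\<bar>}" using that by (auto simp: T_def)
      show "Complex c x = \<gamma> x" if "x \<in> {x. \<bar>x\<bar> > \<bar>R\<bar>}" for x using that v(2) by auto
    qed
    moreover have "\<gamma> t = Complex c t" using that v(2) by (auto simp: T_def)
    ultimately show ?thesis by (simp add: vector_derivative_at)
  qed
  have "(\<lambda>t. ?f t - ?g t) integrable_on {-T..T}" using f gT by (rule integrable_diff)
  then obtain j where "((\<lambda>t. ?f t - ?g t) has_integral j) {-T..T}" by (auto simp: integrable_on_def)
  then have "((\<lambda>t. ?f t - ?g t) has_integral j) UNIV"
    by (rule has_integral_on_superset) (use same in auto)
  then have "(\<lambda>t. ?f t - ?g t) integrable_on UNIV" by (auto simp: integrable_on_def)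
  from integrable_add[OF this g] show ?thesis by simp
qed

text \<open>
  The duplication and multiplication formulas turn the integrand of the G-function into a constant
  multiple of \<open>Q\<close>. With \<open>\<tau> = 2 (w - p0)\<close> and \<open>v = - 2 K w\<close> the line \<open>Re w = c\<close> corresponds to
  \<open>Re \<tau> = \<sigma>\<close>. It has all poles on the correct side except \<open>p0\<close> (that is, \<open>\<tau> = 0\<close>).
\<close>

locale meijer_setup = mellin_barnes +
  fixes y :: real
  assumes y: "y > 0" and s3: "Re s < 3"
begin

definition p0 :: complex where "p0 = (s - 1) / (2 * of_nat K)"

definition c :: real where "c = (\<sigma> + (Re s - 1) / K) / 2"

text \<open>By \<open>Q_cos\<close> the inner bracket is, up to a constant,
  \<open>Gamma v * cos (pi v / 2) * y powr (- v)\<close>. The half arguments avoid the singularities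
  of \<open>Gamma v\<close> at negative odd \<open>v\<close>: they are removable because of the
  cosine, but the HOL product would have the wrong value 0 there.\<close>

definition Q :: "complex \<Rightarrow> complex" where
  "Q w = Gamma (2 * (w - p0)) * (Gamma (s - 2 * (w - p0)) *
     (Gamma (- (of_nat K * w)) * rGamma (of_nat K * w + 1 / 2) * exp (2 * of_nat K * w * of_real (ln (y / 2)))))"

definition PL :: "complex set" where "PL = {w. 2 * (w - p0) \<in> \<int>\<^sub>\<le>\<^sub>0}"

definition PR :: "complex set" where "PR = {w. s - 2 * (w - p0) \<in> \<int>\<^sub>\<le>\<^sub>0} \<union> {w. - (of_nat K * w) \<in> \<int>\<^sub>\<le>\<^sub>0}"

lemma Re_p0: "Re p0 = (Re s - 1) / (2 * K)"
proof -
  have "p0 = (s - 1) / of_real (2 * real K)" by (simp add: p0_def)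
  then show ?thesis by (simp only: Re_divide_of_real) simp
qed

lemma c_bounds: "c < 0" "Re p0 - 1 / 2 < c" "2 * K * c = - r" "0 < Re p0" "Re p0 < 1 / K" "2 * (c - Re p0) = \<sigma>"
proof -
  have K0: "real K > 0" using K by simp
  show "2 * K * c = - r" using K0 by (simp add: c_def r_def field_simps)
  then have "2 * K * c < 0" using r(1) by simp
  then show "c < 0" using K0 by (simp add: mult_less_0_iff)
  have "Re p0 = (Re s - 1) / K / 2" unfolding Re_p0 by simp
  then show e: "2 * (c - Re p0) = \<sigma>" by (simp add: c_def add_divide_distrib)
  have "2 * (Re p0 - 1 / 2) < 2 * c" using e \<sigma> by (simp add: right_diff_distrib)
  then show "Re p0 - 1 / 2 < c" by simp
  show "0 < Re p0" unfolding Re_p0 using K0 s1 by simp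
  show "Re p0 < 1 / K" unfolding Re_p0 using K0 s3 by (simp add: field_simps)
qed

lemma PL_cases: "w \<in> PL \<Longrightarrow> w = p0 \<or> Re w < c"
proof -
  assume "w \<in> PL"
  then obtain n where n: "2 * (w - p0) = - of_nat n" by (auto simp: PL_def elim!: nonpos_Ints_cases')
  show ?thesis
  proof (cases "n = 0")
    case True
    then show ?thesis using n by simp
  next
    case False
    have "2 * (Re w - Re p0) = - real n" using arg_cong[OF n, of Re] by simp
    then show ?thesis using c_bounds(2) False by simp
  qed
qed

lemma PR_cases: "w \<in> PR \<Longrightarrow> w = 0 \<or> Re w \<ge> Re p0 + 1 / 2 \<or> Re w \<ge> 1 / K"
proof -
  assume "w \<in> PR"
  then consider n where "s - 2 * (w - p0) = - of_nat n" | n where "- (of_nat K * w) = - of_nat n"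
    by (auto simp: PR_def elim!: nonpos_Ints_cases')
  then show ?thesis
  proof cases
    case 1
    have "Re s - 2 * (Re w - Re p0) = - real n" using arg_cong[OF 1, of Re] by simp
    then show ?thesis using s1 by simp
  next
    case 2
    then have e: "of_nat K * w = of_nat n" by simp
    show ?thesis
    proof (cases "n = 0")
      case True
      then show ?thesis using e K by simp
    next
      case False
      have "real K * Re w = real n" using arg_cong[OF e, of Re] by simp
      then have "real K * Re w \<ge> 1" using False by simp
      then show ?thesis using K by (simp add: field_simps)
    qed
  qed
qed

lemma PR_gt: "w \<in> PR \<Longrightarrow> Re w > c"
proof -
  assume "w \<in> PR"
  then have cs: "w = 0 \<or> Re w \<ge> Re p0 + 1 / 2 \<or> Re w \<ge> 1 / K" by (rule PR_cases)
  have "0 < 1 / real K" using K by simp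
  then have d: "c < 1 / real K" by (rule less_trans[OF c_bounds(1)])
  have b: "c < Re p0 + 1 / 2" using c_bounds(1,4) by simp
  show "Re w > c" using cs c_bounds(1) less_le_trans[OF b] less_le_trans[OF d] by auto
qed

lemma poles_finite: "finite {p \<in> PL \<union> PR. \<bar>Re p\<bar> \<le> M}"
proof (rule finite_subset)
  show "finite ({p. of_real 2 * p + (- 2 * p0) \<in> \<int>\<^sub>\<le>\<^sub>0 \<and> \<bar>Re p\<bar> \<le> M} \<union> {p. of_real (- 2) * p + (s + 2 * p0) \<in> \<int>\<^sub>\<le>\<^sub>0 \<and> \<bar>Re p\<bar> \<le> M}
      \<union> {p. of_real (- real K) * p + 0 \<in> \<int>\<^sub>\<le>\<^sub>0 \<and> \<bar>Re p\<bar> \<le> M})"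
    using K by (intro finite_UnI finite_affine_nonpos_Ints) auto
  have e: "2 * (w - p0) = of_real 2 * w + (- 2 * p0)" "s - 2 * (w - p0) = of_real (- 2) * w + (s + 2 * p0)"
    "- (of_nat K * w) = of_real (- real K) * w + 0" for w by (simp_all add: algebra_simps)
  have PLe: "PL = {p. of_real 2 * p + (- 2 * p0) \<in> \<int>\<^sub>\<le>\<^sub>0}" unfolding PL_def e(1) ..
  have PRe: "PR = {p. of_real (- 2) * p + (s + 2 * p0) \<in> \<int>\<^sub>\<le>\<^sub>0} \<union> {p. of_real (- real K) * p + 0 \<in> \<int>\<^sub>\<le>\<^sub>0}"
    unfolding PR_def e(2,3) ..
  show "{p \<in> PL \<union> PR. \<bar>Re p\<bar> \<le> M} \<subseteq> {p. of_real 2 * p + (- 2 * p0) \<in> \<int>\<^sub>\<le>\<^sub>0 \<and> \<bar>Re p\<bar> \<le> M} \<union> {p. of_real (- 2) * p + (s + 2 * p0) \<in> \<int>\<^sub>\<le>\<^sub>0 \<and> \<bar>Re p\<bar> \<le> M}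
      \<union> {p. of_real (- real K) * p + 0 \<in> \<int>\<^sub>\<le>\<^sub>0 \<and> \<bar>Re p\<bar> \<le> M}"
    unfolding PLe PRe by blast
qed

lemma Q_holomorphic: "Q holomorphic_on - (PL \<union> PR)"
  unfolding Q_def[abs_def] PL_def PR_def by (auto intro!: holomorphic_intros)

lemma open_poles: "open (- (PL \<union> PR))"
  using closed_of_locally_finite_strips(1)[OF poles_finite] by (rule open_Compl)

lemma Q_cos:
  assumes "- 2 * of_nat K * w \<notin> \<int>\<^sub>\<le>\<^sub>0"
  shows "Q w = 2 / of_real (sqrt pi) * (Gamma (2 * (w - p0)) * Gamma (s - 2 * (w - p0)) *
     (Gamma (- 2 * of_nat K * w) * cos (of_real pi * (- 2 * of_nat K * w) / 2) * of_real y powr (2 * of_nat K * w)))"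
proof -
  let ?v = "- 2 * of_nat K * w"
  have "Gamma (- (of_nat K * w)) * rGamma (of_nat K * w + 1 / 2) = Gamma (?v / 2) * rGamma (1 / 2 - ?v / 2)"
    by (simp add: add.commute)
  also have "\<dots> = exp ((1 - ?v) * of_real (ln 2)) * Gamma ?v * cos (of_real pi * ?v / 2) / of_real (sqrt pi)"
    by (rule Gamma_half_quotient[OF assms])
  finally have 1: "Gamma (- (of_nat K * w)) * rGamma (of_nat K * w + 1 / 2) = exp ((1 - ?v) * of_real (ln 2)) * Gamma ?v * cos (of_real pi * ?v / 2) / of_real (sqrt pi)" .
  have "exp ((1 - ?v) * of_real (ln 2)) * exp (2 * of_nat K * w * of_real (ln (y / 2))) = exp (of_real (ln 2) + (2 * of_nat K * w) * of_real (ln y))"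
    unfolding exp_add[symmetric] using y by (intro arg_cong[of _ _ exp]) (simp add: ln_div algebra_simps)
  also have "\<dots> = 2 * of_real y powr (2 * of_nat K * w)"
    using y by (simp add: exp_add powr_def Ln_of_real exp_of_real)
  finally have 2: "exp ((1 - ?v) * of_real (ln 2)) * exp (2 * of_nat K * w * of_real (ln (y / 2))) = 2 * of_real y powr (2 * of_nat K * w)" .
  have "Q w = Gamma (2 * (w - p0)) * Gamma (s - 2 * (w - p0)) * (Gamma ?v * cos (of_real pi * ?v / 2) / of_real (sqrt pi)) *
     (exp ((1 - ?v) * of_real (ln 2)) * exp (2 * of_nat K * w * of_real (ln (y / 2))))"
    unfolding Q_def 1 by (simp only: mult_ac times_divide_eq_right times_divide_eq_left)
  then show ?thesis unfolding 2 by (simp only: mult_ac times_divide_eq_right times_divide_eq_left)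
qed

definition E :: "real \<Rightarrow> complex" where
  "E t = B t * (Gamma (v t) * cos (of_real pi * v t / 2) * of_real y powr (- v t))"

lemma Q_line: "Q (Complex c t) = 2 / of_real (sqrt pi) * E (- 2 * Im p0 + 2 * t)"
proof -
  \<comment> \<open>Passing from \<open>w\<close> to \<open>\<tau> = 2 (w - p0)\<close> doubles the
    parameter and shifts it, as \<open>p0\<close> need not be real.\<close>
  define t' where "t' = - 2 * Im p0 + 2 * t"
  have 1: "2 * (Complex c t - p0) = Complex \<sigma> t'"
    using c_bounds(6) by (simp add: complex_eq_iff t'_def algebra_simps)
  have K0: "of_nat K \<noteq> (0 :: complex)" using K by simp
  have "v t' = 1 - s - of_nat K * (2 * (Complex c t - p0))" unfolding v_def 1 ..
  also have "\<dots> = - 2 * of_nat K * Complex c t" using K0 by (simp add: p0_def field_simps)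
  finally have 2: "- 2 * of_nat K * Complex c t = v t'" by simp
  then have 3: "2 * of_nat K * Complex c t = - v t'" by (simp add: minus_equation_iff)
  have "v t' \<notin> \<int>\<^sub>\<le>\<^sub>0"
  proof
    assume "v t' \<in> \<int>\<^sub>\<le>\<^sub>0"
    then obtain n where n: "v t' = - of_nat n" by (elim nonpos_Ints_cases')
    have "r = Re (v t')" by simp
    also have "\<dots> = - real n" unfolding n by simp
    finally show False using r by simp
  qed
  then have "Q (Complex c t) = 2 / of_real (sqrt pi) * E t'"
    using Q_cos[of "Complex c t"] unfolding 1 2 3 by (simp add: E_def B_def)
  then show ?thesis by (simp add: t'_def)
qed

definition \<Phi> :: complex where "\<Phi> = (\<integral>u. \<phi> u * of_real (cos (y * u)) \<partial>lborel)"

text \<open>\<open>cosine_transform\<close> in the variable \<open>w\<close>: its factor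
  \<open>2 pi\<close> is halved by the change of parameter and then multiplied by the
  \<open>2 / sqrt pi\<close> of \<open>Q_cos\<close>.\<close>

lemma Q_line_integral: "((\<lambda>t. Q (Complex c t)) has_integral 2 * of_real (sqrt pi) * Gamma s * \<Phi>) UNIV"
proof -
  note ct = cosine_transform[OF y]
  have E: "integrable lborel E" "integral\<^sup>L lborel E = 2 * pi * Gamma s * \<Phi>"
    using ct by (simp_all add: E_def[abs_def] \<Phi>_def)
  have "integral\<^sup>L lborel E = \<bar>2\<bar> *\<^sub>R (\<integral>t. E (- 2 * Im p0 + 2 * t) \<partial>lborel)"
    by (rule lborel_integral_real_affine) simp
  then have i: "(\<integral>t. E (- 2 * Im p0 + 2 * t) \<partial>lborel) = pi * Gamma s * \<Phi>"
    unfolding E(2) by (simp add: scaleR_conv_of_real mult.assoc)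
  have "integrable lborel (\<lambda>t. E (- 2 * Im p0 + 2 * t))"
    by (rule lborel_integrable_real_affine[OF E(1)]) simp
  from has_integral_mult_right[OF has_integral_integral_lborel[OF this], of "2 / of_real (sqrt pi)"]
  have "((\<lambda>t. Q (Complex c t)) has_integral 2 / of_real (sqrt pi) * (pi * Gamma s * \<Phi>)) UNIV"
    unfolding i Q_line .
  moreover have "2 / of_real (sqrt pi) * (pi * Gamma s * \<Phi>) = 2 * of_real (sqrt pi) * Gamma s * \<Phi>"
  proof -
    have "of_real pi / of_real (sqrt pi) = (of_real (sqrt pi) :: complex)"
      by (simp add: real_div_sqrt flip: of_real_divide)
    moreover have "2 / of_real (sqrt pi) * (pi * Gamma s * \<Phi>) = 2 * (of_real pi / of_real (sqrt pi)) * Gamma s * \<Phi>" by simp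
    ultimately show ?thesis by (simp only:)
  qed
  ultimately show ?thesis by (simp only:)
qed

text \<open>The two Gamma factors in \<open>\<tau>\<close> decay like
  \<open>exp (- 4 |Im w|)\<close>. The growth of the cosine cancels the decay of
  \<open>Gamma v\<close> up to \<open>\<eta> |Im v|\<close>, which equals \<open>|Im w|\<close> for
  \<open>\<eta> = 1 / (2 K)\<close>. The remaining rate 3 exceeds the required one.\<close>

lemma Q_decay: "\<exists>C Y. \<forall>w. \<bar>Re w\<bar> \<le> M \<and> \<bar>Im w\<bar> \<ge> Y \<longrightarrow> norm (Q w) \<le> C * exp (- \<bar>Im w\<bar>)"
proof -
  define M1 where "M1 = 2 * (\<bar>M\<bar> + \<bar>Re p0\<bar>)"
  define M2 where "M2 = 2 * K * \<bar>M\<bar>"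
  define \<eta> where "\<eta> = 1 / (2 * real K)"
  have K1: "real K \<ge> 1" using K by simp
  have \<eta>: "\<eta> > 0" "\<eta> * (2 * K) = 1" using K by (simp_all add: \<eta>_def)
  obtain C1 where C1: "C1 > 0" "\<And>\<tau>. \<bar>Re \<tau>\<bar> \<le> M1 \<and> \<bar>Im \<tau>\<bar> \<ge> \<bar>Im s\<bar> + 1 \<Longrightarrow> norm (Gamma \<tau> * Gamma (s - \<tau>)) \<le> C1 * exp (- 2 * \<bar>Im \<tau>\<bar>)"
    using Gamma_product_bound[of M1 s] by (auto simp: M1_def)
  obtain C2 where C2: "C2 > 0" "\<And>z. \<bar>Re z\<bar> \<le> M2 \<and> \<bar>Im z\<bar> \<ge> 1 \<Longrightarrow> norm (Gamma z) \<le> C2 * exp (- (pi / 2 - \<eta>) * \<bar>Im z\<bar>)"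
    using Gamma_cmod_exp_bound[of M2 \<eta>] \<eta> by (auto simp: M2_def)
  define D where "D = 2 / sqrt pi * (C1 * exp (4 * \<bar>Im p0\<bar>) * (C2 * exp (M2 * \<bar>ln y\<bar>)))"
  show ?thesis
  proof (rule exI[of _ D], rule exI[of _ "\<bar>Im s\<bar> + \<bar>Im p0\<bar> + 1"], intro allI impI, elim conjE)
    fix w assume w: "\<bar>Re w\<bar> \<le> M" "\<bar>Im s\<bar> + \<bar>Im p0\<bar> + 1 \<le> \<bar>Im w\<bar>"
    define v' where "v' = - 2 * of_nat K * w"
    have Imv: "\<bar>Im v'\<bar> = 2 * K * \<bar>Im w\<bar>" by (simp add: v'_def abs_mult)
    have "1 * 1 \<le> 2 * K * \<bar>Im w\<bar>" using w K1 by (intro mult_mono) auto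
    then have v1: "\<bar>Im v'\<bar> \<ge> 1" using Imv by simp
    have Rev: "\<bar>Re v'\<bar> \<le> M2" using w(1) by (auto simp: v'_def M2_def abs_mult intro!: mult_left_mono)
    have vn: "- 2 * of_nat K * w \<notin> \<int>\<^sub>\<le>\<^sub>0"
    proof
      assume "- 2 * of_nat K * w \<in> \<int>\<^sub>\<le>\<^sub>0"
      then obtain n where "v' = - of_nat n" unfolding v'_def by (elim nonpos_Ints_cases')
      then show False using v1 by simp
    qed
    have b1: "norm (Gamma (2 * (w - p0)) * Gamma (s - 2 * (w - p0))) \<le> C1 * exp (4 * \<bar>Im p0\<bar>) * exp (- 4 * \<bar>Im w\<bar>)"
    proof -
      have "norm (Gamma (2 * (w - p0)) * Gamma (s - 2 * (w - p0))) \<le> C1 * exp (- 2 * \<bar>Im (2 * (w - p0))\<bar>)"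
        by (rule C1(2)) (use w in \<open>auto simp: M1_def\<close>)
      also have "- 2 * \<bar>Im (2 * (w - p0))\<bar> \<le> 4 * \<bar>Im p0\<bar> + - 4 * \<bar>Im w\<bar>"
      proof -
        have "Im (2 * (w - p0)) = 2 * Im w - 2 * Im p0" by simp
        then show ?thesis by linarith
      qed
      then have "C1 * exp (- 2 * \<bar>Im (2 * (w - p0))\<bar>) \<le> C1 * exp (4 * \<bar>Im p0\<bar> + - 4 * \<bar>Im w\<bar>)"
        using C1(1) by (intro mult_left_mono) simp_all
      finally show ?thesis unfolding exp_add by (simp only: mult.assoc)
    qed
    have b2: "norm (Gamma v' * cos (of_real pi * v' / 2)) \<le> C2 * exp \<bar>Im w\<bar>"
    proof -
      have "norm (cos (of_real pi * v' / 2)) \<le> exp \<bar>Im (of_real pi * v' / 2)\<bar>"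
        by (rule norm_cos_le_exp)
      also have "\<bar>Im (of_real pi * v' / 2)\<bar> = pi / 2 * \<bar>Im v'\<bar>" by (simp add: abs_mult)
      finally have "norm (Gamma v' * cos (of_real pi * v' / 2)) \<le> (C2 * exp (- (pi / 2 - \<eta>) * \<bar>Im v'\<bar>)) * exp (pi / 2 * \<bar>Im v'\<bar>)"
        unfolding norm_mult using C2 v1 Rev by (intro mult_mono) auto
      also have "\<dots> = C2 * exp (\<eta> * \<bar>Im v'\<bar>)"
      proof -
        have "- (a - \<eta>) * x + a * x = \<eta> * x" for a x :: real by (simp add: left_diff_distrib)
        then show ?thesis by (simp only: mult.assoc[of C2] exp_add[symmetric])
      qed
      also have "\<eta> * \<bar>Im v'\<bar> = \<bar>Im w\<bar>" unfolding Imv using \<eta>(2) by (simp flip: mult.assoc)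
      finally show ?thesis .
    qed
    have b3: "norm (complex_of_real y powr (2 * of_nat K * w)) \<le> exp (M2 * \<bar>ln y\<bar>)"
      by (rule norm_powr_real_bound[OF y]) (use Rev in \<open>simp add: v'_def\<close>)
    have "norm (Q w) = 2 / sqrt pi * (norm (Gamma (2 * (w - p0)) * Gamma (s - 2 * (w - p0))) * (norm (Gamma v' * cos (of_real pi * v' / 2)) * norm (complex_of_real y powr (2 * of_nat K * w))))"
      unfolding Q_cos[OF vn] v'_def[symmetric] by (simp add: norm_mult norm_divide mult.assoc)
    also have "\<dots> \<le> 2 / sqrt pi * ((C1 * exp (4 * \<bar>Im p0\<bar>) * exp (- 4 * \<bar>Im w\<bar>)) * ((C2 * exp \<bar>Im w\<bar>) * exp (M2 * \<bar>ln y\<bar>)))"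
      using b1 b2 b3 C1(1) C2(1) by (intro mult_left_mono mult_mono) auto
    also have "\<dots> = D * (exp (- 4 * \<bar>Im w\<bar>) * exp \<bar>Im w\<bar>)" by (simp add: D_def)
    also have "\<dots> \<le> D * exp (- \<bar>Im w\<bar>)"
      unfolding exp_add[symmetric] using C1(1) C2(1) by (intro mult_left_mono) (auto simp: D_def)
    finally show "norm (Q w) \<le> D * exp (- \<bar>Im w\<bar>)" .
  qed
qed

lemma p0_in_PL: "p0 \<in> PL" by (simp add: PL_def)

lemma p0_notin_PR: "p0 \<notin> PR"
  using PR_cases[of p0] c_bounds(4,5) by auto

text \<open>As \<open>K p0 = (s - 1) / 2\<close>, the Gamma quotient left at \<open>p0\<close> is
  the one in \<open>Gamma_sin_eq\<close>, regular also at \<open>s = 2\<close>.\<close>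

lemma residue_Q: "residue Q p0 = Gamma s * of_real y powr (s - 1) * Gamma_sin s / of_real (sqrt pi)"
proof -
  define g where "g = (\<lambda>w. Gamma (s - 2 * (w - p0)) * (Gamma (- (of_nat K * w)) * rGamma (of_nat K * w + 1 / 2) * exp (2 * of_nat K * w * of_real (ln (y / 2)))))"
  have "closed PR"
    by (rule closed_of_locally_finite_strips(1)) (rule finite_subset[OF _ poles_finite], auto)
  then have "open (- PR)" by (rule open_Compl)
  moreover have "g holomorphic_on - PR" unfolding g_def PR_def by (auto intro!: holomorphic_intros)
  ultimately have "residue (\<lambda>w. Gamma (of_real 2 * (w - p0)) * g w) p0 = g p0 / of_real 2"
    using p0_notin_PR by (intro residue_Gamma_mult) auto
  then have 1: "residue Q p0 = g p0 / 2" by (simp add: Q_def[abs_def] g_def)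
  have K0: "of_nat K \<noteq> (0 :: complex)" using K by simp
  have Kp: "of_nat K * p0 = (s - 1) / 2" using K0 by (simp add: p0_def)
  have "g p0 = Gamma s * (Gamma ((1 - s) / 2) * rGamma (s / 2) * exp ((s - 1) * of_real (ln (y / 2))))"
  proof -
    have q: "- (of_nat K * p0) = (1 - s) / 2" "of_nat K * p0 + 1 / 2 = s / 2" "2 * of_nat K * p0 = s - 1"
      unfolding Kp mult.assoc by (simp_all add: field_simps)
    show ?thesis unfolding g_def q by simp
  qed
  moreover have "Gamma ((1 - s) / 2) * rGamma (s / 2) = exp (s * of_real (ln 2)) * Gamma_sin s / of_real (sqrt pi)"
    using Gamma_sin_eq[OF s1 s3] by (simp add: exp_minus field_simps)
  ultimately have "residue Q p0 = Gamma s * Gamma_sin s / of_real (sqrt pi) * (exp (s * of_real (ln 2)) * exp ((s - 1) * of_real (ln (y / 2)))) / 2"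
    unfolding 1 by simp
  also have "exp (s * of_real (ln 2)) * exp ((s - 1) * of_real (ln (y / 2))) = exp (of_real (ln 2) + (s - 1) * of_real (ln y))"
    unfolding exp_add[symmetric] using y by (intro arg_cong[of _ _ exp]) (simp add: ln_div algebra_simps)
  also have "\<dots> = 2 * of_real y powr (s - 1)"
    using y by (simp add: exp_add powr_def Ln_of_real exp_of_real)
  finally show ?thesis by simp
qed

text \<open>Refers to the merged pole sets of \<open>Q\<close>; \<open>meijer_contour_iff\<close>
  shows that these are the unions of the pole sets of the separate Gamma factors.\<close>

definition separates :: "(real \<Rightarrow> complex) \<Rightarrow> bool" where
  "separates \<gamma> \<longleftrightarrow> vertical_contour \<gamma> \<and> PL \<subseteq> left_side \<gamma> \<and> PR \<subseteq> right_side \<gamma>"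

lemma separates_avoids:
  assumes "separates \<gamma>" shows "range \<gamma> \<subseteq> - (PL \<union> PR)"
proof -
  have "z \<notin> range \<gamma>" if "z \<in> left_side \<gamma> \<or> z \<in> right_side \<gamma>" for z
  proof -
    have "\<exists>r. connected_component (- range \<gamma>) z (complex_of_real r)"
      using that by (auto simp: left_side_def right_side_def dest!: eventually_happens)
    then show ?thesis using connected_component_in by blast
  qed
  then show ?thesis using assms unfolding separates_def by blast
qed

text \<open>The uniqueness half of the definite description in \<open>meijer_G\<close>: the
  right-hand side does not mention \<open>\<gamma>\<close>.\<close>

lemma contour_value:
  assumes \<gamma>: "separates \<gamma>" and I: "((\<lambda>t. Q (\<gamma> t) * vector_derivative \<gamma> (at t)) has_integral I) UNIV"
  shows "I = 2 * pi * \<i> * (Gamma s / of_real (sqrt pi) * (\<Phi> + of_real y powr (s - 1) * Gamma_sin s))"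
proof -
  obtain c' R where v: "\<And>T. \<gamma> piecewise_C1_differentiable_on {-T..T}" "\<forall>t. \<bar>t\<bar> \<ge> R \<longrightarrow> \<gamma> t = Complex c' t"
    using \<gamma> by (auto simp: separates_def vertical_contour_def)
  have "I = \<i> * (2 * of_real (sqrt pi) * Gamma s * \<Phi>) + 2 * pi * \<i> * residue Q p0"
  proof (rule contour_shift[OF v, where PL = "PL - {p0}" and PR = PR and a = c])
    have "PL - {p0} \<union> PR \<union> {p0} = PL \<union> PR" using p0_in_PL by auto
    then show "Q holomorphic_on - (PL - {p0} \<union> PR \<union> {p0})" using Q_holomorphic by (simp only:)
    show "p0 \<in> left_side \<gamma>" using \<gamma> p0_in_PL by (auto simp: separates_def)
    show "Re p0 > c" using c_bounds by linarith
    show "finite {p \<in> PL - {p0} \<union> PR. \<bar>Re p\<bar> \<le> M}" for M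
      by (rule finite_subset[OF _ poles_finite[of M]]) auto
    show "PL - {p0} \<subseteq> left_side \<gamma>" "PR \<subseteq> right_side \<gamma>" using \<gamma> by (auto simp: separates_def)
    show "Re p < c" if "p \<in> PL - {p0}" for p using PL_cases[of p] that by blast
  qed (fact PR_gt Q_decay I Q_line_integral)+
  moreover have "of_real pi = of_real (sqrt pi) * (of_real (sqrt pi) :: complex)"
    by (simp flip: of_real_mult)
  ultimately show ?thesis unfolding residue_Q by (simp add: field_simps)
qed

lemma contour_exists:
  obtains \<gamma> I where "separates \<gamma>" "((\<lambda>t. Q (\<gamma> t) * vector_derivative \<gamma> (at t)) has_integral I) UNIV"
proof -
  \<comment> \<open>The tip of the contour passes \<open>p0\<close> but stays to the left of all
    poles of the right family other than 0.\<close>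
  obtain d where d: "Re p0 < d" "d < min (1 / K) (Re p0 + 1 / 2)"
    using dense[of "Re p0" "min (1 / K) (Re p0 + 1 / 2)"] c_bounds by auto
  obtain \<gamma> R where v: "\<And>T. \<gamma> piecewise_C1_differentiable_on {-T..T}" "\<forall>t. \<bar>t\<bar> \<ge> R \<longrightarrow> \<gamma> t = Complex c t"
    and sides: "{w. Re w < c} \<subseteq> left_side \<gamma>" "Complex (Re p0) (Im p0) \<in> left_side \<gamma>" "0 \<in> right_side \<gamma>" "{w. Re w > d} \<subseteq> right_side \<gamma>"
    using separating_contour[OF c_bounds(1) c_bounds(4) d(1)] by blast
  have "PL \<subseteq> left_side \<gamma>"
  proof
    fix w assume "w \<in> PL"
    then have "w = p0 \<or> w \<in> {w. Re w < c}" using PL_cases by blast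
    then show "w \<in> left_side \<gamma>" using sides(1,2) by auto
  qed
  moreover have "PR \<subseteq> right_side \<gamma>"
  proof
    fix w assume "w \<in> PR"
    then have "w = 0 \<or> w \<in> {w. Re w > d}" using PR_cases[of w] d by auto
    then show "w \<in> right_side \<gamma>" using sides(3,4) by auto
  qed
  ultimately have \<gamma>: "separates \<gamma>" using v by (auto simp: separates_def vertical_contour_def)
  have "(\<lambda>t. Q (\<gamma> t) * vector_derivative \<gamma> (at t)) integrable_on UNIV"
    by (rule integrable_along_contour[OF v open_poles Q_holomorphic separates_avoids[OF \<gamma>]])
       (use Q_line_integral in \<open>auto simp: integrable_on_def\<close>)
  then show ?thesis using that \<gamma> by (auto simp: integrable_on_def)
qed

end

context meijer_setup
begin

section \<open>Evaluation of the G-function and return to the original integral\<close>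

definition "as_list = [(2 * of_nat K - 1 + s) / (2 * of_nat K), (of_nat K - 1 + s) / (2 * of_nat K)]"

definition "b0 = (s * of_nat (Suc K) - 1) / (2 * of_nat K)"

definition "bs_list = map (\<lambda>j. of_nat j / of_nat K) [0..<K] @ [b0, b0 + 1 / 2]"

definition "bs'_list = map (\<lambda>j. (2 * of_nat j + 1) / (2 * of_nat K)) [0..<K]"

definition X :: complex where "X = of_real ((y / (2 * real K)) ^ (2 * K))"

text \<open>The two duplications contribute \<open>pi\<close> and, since the \<open>w\<close> in
  their exponents cancels, \<open>2 powr (2 - s)\<close>; the multiplication formula contributes
  \<open>sqrt K\<close>.\<close>

definition \<kappa> :: complex where "\<kappa> = exp ((2 - s) * of_real (ln 2)) * of_real (pi * sqrt K)"

lemma as_shift: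
  "1 - (2 * of_nat K - 1 + s) / (2 * of_nat K) + w = w - p0"
  "1 - (of_nat K - 1 + s) / (2 * of_nat K) + w = w - p0 + 1 / 2"
  using K by (simp_all add: p0_def field_simps)

lemma b0_shift: "b0 - w = s / 2 - (w - p0)" "b0 + 1 / 2 - w = s / 2 - (w - p0) + 1 / 2"
  using K by (simp_all add: b0_def p0_def field_simps)

lemma PL_iff: "w \<in> PL \<longleftrightarrow> w - p0 \<in> \<int>\<^sub>\<le>\<^sub>0 \<or> w - p0 + 1 / 2 \<in> \<int>\<^sub>\<le>\<^sub>0"
  by (simp add: PL_def half_nonpos_Ints)

lemma PR_iff: "w \<in> PR \<longleftrightarrow> (\<exists>j<K. of_nat j / of_nat K - w \<in> \<int>\<^sub>\<le>\<^sub>0) \<or> b0 - w \<in> \<int>\<^sub>\<le>\<^sub>0 \<or> b0 + 1 / 2 - w \<in> \<int>\<^sub>\<le>\<^sub>0"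
proof -
  have "2 * (s / 2 - (w - p0)) = s - 2 * (w - p0)" by (simp add: algebra_simps)
  then have 1: "s - 2 * (w - p0) \<in> \<int>\<^sub>\<le>\<^sub>0 \<longleftrightarrow> b0 - w \<in> \<int>\<^sub>\<le>\<^sub>0 \<or> b0 + 1 / 2 - w \<in> \<int>\<^sub>\<le>\<^sub>0"
    unfolding b0_shift using half_nonpos_Ints[of "s / 2 - (w - p0)"] by (simp only:)
  have "(\<exists>j<K. of_nat j / of_nat K - w \<in> \<int>\<^sub>\<le>\<^sub>0) \<longleftrightarrow> (\<exists>j<K. - w + of_nat j / of_nat K \<in> \<int>\<^sub>\<le>\<^sub>0)" by simp
  also have "\<dots> \<longleftrightarrow> of_nat K * (- w) \<in> \<int>\<^sub>\<le>\<^sub>0" by (rule multiple_nonpos_Ints[OF K])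
  finally show ?thesis unfolding PR_def using 1 by auto
qed

lemma pole_sets:
  fixes a b :: complex
  shows "{w. is_pole (\<lambda>u. Gamma (1 - a + u)) w} = {w. 1 - a + w \<in> \<int>\<^sub>\<le>\<^sub>0}"
  "{w. is_pole (\<lambda>u. Gamma (b - u)) w} = {w. b - w \<in> \<int>\<^sub>\<le>\<^sub>0}"
  using is_pole_Gamma_iff[of 1 "1 - a"] is_pole_Gamma_iff[of "-1" b] by (simp_all add: add.commute)

lemma meijer_contour_iff: "meijer_contour as_list bs_list \<gamma> \<longleftrightarrow> separates \<gamma>"
proof -
  have "(\<forall>a\<in>set as_list. {w. is_pole (\<lambda>u. Gamma (1 - a + u)) w} \<subseteq> left_side \<gamma>) \<longleftrightarrow> PL \<subseteq> left_side \<gamma>"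
    unfolding pole_sets as_list_def by (auto simp: as_shift PL_iff)
  moreover have "(\<forall>b\<in>set bs_list. {w. is_pole (\<lambda>u. Gamma (b - u)) w} \<subseteq> right_side \<gamma>) \<longleftrightarrow> PR \<subseteq> right_side \<gamma>"
  proof -
    have "PR = (\<Union>j<K. {w. of_nat j / of_nat K - w \<in> \<int>\<^sub>\<le>\<^sub>0}) \<union> {w. b0 - w \<in> \<int>\<^sub>\<le>\<^sub>0} \<union> {w. b0 + 1 / 2 - w \<in> \<int>\<^sub>\<le>\<^sub>0}"
      using PR_iff by auto
    then show ?thesis unfolding pole_sets bs_list_def by (auto simp: UN_subset_iff)
  qed
  ultimately show ?thesis by (simp add: meijer_contour_def separates_def)
qed

text \<open>The power of \<open>K\<close> with exponent \<open>2 K w\<close> from the multiplication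
  formula cancels against the one in \<open>X powr w\<close>, so that \<open>y / 2\<close> is the
  base left in \<open>Q\<close>.\<close>

lemma meijer_integrand_eq:
  assumes "w \<notin> PL \<union> PR"
  shows "meijer_integrand as_list [] bs_list bs'_list X w = \<kappa> * Q w"
proof -
  have w: "2 * (w - p0) \<notin> \<int>\<^sub>\<le>\<^sub>0" "s - 2 * (w - p0) \<notin> \<int>\<^sub>\<le>\<^sub>0" "- (of_nat K * w) \<notin> \<int>\<^sub>\<le>\<^sub>0"
    using assms by (auto simp: PL_def PR_def)
  have K0: "real K > 0" using K by simp
  define G1 where "G1 = Gamma (w - p0) * Gamma (w - p0 + 1 / 2)"
  define G2 where "G2 = Gamma (b0 - w) * Gamma (b0 + 1 / 2 - w)"
  define N where "N = (\<Prod>j<K. Gamma (of_nat j / of_nat K - w))"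
  define D where "D = (\<Prod>j<K. Gamma (1 - (2 * of_nat j + 1) / (2 * of_nat K) + w))"
  have G1: "G1 = exp ((1 - 2 * (w - p0)) * of_real (ln 2)) * of_real (sqrt pi) * Gamma (2 * (w - p0))"
    unfolding G1_def by (rule Gamma_duplication[OF w(1)])
  have e: "2 * (s / 2 - (w - p0)) = s - 2 * (w - p0)" by (simp add: algebra_simps)
  have G2: "G2 = exp ((1 - (s - 2 * (w - p0))) * of_real (ln 2)) * of_real (sqrt pi) * Gamma (s - 2 * (w - p0))"
    unfolding G2_def b0_shift using Gamma_duplication[of "s / 2 - (w - p0)"] w(2) unfolding e by simp
  have ND: "N / D = exp ((2 * of_nat K * w + 1 / 2) * of_real (ln K)) * Gamma (- (of_nat K * w)) * rGamma (of_nat K * w + 1 / 2)"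
    unfolding N_def D_def by (rule Gamma_quotient_product[OF K w(3)])
  have Xw: "X powr w = exp (w * of_real (2 * K * ln (y / (2 * real K))))"
  proof -
    have "(y / (2 * real K)) ^ (2 * K) > 0" using y K0 by simp
    moreover from this have "X \<noteq> 0" unfolding X_def of_real_eq_0_iff by (rule less_imp_neq[symmetric])
    ultimately show ?thesis using y K0 by (simp only: powr_def X_def Ln_of_real ln_realpow if_False)
  qed
  have "meijer_integrand as_list [] bs_list bs'_list X w = (N * G2 * G1) / D * X powr w"
    unfolding meijer_integrand_def as_list_def bs_list_def bs'_list_def N_def D_def G1_def G2_def
    by (simp add: o_def prod_list_map_upt as_shift mult.assoc)
  also have "\<dots> = (N / D) * G1 * G2 * X powr w" by simp
  also have "\<dots> = (exp ((2 * of_nat K * w + 1 / 2) * of_real (ln K)) * exp ((1 - 2 * (w - p0)) * of_real (ln 2)) *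
      exp ((1 - (s - 2 * (w - p0))) * of_real (ln 2)) * exp (w * of_real (2 * K * ln (y / (2 * real K))))) * (of_real (sqrt pi) * of_real (sqrt pi)) *
      (Gamma (2 * (w - p0)) * (Gamma (s - 2 * (w - p0)) * (Gamma (- (of_nat K * w)) * rGamma (of_nat K * w + 1 / 2))))"
    unfolding ND G1 G2 Xw by (simp only: mult_ac)
  also have "exp ((2 * of_nat K * w + 1 / 2) * of_real (ln K)) * exp ((1 - 2 * (w - p0)) * of_real (ln 2)) *
      exp ((1 - (s - 2 * (w - p0))) * of_real (ln 2)) * exp (w * of_real (2 * K * ln (y / (2 * real K))))
    = exp (of_real (ln K) / 2) * exp ((2 - s) * of_real (ln 2)) * exp (2 * of_nat K * w * of_real (ln (y / 2)))"
    unfolding exp_add[symmetric] using y K0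
    by (intro arg_cong[of _ _ exp]) (simp add: ln_div ln_mult algebra_simps)
  also have "exp (of_real (ln K) / 2) = complex_of_real (sqrt K)"
  proof -
    have "exp (ln (real K) / 2) = sqrt K" using K0 by (simp add: ln_sqrt[symmetric])
    then show ?thesis by (metis exp_of_real of_real_divide of_real_numeral)
  qed
  also have "of_real (sqrt pi) * of_real (sqrt pi) = complex_of_real pi" by (simp flip: of_real_mult)
  finally show ?thesis unfolding Q_def \<kappa>_def by (simp only: of_real_mult mult_ac)
qed

lemma meijer_G_eq: "meijer_G as_list [] bs_list bs'_list X = \<kappa> * (Gamma s / of_real (sqrt pi) * (\<Phi> + of_real y powr (s - 1) * Gamma_sin s))"
proof -
  let ?M = "meijer_integrand as_list [] bs_list bs'_list X"
  define V where "V = Gamma s / of_real (sqrt pi) * (\<Phi> + of_real y powr (s - 1) * Gamma_sin s)"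
  have \<kappa>: "\<kappa> \<noteq> 0" using K by (simp add: \<kappa>_def)
  have eq: "?M (\<gamma> t) * vector_derivative \<gamma> (at t) = \<kappa> * (Q (\<gamma> t) * vector_derivative \<gamma> (at t))"
    if "separates \<gamma>" for \<gamma> t
    using separates_avoids[OF that] by (subst meijer_integrand_eq) (auto simp: mult.assoc)
  have cancel: "1 / (2 * of_real pi * \<i>) * (\<kappa> * (2 * pi * \<i> * V)) = \<kappa> * V"
  proof -
    have "1 / (2 * of_real pi * \<i>) * (\<kappa> * (2 * pi * \<i> * V)) = (1 / (2 * of_real pi * \<i>) * (2 * of_real pi * \<i>)) * (\<kappa> * V)"
      by (simp only: of_real_mult of_real_numeral mult_ac)
    then show ?thesis by simp
  qed
  show ?thesis unfolding meijer_G_def meijer_contour_iff V_def[symmetric]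
  proof (rule the_equality)
    obtain \<gamma> I where \<gamma>: "separates \<gamma>" and I: "((\<lambda>t. Q (\<gamma> t) * vector_derivative \<gamma> (at t)) has_integral I) UNIV"
      using contour_exists by blast
    have "I = 2 * pi * \<i> * V" unfolding V_def by (rule contour_value[OF \<gamma> I])
    then have "\<kappa> * V = 1 / (2 * of_real pi * \<i>) * (\<kappa> * I)" by (simp only: cancel)
    moreover have "((\<lambda>t. ?M (\<gamma> t) * vector_derivative \<gamma> (at t)) has_integral \<kappa> * I) UNIV"
      unfolding eq[OF \<gamma>] by (rule has_integral_mult_right[OF I])
    ultimately show "\<exists>\<gamma> I. separates \<gamma> \<and> ((\<lambda>t. ?M (\<gamma> t) * vector_derivative \<gamma> (at t)) has_integral I) UNIV \<and>
        \<kappa> * V = 1 / (2 * of_real pi * \<i>) * I" using \<gamma> by blast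
  next
    fix u assume "\<exists>\<gamma> I. separates \<gamma> \<and> ((\<lambda>t. ?M (\<gamma> t) * vector_derivative \<gamma> (at t)) has_integral I) UNIV \<and>
        u = 1 / (2 * of_real pi * \<i>) * I"
    then obtain \<gamma> I where \<gamma>: "separates \<gamma>" and I: "((\<lambda>t. ?M (\<gamma> t) * vector_derivative \<gamma> (at t)) has_integral I) UNIV"
      and u: "u = 1 / (2 * of_real pi * \<i>) * I" by blast
    from has_integral_mult_right[OF I[unfolded eq[OF \<gamma>]], of "1 / \<kappa>"] \<kappa>
    have "((\<lambda>t. Q (\<gamma> t) * vector_derivative \<gamma> (at t)) has_integral I / \<kappa>) UNIV" by simp
    from contour_value[OF \<gamma> this] have "I / \<kappa> = 2 * pi * \<i> * V" unfolding V_def .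
    then have "I = \<kappa> * (2 * pi * \<i> * V)" using \<kappa> by (simp add: field_simps)
    then show "u = \<kappa> * V" unfolding u by (simp only: cancel)
  qed
qed

text \<open>The Jacobian \<open>K * u ^ (K - 1)\<close> and the power of \<open>x = u ^ K\<close>
  combine to \<open>K * u powr (- s)\<close>. The change of variables is used from \<open>u\<close>
  to \<open>x\<close>, so that absolute integrability in \<open>x\<close> follows from that of
  \<open>\<phi>\<close>.\<close>

lemma substituted_integral:
  "((\<lambda>x. (complex_of_real (1 + x) powr (- s) - 1) * complex_of_real x powr (- ((s + of_nat K - 1) / of_nat K)) *
      complex_of_real (cos (y * x powr (1 / real K)))) has_integral of_nat K * \<Phi>) {0<..}"
proof -
  define f where "f = (\<lambda>x. (complex_of_real (1 + x) powr (- s) - 1) * complex_of_real x powr (- ((s + of_nat K - 1) / of_nat K)) *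
      complex_of_real (cos (y * x powr (1 / real K))))"
  define g where "g = (\<lambda>u::real. u ^ K)"
  define g' where "g' = (\<lambda>u::real. real K * u ^ (K - 1))"
  define h where "h = (\<lambda>u. of_nat K * (\<phi> u * of_real (cos (y * u))))"
  have K0: "real K > 0" using K by simp
  have "(\<lambda>u. \<phi> u * of_real (cos (y * u))) \<in> borel_measurable borel" by measurable
  then have "integrable lborel (\<lambda>u. \<phi> u * of_real (cos (y * u)))"
    by (intro Bochner_Integration.integrable_bound[OF \<phi>_integrable]) (auto simp: norm_mult intro!: AE_I2 mult_left_le)
  then have "integrable lborel h" and hi: "integral\<^sup>L lborel h = of_nat K * \<Phi>" by (simp_all add: h_def \<Phi>_def)
  then have h: "h absolutely_integrable_on UNIV" "integral UNIV h = of_nat K * \<Phi>"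
    using has_integral_integral_lborel[of h] by (auto simp: set_integrable_def integrable_completion integral_unique)
  have hz: "h u = 0" if "u \<notin> {0<..}" for u using that by (simp add: h_def \<phi>_def)
  have "(h has_integral of_nat K * \<Phi>) {0<..}"
  proof -
    have "(h has_integral of_nat K * \<Phi>) UNIV" using h(1,2) by (metis has_integral_integral set_lebesgue_integral_eq_integral(1))
    moreover have "h = (\<lambda>u. if u \<in> {0<..} then h u else 0)" using hz by auto
    ultimately show ?thesis by (metis has_integral_restrict_UNIV)
  qed
  then have hint: "integral {0<..} h = of_nat K * \<Phi>" by (rule integral_unique)
  have hai: "h absolutely_integrable_on {0<..}" by (rule set_integrable_subset[OF h(1)]) auto
  have heq: "h u = \<bar>g' u\<bar> *\<^sub>R f (g u)" if "u \<in> {0<..}" for u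
  proof -
    have u: "u > 0" using that by simp
    have 1: "g u powr (1 / real K) = u" using u K0 by (simp add: g_def powr_power powr_powr flip: powr_realpow)
    have 2: "of_real (u ^ (K - 1)) * complex_of_real (g u) powr (- ((s + of_nat K - 1) / of_nat K)) = of_real u powr (- s)"
    proof -
      have "complex_of_real (g u) powr (- ((s + of_nat K - 1) / of_nat K)) = exp (- ((s + of_nat K - 1) / of_nat K) * of_real (real K * ln u))"
      proof -
        have gp: "g u > 0" using u by (simp add: g_def)
        then have "complex_of_real (g u) \<noteq> 0" by simp
        then have "complex_of_real (g u) powr (- ((s + of_nat K - 1) / of_nat K)) = exp (- ((s + of_nat K - 1) / of_nat K) * of_real (ln (g u)))"
          unfolding powr_def using Ln_of_real[OF gp] by simp
        also have "ln (g u) = real K * ln u" using u by (simp add: g_def ln_realpow)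
        finally show ?thesis .
      qed
      also have "- ((s + of_nat K - 1) / of_nat K) * of_real (real K * ln u) = - (s + of_nat K - 1) * of_real (ln u)"
        using K by (simp add: field_simps)
      finally have "complex_of_real (g u) powr (- ((s + of_nat K - 1) / of_nat K)) = exp (- (s + of_nat K - 1) * of_real (ln u))" .
      moreover have "complex_of_real (u ^ (K - 1)) = exp ((of_nat K - 1) * of_real (ln u))"
      proof -
        have "u ^ (K - 1) = exp (real (K - 1) * ln u)" using u by (simp add: exp_of_nat_mult)
        then have "complex_of_real (u ^ (K - 1)) = exp (of_real (real (K - 1) * ln u))" by (simp only: exp_of_real)
        then show ?thesis using K by (simp add: of_nat_diff)
      qed
      ultimately have "of_real (u ^ (K - 1)) * complex_of_real (g u) powr (- ((s + of_nat K - 1) / of_nat K)) =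
         exp ((of_nat K - 1) * of_real (ln u) + - (s + of_nat K - 1) * of_real (ln u))" by (simp only: exp_add)
      also have "(of_nat K - 1) * of_real (ln u) + - (s + of_nat K - 1) * of_real (ln u) = - s * complex_of_real (ln u)" by (simp add: algebra_simps)
      also have "exp (- s * complex_of_real (ln u)) = of_real u powr (- s)" using u by (simp add: powr_def Ln_of_real)
      finally show ?thesis .
    qed
    have "\<bar>g' u\<bar> *\<^sub>R f (g u) = of_nat K * ((complex_of_real (1 + g u) powr (- s) - 1) * (of_real (u ^ (K - 1)) * complex_of_real (g u) powr (- ((s + of_nat K - 1) / of_nat K))) * of_real (cos (y * u)))"
      unfolding f_def 1 using u by (simp add: g'_def abs_mult scaleR_conv_of_real)
    then show ?thesis unfolding 2 using u by (simp add: h_def \<phi>_def g_def mult.assoc)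
  qed
  have "(\<lambda>u. \<bar>g' u\<bar> *\<^sub>R f (g u)) absolutely_integrable_on {0<..} \<longleftrightarrow> h absolutely_integrable_on {0<..}"
    by (intro set_integrable_cong refl heq[symmetric])
  moreover have "integral {0<..} (\<lambda>u. \<bar>g' u\<bar> *\<^sub>R f (g u)) = integral {0<..} h"
    by (intro integral_cong heq[symmetric])
  ultimately have "(\<lambda>u. \<bar>g' u\<bar> *\<^sub>R f (g u)) absolutely_integrable_on {0<..} \<and> integral {0<..} (\<lambda>u. \<bar>g' u\<bar> *\<^sub>R f (g u)) = of_nat K * \<Phi>"
    using hai hint by simp
  then have "f absolutely_integrable_on g ` {0<..} \<and> integral (g ` {0<..}) f = of_nat K * \<Phi>"
  proof (subst (asm) has_absolute_integral_change_of_variables_real)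
    show "(g has_field_derivative g' x) (at x within {0<..})" for x
      unfolding g_def g'_def by (auto intro!: derivative_eq_intros)
    show "inj_on g {0<..}" using K by (auto simp: g_def inj_on_def intro: power_eq_imp_eq_base)
  qed auto
  moreover have "g ` {0<..} = {0<..}"
  proof
    show "{0<..} \<subseteq> g ` {0<..}"
    proof
      fix x :: real assume "x \<in> {0<..}"
      then have "x = g (root K x)" "root K x \<in> {0<..}" using K by (auto simp: g_def)
      then show "x \<in> g ` {0<..}" by blast
    qed
  qed (auto simp: g_def)
  ultimately have "f absolutely_integrable_on {0<..}" "integral {0<..} f = of_nat K * \<Phi>" by simp_all
  then show ?thesis unfolding f_def[symmetric] by (metis has_integral_integral set_lebesgue_integral_eq_integral(1))
qed

end

theorem theorem1p4:
  fixes k :: nat and y :: real and s :: complex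
  assumes "k \<ge> 2" and "y > 0"
    and "(k = 2 \<and> 1 < Re s \<and> Re s < 2) \<or> (k > 2 \<and> 1 < Re s \<and> Re s < 3)"
  shows "((\<lambda>x::real. (complex_of_real (1 + x) powr (- s) - 1)
             * complex_of_real x powr ((s + of_nat k - 2) / (1 - of_nat k))
             * complex_of_real (cos (y * x powr (1 / (real k - 1)))))
          has_integral
            (of_nat k - 1) *
              (2 powr (s - 2) / (complex_of_real (sqrt (pi * (real k - 1))) * Gamma s) * meijer_G_cal k s y
               - complex_of_real y powr (s - 1) * Gamma_sin s))
         {0<..}"
proof -
  define K where "K = k - 1"
  have k: "k = Suc K" and K: "K > 0" using assms(1) by (auto simp: K_def)
  \<comment> \<open>The last bound is the hypothesis \<open>Re s < 2\<close> for
    \<open>k = 2\<close> and follows from \<open>Re s < 3\<close> for larger \<open>k\<close>. It is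
    what makes the interval for \<open>\<sigma>\<close> nonempty.\<close>
  have s: "1 < Re s" "Re s < 3" "Re s < real K + 1" using assms(3) by (auto simp: K_def)
  have "max (-1) (- Re s / K) < (1 - Re s) / K" using s K by (simp add: field_simps)
  then obtain \<sigma> where \<sigma>: "max (-1) (- Re s / K) < \<sigma>" "\<sigma> < (1 - Re s) / K" using dense by blast
  have neg: "(1 - Re s) / K < 0" using s K by (simp add: field_simps)
  interpret meijer_setup s \<sigma> K y
  proof
    show "\<sigma> < 0" using \<sigma>(2) neg by linarith
    show "- Re s < real K * \<sigma>" "real K * \<sigma> < 1 - Re s" using \<sigma> K by (auto simp: field_simps)
  qed (use s \<sigma> K assms(2) in auto)
  have "meijer_G_cal k s y = meijer_G as_list [] bs_list bs'_list X"
    unfolding meijer_G_cal_def as_list_def bs_list_def bs'_list_def X_def b0_def k by (simp add: algebra_simps)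
  then have G: "meijer_G_cal k s y = \<kappa> * (Gamma s / of_real (sqrt pi) * (\<Phi> + of_real y powr (s - 1) * Gamma_sin s))"
    unfolding meijer_G_eq .
  have Gs: "Gamma s \<noteq> 0" using s by (auto simp: Gamma_eq_zero_iff elim!: nonpos_Ints_cases)
  have p2: "2 powr (s - 2) * exp ((2 - s) * of_real (ln 2)) = (1 :: complex)"
    by (simp add: powr_def Ln_of_real[of 2, simplified] exp_add[symmetric] algebra_simps)
  have sq: "complex_of_real (pi * sqrt K) / (of_real (sqrt (pi * real K)) * of_real (sqrt pi)) = 1"
  proof -
    have "sqrt (pi * real K) * sqrt pi = pi * sqrt K" by (simp add: real_sqrt_mult mult.commute mult.left_commute)
    then have "complex_of_real (sqrt (pi * real K)) * of_real (sqrt pi) = of_real (pi * sqrt K)" by (simp only: flip: of_real_mult)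
    then show ?thesis using K by simp
  qed
  have "2 powr (s - 2) / (complex_of_real (sqrt (pi * real K)) * Gamma s) * meijer_G_cal k s y =
     (2 powr (s - 2) * exp ((2 - s) * of_real (ln 2))) * (complex_of_real (pi * sqrt K) / (of_real (sqrt (pi * real K)) * of_real (sqrt pi))) * (\<Phi> + of_real y powr (s - 1) * Gamma_sin s)"
  proof -
    have "a / (q * g) * ((e * P) * (g / w * Z)) = (a * e) * (P / (q * w)) * Z" if "g \<noteq> 0" for a q g e P w Z :: complex
      using that by simp
    from this[OF Gs] show ?thesis unfolding G \<kappa>_def .
  qed
  then have "2 powr (s - 2) / (complex_of_real (sqrt (pi * real K)) * Gamma s) * meijer_G_cal k s y - complex_of_real y powr (s - 1) * Gamma_sin s = \<Phi>"
    unfolding p2 sq by simp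
  moreover have "(s + of_nat k - 2) / (1 - of_nat k) = - ((s + of_nat K - 1) / of_nat K)" "real k - 1 = real K" "of_nat k - 1 = (of_nat K :: complex)"
    by (simp_all add: k)
  ultimately show ?thesis using substituted_integral by (simp only:)
qed

end
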